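(* Let $R$ be a commutative ring, and let $G$ and $H$ be finite groups whose orders are invertible in $R$. (a) One has $$\alpha_{G,H}(RB(G,H))=(R\mathscr{S}_{G\times H})^{G\times H}=e_G*_G^\kappa(R\mathscr{S}_{G\times H})*_H^\kappa e_H.$$ (b) The double Burnside algebra $RB(G,G)$ is isomorphic (as an $R$-algebra) to $e_G*_G^\kappa(R\mathscr{S}_{G\times G})*_G^\kappa e_G$.
   Context: A $(G,H)$-biset is a finite set with commuting left $G$-action and right $H$-action; it is identified with a left $G\times H$-set via $(g,h)x=gxh^{-1}$. $B(G,H)$ is the Grothendieck group of the category of $(G,H)$-bisets with respect to disjoint unions, $[X]$ is the class of $X$, and $RB(G,H)=R\otimes_{\mathbb{Z}}B(G,H)$. For a $(G,H)$-biset $X$ and an $(H,K)$-biset $Y$, $X\times_H Y$ is the $(G,K)$-biset of $H$-orbits of $X\times Y$ under $h(x,y)=(xh^{-1},hy)$, and $[X]\cdot_H[Y]=[X\times_HY]$. The double Burnside algebra is $RB(G,G)$ with multiplication $\cdot_G$; its identity is $[G]$. For a finite group $X$, $\mathscr{S}_X$ is the set of subgroups of $X$ and $R\mathscr{S}_X$ is the free $R$-module with basis $\mathscr{S}_X$. The group $G\times H$ acts on $\mathscr{S}_{G\times H}$ by conjugation and $(R\mathscr{S}_{G\times H})^{G\times H}$ denotes the fixed points of $R\mathscr{S}_{G\times H}$. The $R$-linear map $\alpha_{G,H}\colon RB(G,H)\to R\mathscr{S}_{G\times H}$ is given by $[X]\mapsto\sum_{x\in X}\mathrm{stab}_{G\times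 H}(x)$. For $L\le G\times H$ put $k_1(L)=\{g\in G\mid (g,1)\in L\}$ and $k_2(L)=\{h\in H\mid(1,h)\in L\}$. For $L\le G\times H$ and $M\le H\times K$ put $L*M=\{(g,k)\in G\times K\mid \exists\,h\in H:\ (g,h)\in L,\ (h,k)\in M\}$. The $R$-bilinear map $-*_H^\kappa-\colon R\mathscr{S}_{G\times H}\times R\mathscr{S}_{H\times K}\to R\mathscr{S}_{G\times K}$ is given by $L*_H^\kappa M=\frac{|k_2(L)\cap k_1(M)|}{|H|}\cdot(L*M)$; with $*_G^\kappa$, $R\mathscr{S}_{G\times G}$ is an $R$-algebra. For $g\in G$, $\Delta_g(G)=\{(gxg^{-1},x)\mid x\in G\}\le G\times G$, and $e_G:=\sum_{g\in G}\Delta_g(G)\in R\mathscr{S}_{G\times G}$, which is an idempotent with respect to $*_G^\kappa$ (with identity element of $e_G*_G^\kappa(R\mathscr{S}_{G\times G})*_G^\kappa e_G$ being $e_G$). *)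

theory Defs
  imports "HOL-Algebra.Free_Abelian_Groups" "HOL-Algebra.Group_Action" "HOL-Algebra.QuotRing" "HOL-Algebra.Module"
begin

section \<open>Modules and algebras over a commutative ring\<close>

text \<open>
  All modules and algebras over \<open>R\<close> are records of type \<^typ>\<open>('r, 'e) module\<close>, which extend ring
  records. Where only a module is meant, the fields \<open>mult\<close> and \<open>one\<close> carry no information.
\<close>

definition linear_maps ::
    "('r, 'm) ring_scheme \<Rightarrow> ('r, 'a, 'p) module_scheme \<Rightarrow> ('r, 'b, 'q) module_scheme \<Rightarrow> ('a \<Rightarrow> 'b) set" where
  "linear_maps R M N = {f \<in> carrier M \<rightarrow> carrier N.
     (\<forall>x\<in>carrier M. \<forall>y\<in>carrier M. f (x \<oplus>\<^bsub>M\<^esub> y) = f x \<oplus>\<^bsub>N\<^esub> f y) \<and>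
     (\<forall>r\<in>carrier R. \<forall>x\<in>carrier M. f (r \<odot>\<^bsub>M\<^esub> x) = r \<odot>\<^bsub>N\<^esub> f x)}"

text \<open>
  The locale \<^locale>\<open>algebra\<close> of the library is restricted to commutative algebras, so isomorphisms
  of \<open>R\<close>-algebras are introduced here as the \<open>R\<close>-linear ring isomorphisms (which are unital).
\<close>

definition algebra_isomorphic ::
    "('r, 'm) ring_scheme \<Rightarrow> ('r, 'a, 'p) module_scheme \<Rightarrow> ('r, 'b, 'q) module_scheme \<Rightarrow> bool" where
  "algebra_isomorphic R A B \<longleftrightarrow> ring_iso A B \<inter> linear_maps R A B \<noteq> {}"

definition free_module :: "('r, 'm) ring_scheme \<Rightarrow> 's set \<Rightarrow> ('r, 's \<Rightarrow> 'r) module" where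
  "free_module R S =
    \<lparr>carrier = {u \<in> S \<rightarrow>\<^sub>E carrier R. finite {s \<in> S. u s \<noteq> \<zero>\<^bsub>R\<^esub>}},
     monoid.mult = undefined, one = undefined,
     zero = (\<lambda>s\<in>S. \<zero>\<^bsub>R\<^esub>),
     add = (\<lambda>u v. \<lambda>s\<in>S. u s \<oplus>\<^bsub>R\<^esub> v s),
     smult = (\<lambda>r u. \<lambda>s\<in>S. r \<otimes>\<^bsub>R\<^esub> u s)\<rparr>"

definition basis_elem :: "('r, 'm) ring_scheme \<Rightarrow> 's set \<Rightarrow> 's \<Rightarrow> ('s \<Rightarrow> 'r)" where
  "basis_elem R S t = (\<lambda>s\<in>S. if s = t then \<one>\<^bsub>R\<^esub> else \<zero>\<^bsub>R\<^esub>)"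

text \<open>
  The biadditive extension of a map \<open>f\<close> on basis elements, passed to quotients of the three free
  abelian groups: \<open>U\<close> and \<open>V\<close> are cosets, and the result is a coset of the subgroup \<open>K\<close> of the free
  abelian group on \<open>S\<close>. The union over representatives is a single coset when the operation is
  well-defined.
\<close>

definition coset_biadditive ::
    "'c set \<Rightarrow> ('c \<Rightarrow>\<^sub>0 int) set \<Rightarrow> ('a \<Rightarrow> 'b \<Rightarrow> 'c) \<Rightarrow>
     ('a \<Rightarrow>\<^sub>0 int) set \<Rightarrow> ('b \<Rightarrow>\<^sub>0 int) set \<Rightarrow> ('c \<Rightarrow>\<^sub>0 int) set" where
  "coset_biadditive S K f U V =
    (\<Union>c\<in>U. \<Union>d\<in>V. K #>\<^bsub>free_Abelian_group S\<^esub>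
       frag_extend (\<lambda>x. frag_extend (\<lambda>y. frag_of (f x y)) d) c)"

subsection \<open>The \<open>R\<close>-module \<open>R \<otimes>\<^sub>\<int> A\<close> of an abelian group \<open>A\<close>\<close>

text \<open>
  The group \<open>A\<close> is written multiplicatively. Biadditivity already implies that the tensors are
  balanced over the integers.
\<close>

definition tensor_rel ::
    "('r, 'm) ring_scheme \<Rightarrow> ('a, 'n) monoid_scheme \<Rightarrow> ('r \<times> 'a \<Rightarrow>\<^sub>0 int) set" where
  "tensor_rel R A = generate (free_Abelian_group (carrier R \<times> carrier A))
    ({frag_of (r \<oplus>\<^bsub>R\<^esub> s, a) - frag_of (r, a) - frag_of (s, a) | r s a.
        r \<in> carrier R \<and> s \<in> carrier R \<and> a \<in> carrier A} \<union>
     {frag_of (r, a \<otimes>\<^bsub>A\<^esub> b) - frag_of (r, a) - frag_of (r, b) | r a b.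
        r \<in> carrier R \<and> a \<in> carrier A \<and> b \<in> carrier A})"

definition tensor_group ::
    "('r, 'm) ring_scheme \<Rightarrow> ('a, 'n) monoid_scheme \<Rightarrow> ('r \<times> 'a \<Rightarrow>\<^sub>0 int) set monoid" where
  "tensor_group R A = free_Abelian_group (carrier R \<times> carrier A) Mod tensor_rel R A"

definition pure_tensor ::
    "('r, 'm) ring_scheme \<Rightarrow> ('a, 'n) monoid_scheme \<Rightarrow> 'r \<Rightarrow> 'a \<Rightarrow> ('r \<times> 'a \<Rightarrow>\<^sub>0 int) set" where
  "pure_tensor R A r a =
    tensor_rel R A #>\<^bsub>free_Abelian_group (carrier R \<times> carrier A)\<^esub> frag_of (r, a)"

definition tensor_module ::
    "('r, 'm) ring_scheme \<Rightarrow> ('a, 'n) monoid_scheme \<Rightarrow> ('r, ('r \<times> 'a \<Rightarrow>\<^sub>0 int) set) module" where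
  "tensor_module R A =
    \<lparr>carrier = carrier (tensor_group R A),
     monoid.mult = undefined, one = undefined,
     zero = \<one>\<^bsub>tensor_group R A\<^esub>,
     add = (\<lambda>u v. u \<otimes>\<^bsub>tensor_group R A\<^esub> v),
     smult = (\<lambda>r u. \<Union>c\<in>u. tensor_rel R A #>\<^bsub>free_Abelian_group (carrier R \<times> carrier A)\<^esub>
                frag_extend (\<lambda>(s, a). frag_of (r \<otimes>\<^bsub>R\<^esub> s, a)) c)\<rparr>"

section \<open>Bisets\<close>

record ('g, 'h, 'x) biset =
  points :: "'x set"
  lact :: "'g \<Rightarrow> 'x \<Rightarrow> 'x"
  ract :: "'x \<Rightarrow> 'h \<Rightarrow> 'x"

definition is_biset ::
    "('g, 'm) monoid_scheme \<Rightarrow> ('h, 'n) monoid_scheme \<Rightarrow> ('g, 'h, 'x) biset \<Rightarrow> bool" where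
  "is_biset G H X \<longleftrightarrow> finite (points X) \<and>
    (\<forall>g\<in>carrier G. \<forall>x\<in>points X. lact X g x \<in> points X) \<and>
    (\<forall>x\<in>points X. lact X \<one>\<^bsub>G\<^esub> x = x) \<and>
    (\<forall>g\<in>carrier G. \<forall>g'\<in>carrier G. \<forall>x\<in>points X. lact X (g \<otimes>\<^bsub>G\<^esub> g') x = lact X g (lact X g' x)) \<and>
    (\<forall>x\<in>points X. \<forall>h\<in>carrier H. ract X x h \<in> points X) \<and>
    (\<forall>x\<in>points X. ract X x \<one>\<^bsub>H\<^esub> = x) \<and>
    (\<forall>x\<in>points X. \<forall>h\<in>carrier H. \<forall>h'\<in>carrier H. ract X x (h \<otimes>\<^bsub>H\<^esub> h') = ract X (ract X x h) h') \<and>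
    (\<forall>g\<in>carrier G. \<forall>x\<in>points X. \<forall>h\<in>carrier H. ract X (lact X g x) h = lact X g (ract X x h))"

definition biset_isomorphic ::
    "('g, 'm) monoid_scheme \<Rightarrow> ('h, 'n) monoid_scheme \<Rightarrow>
     ('g, 'h, 'x) biset \<Rightarrow> ('g, 'h, 'y) biset \<Rightarrow> bool" where
  "biset_isomorphic G H X Y \<longleftrightarrow> (\<exists>f. bij_betw f (points X) (points Y) \<and>
    (\<forall>g\<in>carrier G. \<forall>x\<in>points X. f (lact X g x) = lact Y g (f x)) \<and>
    (\<forall>x\<in>points X. \<forall>h\<in>carrier H. f (ract X x h) = ract Y (f x) h))"

definition prod_act ::
    "('g, 'm) monoid_scheme \<Rightarrow> ('h, 'n) monoid_scheme \<Rightarrow> ('g, 'h, 'x) biset \<Rightarrow> 'g \<times> 'h \<Rightarrow> 'x \<Rightarrow> 'x" where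
  "prod_act G H X = (\<lambda>(g, h) x. ract X (lact X g x) (inv\<^bsub>H\<^esub> h))"

definition regular_biset :: "('g, 'm) monoid_scheme \<Rightarrow> ('g, 'g, 'g) biset" where
  "regular_biset G = \<lparr>points = carrier G, lact = (\<lambda>g x. g \<otimes>\<^bsub>G\<^esub> x), ract = (\<lambda>x h. x \<otimes>\<^bsub>G\<^esub> h)\<rparr>"

definition biset_union ::
    "('g, 'h, 'x) biset \<Rightarrow> ('g, 'h, 'y) biset \<Rightarrow> ('g, 'h, 'x + 'y) biset" where
  "biset_union X Y =
    \<lparr>points = points X <+> points Y,
     lact = (\<lambda>g. map_sum (lact X g) (lact Y g)),
     ract = (\<lambda>z h. map_sum (\<lambda>x. ract X x h) (\<lambda>y. ract Y y h) z)\<rparr>"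

definition biset_tensor ::
    "('h, 'n) monoid_scheme \<Rightarrow> ('g, 'h, 'x) biset \<Rightarrow> ('h, 'k, 'y) biset \<Rightarrow> ('g, 'k, ('x \<times> 'y) set) biset" where
  "biset_tensor H X Y =
    \<lparr>points = orbits H (points X \<times> points Y) (\<lambda>h (x, y). (ract X x (inv\<^bsub>H\<^esub> h), lact Y h y)),
     lact = (\<lambda>g B. (\<lambda>(x, y). (lact X g x, y)) ` B),
     ract = (\<lambda>B k. (\<lambda>(x, y). (x, ract Y y k)) ` B)\<rparr>"

section \<open>Burnside groups\<close>

subsection \<open>The Grothendieck group of a commutative monoid\<close>

definition grothendieck_rel :: "('a, 'm) monoid_scheme \<Rightarrow> ('a \<Rightarrow>\<^sub>0 int) set" where
  "grothendieck_rel M = generate (free_Abelian_group (carrier M))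
    {frag_of (x \<otimes>\<^bsub>M\<^esub> y) - frag_of x - frag_of y | x y. x \<in> carrier M \<and> y \<in> carrier M}"

definition grothendieck_group :: "('a, 'm) monoid_scheme \<Rightarrow> ('a \<Rightarrow>\<^sub>0 int) set monoid" where
  "grothendieck_group M = free_Abelian_group (carrier M) Mod grothendieck_rel M"

definition grothendieck_class :: "('a, 'm) monoid_scheme \<Rightarrow> 'a \<Rightarrow> ('a \<Rightarrow>\<^sub>0 int) set" where
  "grothendieck_class M x = grothendieck_rel M #>\<^bsub>free_Abelian_group (carrier M)\<^esub> frag_of x"

subsection \<open>The group \<open>B(G,H)\<close>\<close>

text \<open>
  Since bisets are finite, each of them, whatever the type of its points, is isomorphic to one whose
  points are natural numbers. The isomorphism class of a biset is therefore represented by the set of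
  all bisets on natural numbers which are isomorphic to it.
\<close>

type_synonym ('g, 'h) biset_class = "('g, 'h, nat) biset set"

definition iso_class ::
    "('g, 'm) monoid_scheme \<Rightarrow> ('h, 'n) monoid_scheme \<Rightarrow> ('g, 'h, 'x) biset \<Rightarrow> ('g, 'h) biset_class" where
  "iso_class G H X = {Y. is_biset G H Y \<and> biset_isomorphic G H Y X}"

definition biset_monoid ::
    "('g, 'm) monoid_scheme \<Rightarrow> ('h, 'n) monoid_scheme \<Rightarrow> ('g, 'h) biset_class monoid" where
  "biset_monoid G H =
    \<lparr>carrier = {iso_class G H X | X :: ('g, 'h, nat) biset. is_biset G H X},
     monoid.mult = (\<lambda>x y. \<Union>X\<in>x. \<Union>Y\<in>y. iso_class G H (biset_union X Y)),
     one = {X. is_biset G H X \<and> points X = {}}\<rparr>"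

type_synonym ('g, 'h) burnside = "(('g, 'h) biset_class \<Rightarrow>\<^sub>0 int) set"

definition burnside_group ::
    "('g, 'm) monoid_scheme \<Rightarrow> ('h, 'n) monoid_scheme \<Rightarrow> ('g, 'h) burnside monoid" where
  "burnside_group G H = grothendieck_group (biset_monoid G H)"

definition burnside_class ::
    "('g, 'm) monoid_scheme \<Rightarrow> ('h, 'n) monoid_scheme \<Rightarrow> ('g, 'h, 'x) biset \<Rightarrow> ('g, 'h) burnside" where
  "burnside_class G H X = grothendieck_class (biset_monoid G H) (iso_class G H X)"

text \<open>The biadditive product determined by \<open>[X] \<cdot>\<^sub>H [Y] = [X \<times>\<^sub>H Y]\<close>.\<close>

definition burnside_mult ::
    "('g, 'm) monoid_scheme \<Rightarrow> ('h, 'n) monoid_scheme \<Rightarrow> ('k, 'p) monoid_scheme \<Rightarrow>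
     ('g, 'h) burnside \<Rightarrow> ('h, 'k) burnside \<Rightarrow> ('g, 'k) burnside" where
  "burnside_mult G H K =
    coset_biadditive (carrier (biset_monoid G K)) (grothendieck_rel (biset_monoid G K))
      (\<lambda>x y. \<Union>X\<in>x. \<Union>Y\<in>y. iso_class G K (biset_tensor H X Y))"

subsection \<open>The module \<open>RB(G,H)\<close> and the algebra \<open>RB(G,G)\<close>\<close>

type_synonym ('r, 'g, 'h) burnside_tensor = "('r \<times> ('g, 'h) burnside \<Rightarrow>\<^sub>0 int) set"

definition burnside_module ::
    "('r, 's) ring_scheme \<Rightarrow> ('g, 'm) monoid_scheme \<Rightarrow> ('h, 'n) monoid_scheme \<Rightarrow>
     ('r, ('r, 'g, 'h) burnside_tensor) module" where
  "burnside_module R G H = tensor_module R (burnside_group G H)"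

definition burnside_module_class ::
    "('r, 's) ring_scheme \<Rightarrow> ('g, 'm) monoid_scheme \<Rightarrow> ('h, 'n) monoid_scheme \<Rightarrow>
     ('g, 'h, 'x) biset \<Rightarrow> ('r, 'g, 'h) burnside_tensor" where
  "burnside_module_class R G H X = pure_tensor R (burnside_group G H) \<one>\<^bsub>R\<^esub> (burnside_class G H X)"

text \<open>The product determined by \<open>(r \<otimes> b) \<cdot>\<^sub>H (s \<otimes> c) = rs \<otimes> (b \<cdot>\<^sub>H c)\<close>.\<close>

definition burnside_module_mult ::
    "('r, 's) ring_scheme \<Rightarrow> ('g, 'm) monoid_scheme \<Rightarrow> ('h, 'n) monoid_scheme \<Rightarrow> ('k, 'p) monoid_scheme \<Rightarrow>
     ('r, 'g, 'h) burnside_tensor \<Rightarrow> ('r, 'h, 'k) burnside_tensor \<Rightarrow> ('r, 'g, 'k) burnside_tensor" where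
  "burnside_module_mult R G H K =
    coset_biadditive (carrier R \<times> carrier (burnside_group G K)) (tensor_rel R (burnside_group G K))
      (\<lambda>(r, b) (s, c). (r \<otimes>\<^bsub>R\<^esub> s, burnside_mult G H K b c))"

definition double_burnside_algebra ::
    "('r, 's) ring_scheme \<Rightarrow> ('g, 'm) monoid_scheme \<Rightarrow> ('r, ('r, 'g, 'g) burnside_tensor) module" where
  "double_burnside_algebra R G =
    (burnside_module R G G)\<lparr>monoid.mult := burnside_module_mult R G G G,
                            one := burnside_module_class R G G (regular_biset G)\<rparr>"

section \<open>The free module on the subgroups of \<open>G \<times> H\<close>\<close>

definition subgroups_of :: "('a, 'm) monoid_scheme \<Rightarrow> 'a set set" where
  "subgroups_of X = {L. subgroup L X}"

definition subgroup_module :: "('r, 's) ring_scheme \<Rightarrow> ('a, 'm) monoid_scheme \<Rightarrow> ('r, 'a set \<Rightarrow> 'r) module" where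
  "subgroup_module R X = free_module R (subgroups_of X)"

definition subgroup_basis :: "('r, 's) ring_scheme \<Rightarrow> ('a, 'm) monoid_scheme \<Rightarrow> 'a set \<Rightarrow> ('a set \<Rightarrow> 'r)" where
  "subgroup_basis R X L = basis_elem R (subgroups_of X) L"

definition conj_act ::
    "('r, 's) ring_scheme \<Rightarrow> ('a, 'm) monoid_scheme \<Rightarrow> 'a \<Rightarrow> ('a set \<Rightarrow> 'r) \<Rightarrow> ('a set \<Rightarrow> 'r)" where
  "conj_act R X x u = (\<Oplus>\<^bsub>subgroup_module R X\<^esub>L\<in>subgroups_of X.
     u L \<odot>\<^bsub>subgroup_module R X\<^esub> subgroup_basis R X (x <#\<^bsub>X\<^esub> L #>\<^bsub>X\<^esub> inv\<^bsub>X\<^esub> x))"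

definition conj_fixed :: "('r, 's) ring_scheme \<Rightarrow> ('a, 'm) monoid_scheme \<Rightarrow> ('a set \<Rightarrow> 'r) set" where
  "conj_fixed R X = {u \<in> carrier (subgroup_module R X). \<forall>x\<in>carrier X. conj_act R X x u = u}"

text \<open>
  Extensionality makes the \<open>R\<close>-linear map \<open>\<alpha>\<close> unique as a total function.
\<close>

definition alpha ::
    "('r, 's) ring_scheme \<Rightarrow> ('g, 'm) monoid_scheme \<Rightarrow> ('h, 'n) monoid_scheme \<Rightarrow>
     ('r, 'g, 'h) burnside_tensor \<Rightarrow> (('g \<times> 'h) set \<Rightarrow> 'r)" where
  "alpha R G H = (THE f.
     f \<in> linear_maps R (burnside_module R G H) (subgroup_module R (G \<times>\<times> H)) \<and>
     f \<in> extensional (carrier (burnside_module R G H)) \<and>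
     (\<forall>X :: ('g, 'h, nat) biset. is_biset G H X \<longrightarrow>
        f (burnside_module_class R G H X) =
          (\<Oplus>\<^bsub>subgroup_module R (G \<times>\<times> H)\<^esub>x\<in>points X.
             subgroup_basis R (G \<times>\<times> H) (stabilizer (G \<times>\<times> H) (prod_act G H X) x))))"

definition k1 :: "('g, 'm) monoid_scheme \<Rightarrow> ('h, 'n) monoid_scheme \<Rightarrow> ('g \<times> 'h) set \<Rightarrow> 'g set" where
  "k1 G H L = {g \<in> carrier G. (g, \<one>\<^bsub>H\<^esub>) \<in> L}"

definition k2 :: "('g, 'm) monoid_scheme \<Rightarrow> ('h, 'n) monoid_scheme \<Rightarrow> ('g \<times> 'h) set \<Rightarrow> 'h set" where
  "k2 G H L = {h \<in> carrier H. (\<one>\<^bsub>G\<^esub>, h) \<in> L}"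

text \<open>
  The subgroup \<open>L * M\<close> is the relational composite \<^term>\<open>L O M\<close>. The quotient
  \<open>|k\<^sub>2(L) \<inter> k\<^sub>1(M)| / |H|\<close> is taken in \<open>R\<close>, where \<open>|H|\<close> is assumed to be invertible.
\<close>

definition kappa ::
    "('r, 's) ring_scheme \<Rightarrow> ('g, 'm) monoid_scheme \<Rightarrow> ('h, 'n) monoid_scheme \<Rightarrow> ('k, 'p) monoid_scheme \<Rightarrow>
     ('g \<times> 'h) set \<Rightarrow> ('h \<times> 'k) set \<Rightarrow> 'r" where
  "kappa R G H K L M =
    ([card (k2 G H L \<inter> k1 H K M)] \<cdot>\<^bsub>R\<^esub> \<one>\<^bsub>R\<^esub>) \<otimes>\<^bsub>R\<^esub> inv\<^bsub>R\<^esub> ([order H] \<cdot>\<^bsub>R\<^esub> \<one>\<^bsub>R\<^esub>)"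

definition star_kappa ::
    "('r, 's) ring_scheme \<Rightarrow> ('g, 'm) monoid_scheme \<Rightarrow> ('h, 'n) monoid_scheme \<Rightarrow> ('k, 'p) monoid_scheme \<Rightarrow>
     (('g \<times> 'h) set \<Rightarrow> 'r) \<Rightarrow> (('h \<times> 'k) set \<Rightarrow> 'r) \<Rightarrow> (('g \<times> 'k) set \<Rightarrow> 'r)" where
  "star_kappa R G H K u v =
    (\<Oplus>\<^bsub>subgroup_module R (G \<times>\<times> K)\<^esub>L\<in>subgroups_of (G \<times>\<times> H).
     \<Oplus>\<^bsub>subgroup_module R (G \<times>\<times> K)\<^esub>M\<in>subgroups_of (H \<times>\<times> K).
       (u L \<otimes>\<^bsub>R\<^esub> v M \<otimes>\<^bsub>R\<^esub> kappa R G H K L M)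
         \<odot>\<^bsub>subgroup_module R (G \<times>\<times> K)\<^esub> subgroup_basis R (G \<times>\<times> K) (L O M))"

definition twisted_diag :: "('g, 'm) monoid_scheme \<Rightarrow> 'g \<Rightarrow> ('g \<times> 'g) set" where
  "twisted_diag G g = {(g \<otimes>\<^bsub>G\<^esub> x \<otimes>\<^bsub>G\<^esub> inv\<^bsub>G\<^esub> g, x) | x. x \<in> carrier G}"

definition e_idem :: "('r, 's) ring_scheme \<Rightarrow> ('g, 'm) monoid_scheme \<Rightarrow> (('g \<times> 'g) set \<Rightarrow> 'r)" where
  "e_idem R G =
    (\<Oplus>\<^bsub>subgroup_module R (G \<times>\<times> G)\<^esub>g\<in>carrier G. subgroup_basis R (G \<times>\<times> G) (twisted_diag G g))"

definition e_corner ::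
    "('r, 's) ring_scheme \<Rightarrow> ('g, 'm) monoid_scheme \<Rightarrow> ('h, 'n) monoid_scheme \<Rightarrow> (('g \<times> 'h) set \<Rightarrow> 'r) set" where
  "e_corner R G H =
    {star_kappa R G H H (star_kappa R G G H (e_idem R G) u) (e_idem R H) | u.
       u \<in> carrier (subgroup_module R (G \<times>\<times> H))}"

definition e_corner_algebra ::
    "('r, 's) ring_scheme \<Rightarrow> ('g, 'm) monoid_scheme \<Rightarrow> ('r, ('g \<times> 'g) set \<Rightarrow> 'r) module" where
  "e_corner_algebra R G =
    (subgroup_module R (G \<times>\<times> G))\<lparr>carrier := e_corner R G G,
                                  monoid.mult := star_kappa R G G G,
                                  one := e_idem R G\<rparr>"

end

theory Submission
  imports Defs
begin

text \<open>
  Put \<open>T = G \<times> H\<close>. The key to everything is the stabilizer count of a biset \<open>X\<close>: the function that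
  assigns to each subgroup \<open>L\<close> of \<open>T\<close> the number of points of \<open>X\<close> with stabilizer exactly \<open>L\<close>. It is
  additive on disjoint unions, and it determines \<open>X\<close> up to isomorphism, because one can match a point
  of \<open>X\<close> with a point of \<open>Y\<close> of the same stabilizer, remove the two isomorphic orbits, and repeat
  (\<open>biset_isomorphic_iff_mark\<close>). The map \<open>\<alpha>\<close> sends \<open>[X]\<close> to this function read in \<open>R\<close>.

  An inverse of \<open>\<alpha>\<close> is built from the transitive bisets: let \<open>\<beta>(L) = |L|/|T| [T/L]\<close>. The stabilizers of
  the points of \<open>T/L\<close> are the conjugates of \<open>L\<close>, each \<open>tL\<close> arising from \<open>|L|\<close> elements \<open>t\<close>; so \<open>\<alpha> \<circ> \<beta>\<close> is
  the average over conjugation by \<open>T\<close> (\<open>alpha_beta\<close>). Conversely \<open>\<beta> \<circ> \<alpha>\<close> is the identity, because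
  \<open>|T|\<close> copies of \<open>X\<close> and the disjoint union over \<open>x \<in> X\<close> of \<open>|stab x|\<close> copies of \<open>T/stab x\<close> have the same
  stabilizer counts (\<open>sum_mark_transporters\<close>, \<open>beta_alpha\<close>). On the other side, \<open>\<Delta>\<^sub>g * L * \<Delta>\<^sub>h\<close> is the conjugate
  of \<open>L\<close> by \<open>(g, h\<^sup>-\<^sup>1)\<close> and the scalars that occur are \<open>1/|G|\<close> and \<open>1/|H|\<close>, so that \<open>u \<mapsto> e\<^sub>G * u * e\<^sub>H\<close> is the
  same average (\<open>corner_eq_average\<close>). The three sets of part (a) are therefore all equal to
  the image of one projection, and \<open>\<alpha>\<close> is injective.

  For part (b) it remains to see that \<open>\<alpha>\<close> is multiplicative. The stabilizer of the orbit of \<open>(x, y)\<close> in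
  \<open>X \<times>\<^sub>H Y\<close> is \<open>stab x * stab y\<close>, and that orbit consists of \<open>|H| / |k\<^sub>2(stab x) \<inter> k\<^sub>1(stab y)|\<close> pairs.
  Summing over pairs instead of orbits produces exactly the factor \<open>\<kappa>\<close> (\<open>mark_tensor\<close>, \<open>alpha_mult\<close>).
  The same formula shows that the product of isomorphism classes is well-defined and biadditive:
  after multiplication by \<open>|H|\<close> both sides of each such claim have visibly equal stabilizer counts.
\<close>

section \<open>Abelian groups given by generators and relations\<close>

(* Products in quotients are computed on representatives, not as set products of cosets. *)
declare mult_FactGroup [simp del]

lemmas free_induct = free_Abelian_group_induct [consumes 1, case_names zero diff gen]

text \<open>
Both the Burnside group and the tensor product are quotients of a free abelian group by the subgroup
generated by a set \<open>A\<close> of relators.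
\<close>
locale presentation =
  fixes S :: "'a set" and A :: "('a \<Rightarrow>\<^sub>0 int) set"
  assumes relators: "\<And>a. a \<in> A \<Longrightarrow> Poly_Mapping.keys a \<subseteq> S"
begin

abbreviation F where "F \<equiv> free_Abelian_group S"
abbreviation K where "K \<equiv> generate F A"
abbreviation Q where "Q \<equiv> F Mod K"
abbreviation cls where "cls c \<equiv> K #>\<^bsub>F\<^esub> c"

lemma K_subgroup: "subgroup K F"
  using relators by (intro group.generate_is_subgroup) auto

lemma K_normal: "K \<lhd> F"
  by (rule comm_group.subgroup_imp_normal[OF abelian_free_Abelian_group K_subgroup])

lemma comm_group_quotient: "comm_group Q"
  by (intro comm_group.abelian_FactGroup abelian_free_Abelian_group K_subgroup)

lemma K_keys: "c \<in> K \<Longrightarrow> Poly_Mapping.keys c \<subseteq> S"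
  using subgroup.mem_carrier[OF K_subgroup, of c] by simp

lemma K_add: "c \<in> K \<Longrightarrow> d \<in> K \<Longrightarrow> c + d \<in> K"
  using subgroup.m_closed[OF K_subgroup] by simp

lemma K_zero: "0 \<in> K"
  using subgroup.one_closed[OF K_subgroup] by simp

lemma K_uminus: "c \<in> K \<Longrightarrow> - c \<in> K"
  using subgroup.m_inv_closed[OF K_subgroup, of c] K_keys[of c] by simp

lemma K_diff: "c \<in> K \<Longrightarrow> d \<in> K \<Longrightarrow> c - d \<in> K"
  using K_add[OF _ K_uminus] by fastforce

lemma mem_cls: "x \<in> cls c \<longleftrightarrow> x - c \<in> K"
proof -
  have "x \<in> cls c \<longleftrightarrow> (\<exists>k\<in>K. x = k + c)"
    by (auto simp: r_coset_def)
  then show ?thesis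
    by (metis add_diff_cancel diff_add_cancel)
qed

lemma cls_self: "c \<in> cls c"
  by (simp add: mem_cls K_zero)

lemma cls_eq_iff: "cls c = cls d \<longleftrightarrow> c - d \<in> K"
proof
  assume "cls c = cls d"
  then show "c - d \<in> K"
    using cls_self mem_cls by metis
next
  assume cd: "c - d \<in> K"
  have "x - c \<in> K \<longleftrightarrow> x - d \<in> K" for x
    using K_add[of "x - c" "c - d"] K_diff[of "x - d" "c - d"] cd by auto
  then show "cls c = cls d"
    by (auto simp: mem_cls set_eq_iff)
qed

lemma carrier_quotient: "carrier Q = cls ` {c. Poly_Mapping.keys c \<subseteq> S}"
  by (auto simp: FactGroup_def RCOSETS_def)

lemma cls_in_carrier: "Poly_Mapping.keys c \<subseteq> S \<Longrightarrow> cls c \<in> carrier Q"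
  by (auto simp: carrier_quotient)

lemma gen_in_carrier: "x \<in> S \<Longrightarrow> cls (frag_of x) \<in> carrier Q"
  by (intro cls_in_carrier) simp

lemma mult_cls:
  "Poly_Mapping.keys c \<subseteq> S \<Longrightarrow> Poly_Mapping.keys d \<subseteq> S \<Longrightarrow> cls c \<otimes>\<^bsub>Q\<^esub> cls d = cls (c + d)"
  using normal.rcos_sum[OF K_normal, of c d] by (simp add: mult_FactGroup)

lemma one_cls: "\<one>\<^bsub>Q\<^esub> = cls 0"
proof -
  have "x \<in> K \<longleftrightarrow> x \<in> cls 0" for x by (simp add: mem_cls)
  then show ?thesis by (auto simp: FactGroup_def)
qed

text \<open>
The last rule has the form of a cancellation so that it fits equations between additive maps, where
the values at \<open>w\<close> and \<open>u + w\<close> determine the value at \<open>u\<close>.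
\<close>
lemma quotient_induct [consumes 1, case_names zero gen diff]:
  assumes u: "u \<in> carrier Q"
    and zero: "P \<one>\<^bsub>Q\<^esub>"
    and gen: "\<And>x. x \<in> S \<Longrightarrow> P (cls (frag_of x))"
    and diff: "\<And>u v w. \<lbrakk>u \<in> carrier Q; v \<in> carrier Q; w \<in> carrier Q;
                 P v; P w; v = u \<otimes>\<^bsub>Q\<^esub> w\<rbrakk> \<Longrightarrow> P u"
  shows "P u"
proof -
  obtain c where c: "Poly_Mapping.keys c \<subseteq> S" "u = cls c"
    using u carrier_quotient by auto
  have "P (cls c)" using c(1)
  proof (induction rule: free_induct)
    case zero show ?case using assms(2) unfolding one_cls .
  next
    case (diff x y)
    have k: "Poly_Mapping.keys (x - y) \<subseteq> S"
      using diff(1,2) keys_diff[of x y] by blast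
    show ?case
      by (rule assms(4)[of _ "cls x" "cls y"])
         (use diff k in \<open>auto simp: mult_cls cls_in_carrier\<close>)
  next
    case (gen a) then show ?case by (rule assms(3))
  qed
  then show ?thesis using c by simp
qed

text \<open>
The homomorphism on the free group has all relators in its kernel and so passes to the quotient.
\<close>
lemma hom_from_presentation:
  assumes N: "comm_group N" and f: "\<And>x. x \<in> S \<Longrightarrow> f x \<in> carrier N"
    and rel: "\<And>h a. \<lbrakk>h \<in> hom F N; \<And>x. x \<in> S \<Longrightarrow> h (frag_of x) = f x; a \<in> A\<rbrakk> \<Longrightarrow> h a = \<one>\<^bsub>N\<^esub>"
  obtains g where "g \<in> hom Q N" "\<And>x. x \<in> S \<Longrightarrow> g (cls (frag_of x)) = f x"
proof -
  interpret N: comm_group N by fact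
  obtain h where h: "h \<in> hom F N" "\<And>x. x \<in> S \<Longrightarrow> h (frag_of x) = f x"
    using N.free_Abelian_group_universal[of f S] f by (metis image_subset_iff)
  interpret h: group_hom F N h
    using h(1) by (simp add: group_hom_def group_hom_axioms_def N.is_group)
  have "A \<subseteq> kernel F N h"
    using rel[OF h] relators by (auto simp: kernel_def)
  then have "K \<subseteq> kernel F N h"
    using group.generate_subgroup_incl[OF group_free_Abelian_group] h.subgroup_kernel by blast
  then obtain g where g: "g \<in> hom Q N" "\<And>x. x \<in> carrier F \<Longrightarrow> g (cls x) = h x"
    using h.FactGroup_universal_kernel[OF K_normal] by blast
  show thesis
    by (rule that[OF g(1)]) (use g(2) h(2) in auto)
qed

lemma additive_maps_K:
  assumes T: "\<And>c d. T (c - d) = T c - (T d :: 'b \<Rightarrow>\<^sub>0 int)" and P: "presentation S' A'"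
    and rel: "\<And>a. a \<in> A \<Longrightarrow> T a \<in> generate (free_Abelian_group S') A'" and c: "c \<in> K"
  shows "T c \<in> generate (free_Abelian_group S') A'"
proof -
  interpret P': presentation S' A' by fact
  have T0: "T 0 = 0" using T[of 0 0] by simp
  have Tm: "T (- c) = - T c" for c using T[of 0 c] T0 by simp
  have Ta: "T (c + d) = T c + T d" for c d using T[of c "- d"] Tm by simp
  show ?thesis using c
  proof induction
    case one then show ?case by (simp add: T0 P'.K_zero)
  next
    case (incl h) then show ?case by (rule rel)
  next
    case (inv h) then show ?case using relators P'.K_uminus[OF rel] by (simp add: Tm)
  next
    case (eng h1 h2) then show ?case by (simp add: Ta P'.K_add)
  qed
qed

text \<open>
Two representatives differ by an element of the relation subgroup, which \<open>T\<close> maps into the relation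
subgroup of the target as soon as this holds for the relators. So all members of the union coincide.
\<close>
lemma union_over_coset:
  assumes T: "\<And>c d. T (c - d) = T c - (T d :: 'b \<Rightarrow>\<^sub>0 int)" and P: "presentation S' A'"
    and rel: "\<And>a. a \<in> A \<Longrightarrow> T a \<in> generate (free_Abelian_group S') A'"
  shows "(\<Union>c\<in>cls c0. generate (free_Abelian_group S') A' #>\<^bsub>free_Abelian_group S'\<^esub> T c)
         = generate (free_Abelian_group S') A' #>\<^bsub>free_Abelian_group S'\<^esub> T c0"
proof -
  interpret P': presentation S' A' by fact
  have "P'.cls (T c) = P'.cls (T c0)" if "c \<in> cls c0" for c
    using additive_maps_K[OF T P rel, of "c - c0"] that by (simp add: P'.cls_eq_iff mem_cls T)
  then show ?thesis using cls_self[of c0] by blast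
qed

end

lemma frag_extend_keys:
  assumes "\<And>x. x \<in> S \<Longrightarrow> Poly_Mapping.keys (T x) \<subseteq> S'" "Poly_Mapping.keys c \<subseteq> S"
  shows "Poly_Mapping.keys (frag_extend T c) \<subseteq> S'"
  using keys_frag_extend[of T c] assms by blast

text \<open>
To pass a biadditive map to quotients it suffices to test relators of one side against generators of
the other: additivity in each argument extends the conclusion from generators to all elements of the
free group, and then from relators to the subgroup that they generate.
\<close>
locale biadditive_extension =
  P1: presentation S1 A1 + P2: presentation S2 A2 + P3: presentation S3 A3
  for S1 :: "'a set" and A1 and S2 :: "'b set" and A2 and S3 :: "'c set" and A3 +
  fixes f :: "'a \<Rightarrow> 'b \<Rightarrow> 'c"
  assumes f_closed: "\<And>x y. x \<in> S1 \<Longrightarrow> y \<in> S2 \<Longrightarrow> f x y \<in> S3"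
    and rel1: "\<And>a y. a \<in> A1 \<Longrightarrow> y \<in> S2 \<Longrightarrow> frag_extend (\<lambda>x. frag_of (f x y)) a \<in> P3.K"
    and rel2: "\<And>x b. x \<in> S1 \<Longrightarrow> b \<in> A2 \<Longrightarrow> frag_extend (\<lambda>y. frag_of (f x y)) b \<in> P3.K"
begin

abbreviation B where "B c d \<equiv> frag_extend (\<lambda>x. frag_extend (\<lambda>y. frag_of (f x y)) d) c"

lemma B_diff_left: "B (c - c') d = B c d - B c' d"
  by (simp add: frag_extend_diff)

lemma B_diff_right: "B c (d - d') = B c d - B c d'"
proof (rule free_Abelian_group_induct[of c UNIV])
  fix x y assume "B x (d - d') = B x d - B x d'" "B y (d - d') = B y d - B y d'"
  then show "B (x - y) (d - d') = B (x - y) d - B (x - y) d'"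
    by (simp only: B_diff_left) simp
next
  fix a show "B (frag_of a) (d - d') = B (frag_of a) d - B (frag_of a) d'"
    by (simp only: frag_extend_of frag_extend_diff)
qed simp_all

lemma B_zero_right: "B c 0 = 0"
  using B_diff_right[where c = c and d = 0 and d' = 0] by simp

lemma B_add_right: "B c (d + d') = B c d + B c d'"
  using B_diff_right[where c = c and d = d and d' = "- d'"]
    B_diff_right[where c = c and d = 0 and d' = d'] B_zero_right[of c] by simp

lemma B_keys: "Poly_Mapping.keys c \<subseteq> S1 \<Longrightarrow> Poly_Mapping.keys d \<subseteq> S2 \<Longrightarrow> Poly_Mapping.keys (B c d) \<subseteq> S3"
  by (intro frag_extend_keys[where S = S1] frag_extend_keys[where S = S2]) (auto simp: f_closed)

lemma B_left_K:
  assumes "c \<in> P1.K" "Poly_Mapping.keys d \<subseteq> S2"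
  shows "B c d \<in> P3.K"
proof -
  have "B a d \<in> P3.K" if "a \<in> A1" for a
    using assms(2)
  proof (induction rule: free_induct)
    case zero show ?case by (simp only: B_zero_right P3.K_zero)
  next
    case (diff x y) then show ?case by (simp only: B_diff_right P3.K_diff)
  next
    case (gen y) then show ?case using rel1[OF that] by simp
  qed
  then show ?thesis
    by (rule P1.additive_maps_K[OF B_diff_left P3.presentation_axioms _ assms(1)])
qed

lemma B_right_K:
  assumes "Poly_Mapping.keys c \<subseteq> S1" "d \<in> P2.K"
  shows "B c d \<in> P3.K"
proof -
  have "B c a \<in> P3.K" if "a \<in> A2" for a
    using assms(1)
  proof (induction rule: free_induct)
    case zero show ?case by (simp add: P3.K_zero)
  next
    case (diff x y) then show ?case by (simp only: B_diff_left P3.K_diff)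
  next
    case (gen y) then show ?case using rel2[OF _ that] by simp
  qed
  then show ?thesis
    by (rule P2.additive_maps_K[OF B_diff_right P3.presentation_axioms _ assms(2)])
qed

abbreviation ext where "ext \<equiv> coset_biadditive S3 P3.K f"

lemma ext_cls:
  assumes c: "Poly_Mapping.keys c \<subseteq> S1" and d: "Poly_Mapping.keys d \<subseteq> S2"
  shows "ext (P1.cls c) (P2.cls d) = P3.cls (B c d)"
proof -
  have *: "P3.cls (B c' d') = P3.cls (B c d)" if "c' \<in> P1.cls c" "d' \<in> P2.cls d" for c' d'
  proof -
    have k: "c' - c \<in> P1.K" "d' - d \<in> P2.K"
      using that by (auto simp: P1.mem_cls P2.mem_cls)
    have "B c' d' - B c d = B (c' - c) d' + B c (d' - d)"
      by (simp add: B_diff_left B_diff_right)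
    moreover have "Poly_Mapping.keys d' \<subseteq> S2"
      using P2.K_keys[OF k(2)] d keys_add[of "d' - d" d] by auto
    ultimately show ?thesis
      using B_left_K[OF k(1)] B_right_K[OF c k(2)] P3.K_add by (simp add: P3.cls_eq_iff)
  qed
  have "ext (P1.cls c) (P2.cls d) = (\<Union>c'\<in>P1.cls c. \<Union>d'\<in>P2.cls d. P3.cls (B c' d'))"
    by (simp add: coset_biadditive_def)
  also have "\<dots> = P3.cls (B c d)"
    using * P1.cls_self[of c] P2.cls_self[of d] by blast
  finally show ?thesis .
qed

lemma ext_gen: "x \<in> S1 \<Longrightarrow> y \<in> S2 \<Longrightarrow> ext (P1.cls (frag_of x)) (P2.cls (frag_of y)) = P3.cls (frag_of (f x y))"
  by (simp add: ext_cls)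

lemma ext_closed:
  assumes "u \<in> carrier P1.Q" "v \<in> carrier P2.Q"
  shows "ext u v \<in> carrier P3.Q"
proof -
  obtain c d where "u = P1.cls c" "Poly_Mapping.keys c \<subseteq> S1" "v = P2.cls d" "Poly_Mapping.keys d \<subseteq> S2"
    using assms unfolding P1.carrier_quotient P2.carrier_quotient by blast
  then show ?thesis by (simp only: ext_cls P3.cls_in_carrier B_keys)
qed

lemma ext_add_left:
  assumes "u \<in> carrier P1.Q" "u' \<in> carrier P1.Q" "v \<in> carrier P2.Q"
  shows "ext (u \<otimes>\<^bsub>P1.Q\<^esub> u') v = ext u v \<otimes>\<^bsub>P3.Q\<^esub> ext u' v"
proof -
  obtain c c' d where *: "u = P1.cls c" "Poly_Mapping.keys c \<subseteq> S1" "u' = P1.cls c'" "Poly_Mapping.keys c' \<subseteq> S1"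
      "v = P2.cls d" "Poly_Mapping.keys d \<subseteq> S2"
    using assms unfolding P1.carrier_quotient P2.carrier_quotient by blast
  moreover have "Poly_Mapping.keys (c + c') \<subseteq> S1"
    using * keys_add[of c c'] by blast
  ultimately show ?thesis
    by (simp only: P1.mult_cls P3.mult_cls ext_cls B_keys frag_extend_add)
qed

lemma ext_add_right:
  assumes "u \<in> carrier P1.Q" "v \<in> carrier P2.Q" "v' \<in> carrier P2.Q"
  shows "ext u (v \<otimes>\<^bsub>P2.Q\<^esub> v') = ext u v \<otimes>\<^bsub>P3.Q\<^esub> ext u v'"
proof -
  obtain c d d' where *: "u = P1.cls c" "Poly_Mapping.keys c \<subseteq> S1" "v = P2.cls d" "Poly_Mapping.keys d \<subseteq> S2"
      "v' = P2.cls d'" "Poly_Mapping.keys d' \<subseteq> S2"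
    using assms unfolding P1.carrier_quotient P2.carrier_quotient by blast
  moreover have "Poly_Mapping.keys (d + d') \<subseteq> S2"
    using * keys_add[of d d'] by blast
  ultimately show ?thesis
    by (simp only: P2.mult_cls P3.mult_cls ext_cls B_keys B_add_right)
qed

end

section \<open>The tensor product as a module\<close>

abbreviation frag_relator where
  "frag_relator x y z \<equiv> frag_of x - frag_of y - (frag_of z :: _ \<Rightarrow>\<^sub>0 int)"

lemma keys_relator:
  "x \<in> S \<Longrightarrow> y \<in> S \<Longrightarrow> z \<in> S \<Longrightarrow> Poly_Mapping.keys (frag_relator x y z) \<subseteq> S"
  using keys_diff[of "frag_of x - frag_of y" "frag_of z"] keys_diff[of "frag_of x" "frag_of y"] by auto

text \<open>
All relators of this development have the form \<open>x - y - z\<close>; this is how they are shown to be killed.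
\<close>
lemma hom_frag_relator:
  assumes "abelian_group N" and h: "h \<in> hom (free_Abelian_group S) (add_monoid N)"
    and xyz: "x \<in> S" "y \<in> S" "z \<in> S" and eq: "h (frag_of x) = h (frag_of y) \<oplus>\<^bsub>N\<^esub> h (frag_of z)"
  shows "h (frag_relator x y z) = \<zero>\<^bsub>N\<^esub>"
proof -
  interpret N: abelian_group N by fact
  interpret h: group_hom "free_Abelian_group S" "add_monoid N" h
    using h by (simp add: group_hom_def group_hom_axioms_def N.a_group)
  have k: "Poly_Mapping.keys (frag_relator x y z) \<subseteq> S"
    using xyz by (rule keys_relator)
  have "h (frag_relator x y z + (frag_of y + frag_of z)) = h (frag_relator x y z) \<oplus>\<^bsub>N\<^esub> (h (frag_of y) \<oplus>\<^bsub>N\<^esub> h (frag_of z))"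
    using h.hom_mult[of "frag_relator x y z" "frag_of y + frag_of z"] h.hom_mult[of "frag_of y" "frag_of z"] xyz k
      keys_add[of "frag_of y" "frag_of z"] by auto
  moreover have "h (frag_relator x y z) \<in> carrier N" "h (frag_of x) \<in> carrier N"
    using h.hom_closed[of "frag_relator x y z"] h.hom_closed[of "frag_of x"] k xyz by auto
  ultimately show ?thesis
    using eq by (simp add: N.add.r_cancel_one')
qed

locale tensor = R: cring R + A: comm_group A for R :: "('r, 'm) ring_scheme" (structure) and A :: "('a, 'n) monoid_scheme"
begin

definition tensor_relators where
  "tensor_relators = {frag_of (r \<oplus> s, a) - frag_of (r, a) - frag_of (s, a) | r s a.
        r \<in> carrier R \<and> s \<in> carrier R \<and> a \<in> carrier A} \<union>
     {frag_of (r, a \<otimes>\<^bsub>A\<^esub> b) - frag_of (r, a) - frag_of (r, b) | r a b.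
        r \<in> carrier R \<and> a \<in> carrier A \<and> b \<in> carrier A}"

sublocale P: presentation "carrier R \<times> carrier A" tensor_relators
proof
  fix a assume "a \<in> tensor_relators"
  then obtain x y z where "a = frag_relator x y z" "x \<in> carrier R \<times> carrier A"
    "y \<in> carrier R \<times> carrier A" "z \<in> carrier R \<times> carrier A"
    unfolding tensor_relators_def by fastforce
  then show "Poly_Mapping.keys a \<subseteq> carrier R \<times> carrier A"
    by (simp only: keys_relator)
qed

abbreviation T where "T \<equiv> tensor_module R A"
abbreviation pure where "pure \<equiv> pure_tensor R A"

lemma tensor_rel_eq: "tensor_rel R A = P.K"
  by (simp add: tensor_rel_def tensor_relators_def)

lemma tensor_group_eq: "tensor_group R A = P.Q"
  by (simp add: tensor_group_def tensor_rel_eq)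

lemma pure_eq: "pure r a = P.cls (frag_of (r, a))"
  by (simp add: pure_tensor_def tensor_rel_eq)

lemma carrier_T: "carrier T = carrier P.Q" and add_T: "u \<oplus>\<^bsub>T\<^esub> v = u \<otimes>\<^bsub>P.Q\<^esub> v" and zero_T: "\<zero>\<^bsub>T\<^esub> = \<one>\<^bsub>P.Q\<^esub>"
  by (simp_all add: tensor_module_def tensor_group_eq)

sublocale T: abelian_group T
proof -
  interpret Q: comm_group P.Q by (rule P.comm_group_quotient)
  show "abelian_group T"
    by (rule abelian_groupI; unfold carrier_T add_T zero_T)
       (rule Q.m_closed Q.one_closed Q.m_assoc Q.m_comm Q.l_one Q.l_inv_ex; assumption)+
qed

lemma pure_closed: "r \<in> carrier R \<Longrightarrow> a \<in> carrier A \<Longrightarrow> pure r a \<in> carrier T"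
  by (simp add: pure_eq carrier_T P.gen_in_carrier)

lemma frag_relator_sum:
  assumes "frag_relator x y z \<in> P.K" "x \<in> carrier R \<times> carrier A" "y \<in> carrier R \<times> carrier A" "z \<in> carrier R \<times> carrier A"
  shows "P.cls (frag_of x) = P.cls (frag_of y) \<otimes>\<^bsub>P.Q\<^esub> P.cls (frag_of z)"
proof -
  have "frag_of x - (frag_of y + frag_of z) \<in> P.K"
    using assms(1) by (simp add: diff_diff_eq)
  then show ?thesis
    using assms(2-4) by (simp add: P.mult_cls P.cls_eq_iff)
qed

lemma tensor_relators_cases [consumes 1, case_names left right]:
  assumes "a \<in> tensor_relators"
  obtains r s b where "a = frag_relator (r \<oplus> s, b) (r, b) (s, b)"
      "r \<in> carrier R" "s \<in> carrier R" "b \<in> carrier A"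
    | r b c where "a = frag_relator (r, b \<otimes>\<^bsub>A\<^esub> c) (r, b) (r, c)"
      "r \<in> carrier R" "b \<in> carrier A" "c \<in> carrier A"
  using assms unfolding tensor_relators_def by blast

lemma left_relator_K:
  "r \<in> carrier R \<Longrightarrow> s \<in> carrier R \<Longrightarrow> b \<in> carrier A \<Longrightarrow> frag_relator (r \<oplus> s, b) (r, b) (s, b) \<in> P.K"
  by (rule generate.incl) (unfold tensor_relators_def, blast)

lemma right_relator_K:
  "r \<in> carrier R \<Longrightarrow> b \<in> carrier A \<Longrightarrow> c \<in> carrier A \<Longrightarrow> frag_relator (r, b \<otimes>\<^bsub>A\<^esub> c) (r, b) (r, c) \<in> P.K"
  by (rule generate.incl) (unfold tensor_relators_def, blast)

lemma pure_add_left: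
  assumes "r \<in> carrier R" "s \<in> carrier R" "a \<in> carrier A"
  shows "pure (r \<oplus> s) a = pure r a \<oplus>\<^bsub>T\<^esub> pure s a"
  unfolding pure_eq add_T
  by (rule frag_relator_sum[OF left_relator_K]) (use assms in auto)

lemma pure_add_right:
  assumes "r \<in> carrier R" "a \<in> carrier A" "b \<in> carrier A"
  shows "pure r (a \<otimes>\<^bsub>A\<^esub> b) = pure r a \<oplus>\<^bsub>T\<^esub> pure r b"
  unfolding pure_eq add_T
  by (rule frag_relator_sum[OF right_relator_K]) (use assms in auto)

lemma pure_one_right:
  assumes "r \<in> carrier R"
  shows "pure r \<one>\<^bsub>A\<^esub> = \<zero>\<^bsub>T\<^esub>"
  using pure_add_right[of r "\<one>\<^bsub>A\<^esub>" "\<one>\<^bsub>A\<^esub>"] pure_closed[of r "\<one>\<^bsub>A\<^esub>"] assms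
  by (simp add: T.add.l_cancel_one')

text \<open>
Multiples of a group element move to the scalar; there an integer
factor can be cancelled against its inverse in \<open>R\<close>.
\<close>
lemma pure_pow:
  assumes "r \<in> carrier R" "a \<in> carrier A"
  shows "pure r (a [^]\<^bsub>A\<^esub> (n::nat)) = pure ([n] \<cdot> r) a"
proof (induction n)
  case 0
  have "pure \<zero> a = \<zero>\<^bsub>T\<^esub>"
    using pure_add_left[of "\<zero>" "\<zero>" a] pure_closed[of "\<zero>" a] assms
    by (simp add: T.add.l_cancel_one')
  then show ?case by (simp add: pure_one_right assms)
next
  case (Suc n)
  then show ?case by (simp add: pure_add_right pure_add_left assms)
qed

lemma pure_finprod:
  assumes "finite I" "r \<in> carrier R" "\<And>i. i \<in> I \<Longrightarrow> a i \<in> carrier A"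
  shows "pure r (\<Otimes>\<^bsub>A\<^esub>i\<in>I. a i) = (\<Oplus>\<^bsub>T\<^esub>i\<in>I. pure r (a i))"
  using assms(1,3)
proof (induction I)
  case (insert i I)
  then have "a \<in> I \<rightarrow> carrier A" "(\<lambda>i. pure r (a i)) \<in> I \<rightarrow> carrier T"
    by (auto intro: pure_closed assms)
  with insert show ?case
    by (simp add: pure_add_right pure_closed assms)
qed (simp add: pure_one_right assms)

lemma tensor_induct [consumes 1, case_names zero pure diff]:
  assumes "u \<in> carrier T" and "P \<zero>\<^bsub>T\<^esub>"
    and "\<And>r a. r \<in> carrier R \<Longrightarrow> a \<in> carrier A \<Longrightarrow> P (pure r a)"
    and "\<And>u v w. \<lbrakk>u \<in> carrier T; v \<in> carrier T; w \<in> carrier T; P v; P w; v = u \<oplus>\<^bsub>T\<^esub> w\<rbrakk> \<Longrightarrow> P u"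
  shows "P u"
  using assms(1) unfolding carrier_T
proof (induction rule: P.quotient_induct)
  case zero then show ?case using assms(2) unfolding zero_T .
next
  case (gen x) then show ?case using assms(3)[of "fst x" "snd x"] by (auto simp: pure_eq)
next
  case (diff u v w) then show ?case using assms(4)[of u v w] unfolding carrier_T add_T by blast
qed

lemma hom_from_tensor:
  assumes N: "abelian_group N"
    and f: "\<And>r a. r \<in> carrier R \<Longrightarrow> a \<in> carrier A \<Longrightarrow> f r a \<in> carrier N"
    and l: "\<And>r s a. r \<in> carrier R \<Longrightarrow> s \<in> carrier R \<Longrightarrow> a \<in> carrier A \<Longrightarrow> f (r \<oplus> s) a = f r a \<oplus>\<^bsub>N\<^esub> f s a"
    and rr: "\<And>r a b. r \<in> carrier R \<Longrightarrow> a \<in> carrier A \<Longrightarrow> b \<in> carrier A \<Longrightarrow> f r (a \<otimes>\<^bsub>A\<^esub> b) = f r a \<oplus>\<^bsub>N\<^esub> f r b"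
  obtains g where "g \<in> carrier T \<rightarrow> carrier N"
    "\<And>u v. u \<in> carrier T \<Longrightarrow> v \<in> carrier T \<Longrightarrow> g (u \<oplus>\<^bsub>T\<^esub> v) = g u \<oplus>\<^bsub>N\<^esub> g v"
    "\<And>r a. r \<in> carrier R \<Longrightarrow> a \<in> carrier A \<Longrightarrow> g (pure r a) = f r a"
proof -
  interpret N: abelian_group N by fact
  obtain g where g: "g \<in> hom P.Q (add_monoid N)"
    "\<And>x. x \<in> carrier R \<times> carrier A \<Longrightarrow> g (P.cls (frag_of x)) = (\<lambda>(r,a). f r a) x"
  proof (rule P.hom_from_presentation[where f = "\<lambda>(r,a). f r a" and N = "add_monoid N"])
    show "comm_group (add_monoid N)" by (rule N.a_comm_group)
  next
    fix x assume "x \<in> carrier R \<times> carrier A"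
    then show "(case x of (r, a) \<Rightarrow> f r a) \<in> carrier (add_monoid N)" using f by auto
  next
    fix h a assume h: "h \<in> hom P.F (add_monoid N)"
      and hf: "\<And>x. x \<in> carrier R \<times> carrier A \<Longrightarrow> h (frag_of x) = (\<lambda>(r,a). f r a) x" and a: "a \<in> tensor_relators"
    have "h (frag_relator x y z) = \<zero>\<^bsub>N\<^esub>"
      if "x \<in> carrier R \<times> carrier A" "y \<in> carrier R \<times> carrier A" "z \<in> carrier R \<times> carrier A"
        "h (frag_of x) = h (frag_of y) \<oplus>\<^bsub>N\<^esub> h (frag_of z)" for x y z
      by (rule hom_frag_relator[OF N h that])
    then show "h a = \<one>\<^bsub>add_monoid N\<^esub>"
      using a unfolding tensor_relators_def by (auto simp: hf l rr)
  qed blast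
  show thesis
  proof
    show "g \<in> carrier T \<rightarrow> carrier N"
      using g(1) by (auto simp: hom_def carrier_T)
    show "g (u \<oplus>\<^bsub>T\<^esub> v) = g u \<oplus>\<^bsub>N\<^esub> g v" if "u \<in> carrier T" "v \<in> carrier T" for u v
      using g(1) that by (auto simp: hom_def carrier_T add_T)
    show "g (pure r a) = f r a" if "r \<in> carrier R" "a \<in> carrier A" for r a
      using g(2)[of "(r,a)"] that by (simp add: pure_eq)
  qed
qed

lemma
  assumes r: "r \<in> carrier R"
  shows smult_pure: "\<And>s a. s \<in> carrier R \<Longrightarrow> a \<in> carrier A \<Longrightarrow> r \<odot>\<^bsub>T\<^esub> pure s a = pure (r \<otimes> s) a"
    and smult_closed: "\<And>u. u \<in> carrier T \<Longrightarrow> r \<odot>\<^bsub>T\<^esub> u \<in> carrier T"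
    and smult_add: "\<And>u v. u \<in> carrier T \<Longrightarrow> v \<in> carrier T \<Longrightarrow> r \<odot>\<^bsub>T\<^esub> (u \<oplus>\<^bsub>T\<^esub> v) = r \<odot>\<^bsub>T\<^esub> u \<oplus>\<^bsub>T\<^esub> r \<odot>\<^bsub>T\<^esub> v"
proof -
  let ?t = "\<lambda>(s, a). frag_of (r \<otimes> s, a)"
  have rel: "frag_extend ?t a \<in> P.K" if "a \<in> tensor_relators" for a
    using that
  proof (cases rule: tensor_relators_cases)
    case (left s s' b)
    then show ?thesis
      using left_relator_K[of "r \<otimes> s" "r \<otimes> s'" b] r by (simp add: frag_extend_diff R.r_distr)
  next
    case (right s b c)
    then show ?thesis
      using right_relator_K[of "r \<otimes> s" b c] r by (simp add: frag_extend_diff)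
  qed
  have cls: "r \<odot>\<^bsub>T\<^esub> P.cls c = P.cls (frag_extend ?t c)" for c
    using P.union_over_coset[OF frag_extend_diff P.presentation_axioms rel]
    by (simp add: tensor_module_def tensor_rel_eq)
  have keys: "Poly_Mapping.keys (frag_extend ?t c) \<subseteq> carrier R \<times> carrier A"
    if "Poly_Mapping.keys c \<subseteq> carrier R \<times> carrier A" for c
    by (rule frag_extend_keys[OF _ that]) (use r in auto)
  show "r \<odot>\<^bsub>T\<^esub> pure s a = pure (r \<otimes> s) a" if "s \<in> carrier R" "a \<in> carrier A" for s a
    unfolding pure_eq cls by simp
  show "r \<odot>\<^bsub>T\<^esub> u \<in> carrier T" if "u \<in> carrier T" for u
  proof -
    obtain c where "u = P.cls c" "Poly_Mapping.keys c \<subseteq> carrier R \<times> carrier A"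
      using \<open>u \<in> carrier T\<close> unfolding carrier_T P.carrier_quotient by blast
    then show ?thesis by (simp only: cls carrier_T P.cls_in_carrier keys)
  qed
  show "r \<odot>\<^bsub>T\<^esub> (u \<oplus>\<^bsub>T\<^esub> v) = r \<odot>\<^bsub>T\<^esub> u \<oplus>\<^bsub>T\<^esub> r \<odot>\<^bsub>T\<^esub> v" if "u \<in> carrier T" "v \<in> carrier T" for u v
  proof -
    obtain c where "u = P.cls c" "Poly_Mapping.keys c \<subseteq> carrier R \<times> carrier A"
      using \<open>u \<in> carrier T\<close> unfolding carrier_T P.carrier_quotient by blast
    moreover obtain d where "v = P.cls d" "Poly_Mapping.keys d \<subseteq> carrier R \<times> carrier A"
      using \<open>v \<in> carrier T\<close> unfolding carrier_T P.carrier_quotient by blast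
    ultimately show ?thesis by (simp only: add_T P.mult_cls cls keys frag_extend_add)
  qed
qed

end

section \<open>Counting the members of a family by value\<close>

definition cnt :: "'i set \<Rightarrow> ('i \<Rightarrow> 'l) \<Rightarrow> 'l \<Rightarrow> nat" where
  "cnt I d L = card {i \<in> I. d i = L}"

lemma cnt_eq_sum: "finite I \<Longrightarrow> cnt I d L = (\<Sum>i\<in>I. of_bool (d i = L))"
  by (simp add: cnt_def of_bool_def sum.If_cases Int_def)

text \<open>
A sum over a family may be taken value by value; below, the values are stabilizers of points.
\<close>
lemma sum_cnt:
  assumes "finite I" "finite S" "\<And>i. i \<in> I \<Longrightarrow> d i \<in> S"
  shows "(\<Sum>L\<in>S. cnt I d L * F L) = (\<Sum>i\<in>I. F (d i))" (is "?l = _")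
proof -
  have "?l = (\<Sum>L\<in>S. \<Sum>i\<in>{i \<in> I. d i = L}. F (d i))"
    by (rule sum.cong) (simp_all add: cnt_def)
  also have "\<dots> = (\<Sum>i\<in>I. F (d i))"
    by (rule sum.group) (use assms in auto)
  finally show ?thesis .
qed

lemma cnt_bij_betw:
  assumes "bij_betw f I J" "\<And>i. i \<in> I \<Longrightarrow> e (f i) = d i"
  shows "cnt I d = cnt J e"
proof
  fix L
  have "bij_betw f {i \<in> I. d i = L} {j \<in> J. e j = L}"
    using assms by (auto simp: bij_betw_def inj_on_def)
  then show "cnt I d L = cnt J e L"
    unfolding cnt_def by (rule bij_betw_same_card)
qed

lemma cnt_Un:
  assumes "finite I" "finite J" "I \<inter> J = {}"
  shows "cnt (I \<union> J) d L = cnt I d L + cnt J d L"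
  using assms unfolding cnt_eq_sum[OF assms(1)] cnt_eq_sum[OF assms(2)] cnt_eq_sum[OF finite_UnI[OF assms(1,2)]]
  by (rule sum.union_disjoint)

lemma cnt_cong: "(\<And>i. i \<in> I \<Longrightarrow> d i = e i) \<Longrightarrow> cnt I d = cnt I e"
  by (rule cnt_bij_betw[of id]) auto

section \<open>Conjugation of subgroups\<close>

abbreviation conjugate where
  "conjugate T x L \<equiv> x <#\<^bsub>T\<^esub> L #>\<^bsub>T\<^esub> inv\<^bsub>T\<^esub> x"

context group begin

lemma inv_cancel [simp]:
  assumes "x \<in> carrier G" "y \<in> carrier G"
  shows "x \<otimes> (inv x \<otimes> y) = y" "inv x \<otimes> (x \<otimes> y) = y"
  using assms by (simp_all flip: m_assoc)

lemma conjugate_eq_image: "conjugate G x L = (\<lambda>l. x \<otimes> l \<otimes> inv x) ` L"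
  by (auto simp: l_coset_def r_coset_def)

lemma conjugate_subset: "x \<in> carrier G \<Longrightarrow> L \<subseteq> carrier G \<Longrightarrow> conjugate G x L \<subseteq> carrier G"
  by (auto simp: conjugate_eq_image)

lemma conjugate_one: "L \<subseteq> carrier G \<Longrightarrow> conjugate G \<one> L = L"
  unfolding conjugate_eq_image by (force simp: image_iff subset_iff)

lemma conjugate_mult:
  assumes "x \<in> carrier G" "y \<in> carrier G" "L \<subseteq> carrier G"
  shows "conjugate G (x \<otimes> y) L = conjugate G x (conjugate G y L)"
  unfolding conjugate_eq_image image_image
  by (rule image_cong) (use assms in \<open>auto simp: inv_mult_group m_assoc subset_iff\<close>)

lemma conjugate_inv_iff:
  assumes "x \<in> carrier G" "L \<subseteq> carrier G" "N \<subseteq> carrier G"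
  shows "conjugate G x L = N \<longleftrightarrow> L = conjugate G (inv x) N"
  using conjugate_mult[of "inv x" x L] conjugate_mult[of x "inv x" N] conjugate_one assms by auto

lemma card_conjugate:
  assumes "x \<in> carrier G" "L \<subseteq> carrier G"
  shows "card (conjugate G x L) = card L"
  unfolding conjugate_eq_image
  by (rule card_image) (use assms in \<open>auto simp: inj_on_def subset_iff\<close>)

lemma conjugate_subgroup:
  assumes "x \<in> carrier G" "subgroup L G"
  shows "subgroup (conjugate G x L) G"
proof (rule subgroupI)
  have L: "L \<subseteq> carrier G" using assms(2) by (rule subgroup.subset)
  show "conjugate G x L \<subseteq> carrier G" using conjugate_subset assms(1) L .
  show "conjugate G x L \<noteq> {}"
    using subgroup.one_closed[OF assms(2)] by (auto simp: conjugate_eq_image)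
  show "inv a \<in> conjugate G x L" if a: "a \<in> conjugate G x L" for a
  proof -
    obtain l where l: "l \<in> L" "a = x \<otimes> l \<otimes> inv x" using a by (auto simp: conjugate_eq_image)
    have "inv a = x \<otimes> inv l \<otimes> inv x"
      using l assms(1) L by (auto simp: inv_mult_group m_assoc)
    then show ?thesis
      using subgroup.m_inv_closed[OF assms(2) l(1)] by (auto simp: conjugate_eq_image)
  qed
  show "a \<otimes> b \<in> conjugate G x L" if ab: "a \<in> conjugate G x L" "b \<in> conjugate G x L" for a b
  proof -
    obtain l l' where l: "l \<in> L" "a = x \<otimes> l \<otimes> inv x" "l' \<in> L" "b = x \<otimes> l' \<otimes> inv x"
      using ab by (auto simp: conjugate_eq_image)
    then have c: "l \<in> carrier G" "l' \<in> carrier G" using L by auto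
    have "a \<otimes> b = x \<otimes> (l \<otimes> (inv x \<otimes> x) \<otimes> l') \<otimes> inv x"
      unfolding l(2,4) using c assms(1) by (simp only: m_assoc m_closed inv_closed)
    then have "a \<otimes> b = x \<otimes> (l \<otimes> l') \<otimes> inv x" using c assms(1) by simp
    then show ?thesis
      using subgroup.m_closed[OF assms(2) l(1,3)] by (auto simp: conjugate_eq_image)
  qed
qed

end

section \<open>Sets with a group action are classified by their stabilizers\<close>

text \<open>
Only the values of \<open>\<phi>\<close> on \<open>X\<close> are constrained, as for the actions of a biset.
\<close>
locale gset = group T for T (structure) +
  fixes \<phi> :: "'a \<Rightarrow> 'x \<Rightarrow> 'x" and X :: "'x set"
  assumes act_closed [simp]: "\<And>t x. t \<in> carrier T \<Longrightarrow> x \<in> X \<Longrightarrow> \<phi> t x \<in> X"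
    and act_one [simp]: "\<And>x. x \<in> X \<Longrightarrow> \<phi> \<one> x = x"
    and act_mult: "\<And>s t x. s \<in> carrier T \<Longrightarrow> t \<in> carrier T \<Longrightarrow> x \<in> X \<Longrightarrow> \<phi> (s \<otimes> t) x = \<phi> s (\<phi> t x)"
begin

abbreviation stab where "stab \<equiv> stabilizer T \<phi>"

lemma act_inv [simp]: "t \<in> carrier T \<Longrightarrow> x \<in> X \<Longrightarrow> \<phi> (inv t) (\<phi> t x) = x"
  by (simp flip: act_mult)

lemma act_inv' [simp]: "t \<in> carrier T \<Longrightarrow> x \<in> X \<Longrightarrow> \<phi> t (\<phi> (inv t) x) = x"
  by (simp flip: act_mult)

lemma act_eq_iff:
  assumes "s \<in> carrier T" "t \<in> carrier T" "x \<in> X" "y \<in> X"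
  shows "\<phi> s x = \<phi> t y \<longleftrightarrow> \<phi> (inv t \<otimes> s) x = y"
  using assms act_inv'[of t y] act_inv'[of t "\<phi> s x"] by (auto simp: act_mult)

lemma stab_subgroup: "x \<in> X \<Longrightarrow> subgroup (stab x) T"
  by (rule subgroupI) (auto simp: stabilizer_def act_mult intro: act_one, metis act_inv)

lemma stab_act:
  assumes t: "t \<in> carrier T" and x: "x \<in> X"
  shows "stab (\<phi> t x) = conjugate T t (stab x)"
proof -
  have "s \<in> stab (\<phi> t x) \<longleftrightarrow> s \<in> carrier T \<and> inv t \<otimes> s \<otimes> t \<in> stab x" for s
    using t x act_eq_iff[of "s \<otimes> t" t x x] by (auto simp: stabilizer_def act_mult m_assoc)
  moreover have "s \<in> carrier T \<and> inv t \<otimes> s \<otimes> t \<in> stab x \<longleftrightarrow> s \<in> conjugate T t (stab x)" for s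
  proof
    assume *: "s \<in> carrier T \<and> inv t \<otimes> s \<otimes> t \<in> stab x"
    then have "s = t \<otimes> (inv t \<otimes> s \<otimes> t) \<otimes> inv t"
      using t by (simp add: m_assoc)
    then show "s \<in> conjugate T t (stab x)"
      using * unfolding conjugate_eq_image by blast
  next
    assume "s \<in> conjugate T t (stab x)"
    then obtain l where l: "l \<in> stab x" "s = t \<otimes> l \<otimes> inv t"
      by (auto simp: conjugate_eq_image)
    then have "l \<in> carrier T" by (auto simp: stabilizer_def)
    then have "inv t \<otimes> s \<otimes> t = l" "s \<in> carrier T"
      using t l(2) by (simp_all add: m_assoc)
    then show "s \<in> carrier T \<and> inv t \<otimes> s \<otimes> t \<in> stab x" using l by simp
  qed
  ultimately show ?thesis by blast
qed

lemma mem_orbit: "y \<in> orbit T \<phi> x \<longleftrightarrow> (\<exists>t\<in>carrier T. y = \<phi> t x)"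
  by (auto simp: orbit_def)

lemma orbit_self: "x \<in> X \<Longrightarrow> x \<in> orbit T \<phi> x"
  by (force simp: mem_orbit)

lemma orbit_subset: "x \<in> X \<Longrightarrow> orbit T \<phi> x \<subseteq> X"
  by (auto simp: mem_orbit)

lemma act_in_orbit_iff:
  assumes "t \<in> carrier T" "x \<in> X" "y \<in> X"
  shows "\<phi> t y \<in> orbit T \<phi> x \<longleftrightarrow> y \<in> orbit T \<phi> x"
proof
  assume "\<phi> t y \<in> orbit T \<phi> x"
  then obtain s where "s \<in> carrier T" "\<phi> t y = \<phi> s x" by (auto simp: mem_orbit)
  then have "y = \<phi> (inv t \<otimes> s) x" using assms act_eq_iff[of s t x y] by auto
  then show "y \<in> orbit T \<phi> x" using assms \<open>s \<in> carrier T\<close> by (auto simp: mem_orbit)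
next
  assume "y \<in> orbit T \<phi> x"
  then show "\<phi> t y \<in> orbit T \<phi> x"
    using assms by (auto simp: mem_orbit simp flip: act_mult)
qed

lemma orbit_eq: "x \<in> X \<Longrightarrow> y \<in> orbit T \<phi> x \<Longrightarrow> orbit T \<phi> y = orbit T \<phi> x"
proof -
  assume x: "x \<in> X" and y: "y \<in> orbit T \<phi> x"
  then obtain t where t: "t \<in> carrier T" "y = \<phi> t x" by (auto simp: mem_orbit)
  then have y': "x = \<phi> (inv t) y" "y \<in> X" using x by auto
  show ?thesis
  proof (intro equalityI subsetI)
    fix z assume "z \<in> orbit T \<phi> y"
    then show "z \<in> orbit T \<phi> x" using x y y' act_in_orbit_iff[of _ x y] by (auto simp: mem_orbit)
  next
    fix z assume "z \<in> orbit T \<phi> x"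
    moreover have "x \<in> orbit T \<phi> y" unfolding mem_orbit using t(1) y'(1) inv_closed by blast
    ultimately show "z \<in> orbit T \<phi> y" using x y' act_in_orbit_iff[of _ y x] by (auto simp: mem_orbit)
  qed
qed

text \<open>
The elements moving \<open>x\<close> to \<open>sx\<close> form a right translate of the stabilizer of \<open>sx\<close>.
\<close>
lemma card_transporter:
  assumes "x \<in> X" "s \<in> carrier T"
  shows "card {t \<in> carrier T. \<phi> t x = \<phi> s x} = card (stab (\<phi> s x))"
proof (rule bij_betw_same_card)
  show "bij_betw (\<lambda>t. t \<otimes> inv s) {t \<in> carrier T. \<phi> t x = \<phi> s x} (stab (\<phi> s x))"
    by (rule bij_betw_byWitness[where f' = "\<lambda>t. t \<otimes> s"])
       (use assms in \<open>auto simp: stabilizer_def act_mult m_assoc\<close>)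
qed

text \<open>
Each point \<open>p\<close> of the orbit is \<open>tx\<close> for exactly \<open>|stab p|\<close> elements \<open>t\<close>. For constant \<open>F\<close> this is the
orbit-stabilizer theorem; letting \<open>F\<close> test the stabilizer gives the stabilizer counts of an orbit.
\<close>
lemma sum_over_orbit:
  assumes "x \<in> X" "finite (carrier T)"
  shows "(\<Sum>p\<in>orbit T \<phi> x. card (stab p) * F p) = (\<Sum>t\<in>carrier T. F (\<phi> t x))"
proof -
  have "(\<Sum>p\<in>orbit T \<phi> x. card (stab p) * F p)
        = (\<Sum>p\<in>orbit T \<phi> x. cnt (carrier T) (\<lambda>t. \<phi> t x) p * F p)"
  proof (rule sum.cong)
    fix p assume "p \<in> orbit T \<phi> x"
    then obtain s where "s \<in> carrier T" "p = \<phi> s x" by (auto simp: mem_orbit)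
    then show "card (stab p) * F p = cnt (carrier T) (\<lambda>t. \<phi> t x) p * F p"
      using card_transporter[OF assms(1)] by (simp only: cnt_def)
  qed simp
  also have "\<dots> = (\<Sum>t\<in>carrier T. F (\<phi> t x))"
    by (rule sum_cnt) (use assms in \<open>auto simp: orbit_def\<close>)
  finally show ?thesis .
qed

end

lemma stabilizer_equivariant:
  assumes "gset T \<phi> X" "gset T \<psi> Y" "bij_betw f X Y" "x \<in> X"
    and "\<And>t x. t \<in> carrier T \<Longrightarrow> x \<in> X \<Longrightarrow> f (\<phi> t x) = \<psi> t (f x)"
  shows "stabilizer T \<psi> (f x) = stabilizer T \<phi> x"
proof -
  have "\<psi> t (f x) = f x \<longleftrightarrow> \<phi> t x = x" if "t \<in> carrier T" for t
    using assms(3-5) that gset.act_closed[OF assms(1) that]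
    by (metis bij_betw_imp_inj_on inj_on_eq_iff)
  then show ?thesis by (auto simp: stabilizer_def)
qed

lemma cnt_stabilizer_equivariant:
  assumes "gset T \<phi> X" "gset T \<psi> Y" "bij_betw f X Y"
    and "\<And>t x. t \<in> carrier T \<Longrightarrow> x \<in> X \<Longrightarrow> f (\<phi> t x) = \<psi> t (f x)"
  shows "cnt X (stabilizer T \<phi>) = cnt Y (stabilizer T \<psi>)"
proof (rule cnt_bij_betw[OF assms(3)])
  fix x assume "x \<in> X"
  from stabilizer_equivariant[OF assms(1-3) this] assms(4)
  show "stabilizer T \<psi> (f x) = stabilizer T \<phi> x" by blast
qed

text \<open>
The bijection sends \<open>tx\<close> to \<open>ty\<close>; equality of the stabilizers makes it well-defined and injective.
\<close>
lemma equivariant_bij_between_orbits: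
  assumes "gset T \<phi> X" "gset T \<psi> Y" and x: "x \<in> X" and y: "y \<in> Y"
    and st: "stabilizer T \<phi> x = stabilizer T \<psi> y"
  obtains f where "bij_betw f (orbit T \<phi> x) (orbit T \<psi> y)"
    "\<And>t p. t \<in> carrier T \<Longrightarrow> p \<in> orbit T \<phi> x \<Longrightarrow> f (\<phi> t p) = \<psi> t (f p)"
proof -
  interpret X: gset T \<phi> X by fact
  interpret Y: gset T \<psi> Y by fact
  have eq: "\<phi> s x = \<phi> t x \<longleftrightarrow> \<psi> s y = \<psi> t y" if "s \<in> carrier T" "t \<in> carrier T" for s t
  proof -
    have "inv\<^bsub>T\<^esub> t \<otimes>\<^bsub>T\<^esub> s \<in> stabilizer T \<phi> x \<longleftrightarrow> inv\<^bsub>T\<^esub> t \<otimes>\<^bsub>T\<^esub> s \<in> stabilizer T \<psi> y"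
      by (simp add: st)
    then show ?thesis
      using that x y by (simp add: X.act_eq_iff Y.act_eq_iff stabilizer_def)
  qed
  define f where "f p = \<psi> (SOME t. t \<in> carrier T \<and> p = \<phi> t x) y" for p
  have f: "f (\<phi> t x) = \<psi> t y" if "t \<in> carrier T" for t
  proof -
    have "\<exists>s. s \<in> carrier T \<and> \<phi> t x = \<phi> s x" using that by blast
    from someI_ex[OF this] show ?thesis unfolding f_def using eq that by metis
  qed
  show thesis
  proof
    show "bij_betw f (orbit T \<phi> x) (orbit T \<psi> y)"
      unfolding bij_betw_def
    proof
      show "inj_on f (orbit T \<phi> x)" by (auto simp: inj_on_def X.mem_orbit f eq)
      show "f ` orbit T \<phi> x = orbit T \<psi> y" by (force simp: X.mem_orbit Y.mem_orbit f image_iff)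
    qed
    show "f (\<phi> t p) = \<psi> t (f p)" if "t \<in> carrier T" "p \<in> orbit T \<phi> x" for t p
    proof -
      obtain s where s: "s \<in> carrier T" "p = \<phi> s x" using \<open>p \<in> orbit T \<phi> x\<close> by (auto simp: X.mem_orbit)
      then have "\<phi> t p = \<phi> (t \<otimes>\<^bsub>T\<^esub> s) x" using that(1) x by (simp add: X.act_mult)
      then show ?thesis using f[of "t \<otimes>\<^bsub>T\<^esub> s"] f[of s] s that(1) y by (simp add: Y.act_mult)
    qed
  qed
qed

text \<open>
Choose a point \<open>x \<in> X\<close> and a point \<open>y \<in> Y\<close> with the same stabilizer. Their orbits are isomorphic and
thus have equal counts, so the complements have equal counts again and induction applies.
\<close>
lemma equivariant_bij_of_cnt_eq:
  assumes "finite X" "finite Y" "gset T \<phi> X" "gset T \<psi> Y"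
    and "cnt X (stabilizer T \<phi>) = cnt Y (stabilizer T \<psi>)"
  shows "\<exists>f. bij_betw f X Y \<and> (\<forall>t\<in>carrier T. \<forall>x\<in>X. f (\<phi> t x) = \<psi> t (f x))"
  using assms
proof (induction X arbitrary: Y rule: finite_psubset_induct)
  case (psubset X)
  interpret X: gset T \<phi> X by fact
  interpret Y: gset T \<psi> Y by fact
  show ?case
  proof (cases "X = {}")
    case True
    have "Y = {}"
    proof (rule ccontr)
      assume "Y \<noteq> {}"
      then obtain y where y: "y \<in> Y" by blast
      have "cnt Y (stabilizer T \<psi>) (stabilizer T \<psi> y) = 0"
        using fun_cong[OF psubset.prems(4), of "stabilizer T \<psi> y"] True by (simp add: cnt_def)
      then show False using y psubset.prems(1) by (auto simp: cnt_def)
    qed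
    then show ?thesis using True by (auto simp: bij_betw_def)
  next
    case False
    then obtain x where x: "x \<in> X" by blast
    have "cnt X (stabilizer T \<phi>) (stabilizer T \<phi> x) > 0"
      using x psubset.hyps by (auto simp: cnt_def card_gt_0_iff)
    then have "cnt Y (stabilizer T \<psi>) (stabilizer T \<phi> x) > 0" using psubset.prems(4) by simp
    then obtain y where y: "y \<in> Y" "stabilizer T \<phi> x = stabilizer T \<psi> y"
      by (auto simp: cnt_def card_gt_0_iff)
    let ?O = "orbit T \<phi> x" and ?P = "orbit T \<psi> y"
    have sub: "?O \<subseteq> X" "?P \<subseteq> Y" using X.orbit_subset x Y.orbit_subset y by auto
    note fin = finite_subset[OF sub(1) psubset.hyps(1)] finite_subset[OF sub(2) psubset.prems(1)]
    obtain f where f: "bij_betw f ?O ?P"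
      "\<And>t p. t \<in> carrier T \<Longrightarrow> p \<in> ?O \<Longrightarrow> f (\<phi> t p) = \<psi> t (f p)"
      using equivariant_bij_between_orbits[OF psubset.prems(2,3) x y] by blast
    have gs: "gset T \<phi> ?O" "gset T \<psi> ?P" "gset T \<phi> (X - ?O)" "gset T \<psi> (Y - ?P)"
      using X.act_in_orbit_iff[OF _ x] Y.act_in_orbit_iff[OF _ y(1)] sub
      by (unfold_locales; auto simp: subset_iff X.act_mult Y.act_mult)+
    have split: "(X - ?O) \<union> ?O = X" "(Y - ?P) \<union> ?P = Y" using sub by auto
    have "cnt X (stabilizer T \<phi>) L = cnt (X - ?O) (stabilizer T \<phi>) L + cnt ?O (stabilizer T \<phi>) L" for L
      using cnt_Un[of "X - ?O" ?O "stabilizer T \<phi>" L] fin(1) psubset.hyps(1) unfolding split by blast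
    moreover have "cnt Y (stabilizer T \<psi>) L = cnt (Y - ?P) (stabilizer T \<psi>) L + cnt ?P (stabilizer T \<psi>) L" for L
      using cnt_Un[of "Y - ?P" ?P "stabilizer T \<psi>" L] fin(2) psubset.prems(1) unfolding split by blast
    moreover have "cnt ?O (stabilizer T \<phi>) = cnt ?P (stabilizer T \<psi>)"
    proof (rule cnt_stabilizer_equivariant[OF gs(1,2) f(1)])
      fix t p assume "t \<in> carrier T" "p \<in> ?O"
      then show "f (\<phi> t p) = \<psi> t (f p)" by (rule f(2))
    qed
    ultimately have "cnt (X - ?O) (stabilizer T \<phi>) L = cnt (Y - ?P) (stabilizer T \<psi>) L" for L
      using psubset.prems(4) by (metis add_right_cancel)
    then have "cnt (X - ?O) (stabilizer T \<phi>) = cnt (Y - ?P) (stabilizer T \<psi>)" by blast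
    moreover have "X - ?O \<subset> X" using X.orbit_self[OF x] x by blast
    ultimately obtain g where g: "bij_betw g (X - ?O) (Y - ?P)"
      "\<forall>t\<in>carrier T. \<forall>x\<in>X - ?O. g (\<phi> t x) = \<psi> t (g x)"
      using psubset.IH[of "X - ?O" "Y - ?P"] gs psubset.prems(1) by auto
    \<comment> \<open>Glue the bijections of the orbits and of their complements.\<close>
    let ?h = "\<lambda>p. if p \<in> ?O then f p else g p"
    have h: "bij_betw ?h ?O ?P" "bij_betw ?h (X - ?O) (Y - ?P)"
      using f(1) g(1) by (subst bij_betw_cong[of _ _ f] bij_betw_cong[of _ _ g]; simp)+
    have "bij_betw ?h (?O \<union> (X - ?O)) (?P \<union> (Y - ?P))"
      by (rule bij_betw_combine[OF h]) auto
    then have "bij_betw ?h X Y" using sub by (simp add: Un_absorb1)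
    moreover have "?h (\<phi> t p) = \<psi> t (?h p)" if "t \<in> carrier T" "p \<in> X" for t p
      using that f(2) g(2) X.act_in_orbit_iff[OF that(1) x that(2)] by auto
    ultimately show ?thesis by blast
  qed
qed

section \<open>Bisets\<close>

lemma is_bisetD:
  assumes "is_biset G H X"
  shows "finite (points X)"
    and "\<And>g x. g \<in> carrier G \<Longrightarrow> x \<in> points X \<Longrightarrow> lact X g x \<in> points X"
    and "\<And>x. x \<in> points X \<Longrightarrow> lact X \<one>\<^bsub>G\<^esub> x = x"
    and "\<And>g g' x. g \<in> carrier G \<Longrightarrow> g' \<in> carrier G \<Longrightarrow> x \<in> points X \<Longrightarrow> lact X (g \<otimes>\<^bsub>G\<^esub> g') x = lact X g (lact X g' x)"
    and "\<And>h x. h \<in> carrier H \<Longrightarrow> x \<in> points X \<Longrightarrow> ract X x h \<in> points X"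
    and "\<And>x. x \<in> points X \<Longrightarrow> ract X x \<one>\<^bsub>H\<^esub> = x"
    and "\<And>h h' x. h \<in> carrier H \<Longrightarrow> h' \<in> carrier H \<Longrightarrow> x \<in> points X \<Longrightarrow> ract X x (h \<otimes>\<^bsub>H\<^esub> h') = ract X (ract X x h) h'"
    and "\<And>g h x. g \<in> carrier G \<Longrightarrow> h \<in> carrier H \<Longrightarrow> x \<in> points X \<Longrightarrow> ract X (lact X g x) h = lact X g (ract X x h)"
  using assms unfolding is_biset_def by blast+

text \<open>
The classical mark counts the points fixed by \<open>L\<close>; here the stabilizer has to be \<open>L\<close> itself. The two
counts determine each other, but the second one gives the coefficients of \<open>\<alpha>\<close> directly.
\<close>
definition mark :: "('g, 'm) monoid_scheme \<Rightarrow> ('h, 'n) monoid_scheme \<Rightarrow> ('g, 'h, 'x) biset \<Rightarrow> ('g \<times> 'h) set \<Rightarrow> nat" where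
  "mark G H X = cnt (points X) (stabilizer (G \<times>\<times> H) (prod_act G H X))"

locale group_pair =
  fixes G :: "('g, 'm) monoid_scheme" and H :: "('h, 'n) monoid_scheme"
  assumes groups: "group G" "group H" and fin: "finite (carrier G)" "finite (carrier H)"
begin

sublocale G: group G by (rule groups)
sublocale H: group H by (rule groups)
sublocale T: group "G \<times>\<times> H" by (intro DirProd_group groups)

lemma inv_T: "g \<in> carrier G \<Longrightarrow> h \<in> carrier H \<Longrightarrow> inv\<^bsub>G \<times>\<times> H\<^esub> (g, h) = (inv\<^bsub>G\<^esub> g, inv\<^bsub>H\<^esub> h)"
  by (rule inv_DirProd[OF groups])

lemma gset_of_biset:
  assumes "is_biset G H X"
  shows "gset (G \<times>\<times> H) (prod_act G H X) (points X)"
proof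
  note X = is_bisetD[OF assms]
  show "prod_act G H X t x \<in> points X" if "t \<in> carrier (G \<times>\<times> H)" "x \<in> points X" for t x
    using that by (auto simp: prod_act_def X)
  show "prod_act G H X \<one>\<^bsub>G \<times>\<times> H\<^esub> x = x" if "x \<in> points X" for x
    using that by (simp add: prod_act_def X)
  show "prod_act G H X (s \<otimes>\<^bsub>G \<times>\<times> H\<^esub> t) x = prod_act G H X s (prod_act G H X t x)"
    if "s \<in> carrier (G \<times>\<times> H)" "t \<in> carrier (G \<times>\<times> H)" "x \<in> points X" for s t x
    using that by (auto simp: prod_act_def X(2-7) X(8)[symmetric] H.inv_mult_group)
qed

lemma stab_subgroups_of:
  "is_biset G H X \<Longrightarrow> x \<in> points X \<Longrightarrow> stabilizer (G \<times>\<times> H) (prod_act G H X) x \<in> subgroups_of (G \<times>\<times> H)"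
  using gset.stab_subgroup[OF gset_of_biset] by (auto simp: subgroups_of_def)

lemma finite_subgroups_of: "finite (subgroups_of (G \<times>\<times> H))"
proof (rule finite_subset)
  show "subgroups_of (G \<times>\<times> H) \<subseteq> Pow (carrier (G \<times>\<times> H))"
    unfolding subgroups_of_def using subgroup.subset by blast
qed (simp add: fin)

lemma biset_isomorphic_iff_equivariant:
  fixes X :: "('g, 'h, 'x) biset" and Y :: "('g, 'h, 'y) biset"
  assumes "is_biset G H X" "is_biset G H Y"
  shows "biset_isomorphic G H X Y \<longleftrightarrow> (\<exists>f. bij_betw f (points X) (points Y) \<and>
    (\<forall>t\<in>carrier (G \<times>\<times> H). \<forall>x\<in>points X. f (prod_act G H X t x) = prod_act G H Y t (f x)))"
  unfolding biset_isomorphic_def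
proof (intro ex_cong1 conj_cong refl)
  fix f assume f: "bij_betw f (points X) (points Y)"
  note X = is_bisetD[OF assms(1)] and Y = is_bisetD[OF assms(2)]
  have fY: "f x \<in> points Y" if "x \<in> points X" for x using f that by (auto simp: bij_betw_def)
  show "((\<forall>g\<in>carrier G. \<forall>x\<in>points X. f (lact X g x) = lact Y g (f x)) \<and>
         (\<forall>x\<in>points X. \<forall>h\<in>carrier H. f (ract X x h) = ract Y (f x) h)) \<longleftrightarrow>
        (\<forall>t\<in>carrier (G \<times>\<times> H). \<forall>x\<in>points X. f (prod_act G H X t x) = prod_act G H Y t (f x))"
    (is "?l \<longleftrightarrow> ?r")
  proof
    assume ?l
    then show ?r by (auto simp: prod_act_def X Y fY)
  next
    assume r: ?r
    have "f (lact X g x) = lact Y g (f x)" if "g \<in> carrier G" "x \<in> points X" for g x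
      using r[rule_format, of "(g, \<one>\<^bsub>H\<^esub>)" x] that by (simp add: prod_act_def X Y fY)
    moreover have "f (ract X x h) = ract Y (f x) h" if "h \<in> carrier H" "x \<in> points X" for h x
      using r[rule_format, of "(\<one>\<^bsub>G\<^esub>, inv\<^bsub>H\<^esub> h)" x] that by (simp add: prod_act_def X Y fY)
    ultimately show ?l by blast
  qed
qed

theorem biset_isomorphic_iff_mark:
  fixes X :: "('g, 'h, 'x) biset" and Y :: "('g, 'h, 'y) biset"
  assumes "is_biset G H X" "is_biset G H Y"
  shows "biset_isomorphic G H X Y \<longleftrightarrow> mark G H X = mark G H Y"
  unfolding biset_isomorphic_iff_equivariant[OF assms]
proof
  assume "\<exists>f. bij_betw f (points X) (points Y) \<and>
    (\<forall>t\<in>carrier (G \<times>\<times> H). \<forall>x\<in>points X. f (prod_act G H X t x) = prod_act G H Y t (f x))"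
  then obtain f where f: "bij_betw f (points X) (points Y)"
    "\<forall>t\<in>carrier (G \<times>\<times> H). \<forall>x\<in>points X. f (prod_act G H X t x) = prod_act G H Y t (f x)" by blast
  show "mark G H X = mark G H Y"
    unfolding mark_def
    by (rule cnt_stabilizer_equivariant[OF gset_of_biset[OF assms(1)] gset_of_biset[OF assms(2)] f(1)])
       (use f(2) in blast)
next
  assume "mark G H X = mark G H Y"
  then show "\<exists>f. bij_betw f (points X) (points Y) \<and>
    (\<forall>t\<in>carrier (G \<times>\<times> H). \<forall>x\<in>points X. f (prod_act G H X t x) = prod_act G H Y t (f x))"
    unfolding mark_def
    by (rule equivariant_bij_of_cnt_eq[OF is_bisetD(1)[OF assms(1)] is_bisetD(1)[OF assms(2)]
          gset_of_biset[OF assms(1)] gset_of_biset[OF assms(2)]])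
qed

text \<open>
Every finite set with an action of \<open>G \<times> H\<close> can be transported to an initial segment of the natural
numbers, which is where representatives of isomorphism classes live.
\<close>
lemma biset_of_gset:
  assumes "finite P" "gset (G \<times>\<times> H) \<phi> P"
  obtains X :: "('g, 'h, nat) biset" where "is_biset G H X" "mark G H X = cnt P (stabilizer (G \<times>\<times> H) \<phi>)"
proof -
  interpret P: gset "G \<times>\<times> H" \<phi> P by fact
  obtain e where e: "bij_betw e P {0..<card P}" using ex_bij_betw_finite_nat[OF assms(1)] by blast
  define d where "d = inv_into P e"
  have de: "d (e p) = p" if "p \<in> P" for p
    using that e by (simp add: d_def bij_betw_inv_into_left)
  have eP: "e p < card P" if "p \<in> P" for p using e that by (auto simp: bij_betw_def)
  have n: "\<exists>p\<in>P. n = e p" if "n < card P" for n using e that by (auto simp: bij_betw_def image_iff set_eq_iff)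
  \<comment> \<open>A right action by \<open>h\<close> is the action of \<open>(1, h\<^sup>-\<^sup>1)\<close>, in accordance with \<open>prod_act\<close>.\<close>
  define X :: "('g, 'h, nat) biset" where
    "X = \<lparr>points = {0..<card P}, lact = (\<lambda>g n. e (\<phi> (g, \<one>\<^bsub>H\<^esub>) (d n))), ract = (\<lambda>n h. e (\<phi> (\<one>\<^bsub>G\<^esub>, inv\<^bsub>H\<^esub> h) (d n)))\<rparr>"
  have act: "lact X g (e p) = e (\<phi> (g, \<one>\<^bsub>H\<^esub>) p)" "ract X (e p) h = e (\<phi> (\<one>\<^bsub>G\<^esub>, inv\<^bsub>H\<^esub> h) p)"
    if "p \<in> P" for p g h
    using that by (simp_all add: X_def de)
  have pts: "points X = e ` P" using e by (simp add: X_def bij_betw_def)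
  have m: "\<phi> (g, h) (\<phi> (g', h') p) = \<phi> (g \<otimes>\<^bsub>G\<^esub> g', h \<otimes>\<^bsub>H\<^esub> h') p"
    if "g \<in> carrier G" "g' \<in> carrier G" "h \<in> carrier H" "h' \<in> carrier H" "p \<in> P" for g g' h h' p
    using P.act_mult[of "(g, h)" "(g', h')" p] that by simp
  have c: "\<phi> (g, h) p \<in> P" if "g \<in> carrier G" "h \<in> carrier H" "p \<in> P" for g h p
    using P.act_closed[of "(g, h)" p] that by simp
  have o: "\<phi> (\<one>\<^bsub>G\<^esub>, \<one>\<^bsub>H\<^esub>) p = p" if "p \<in> P" for p using P.act_one[OF that] by simp
  have bX: "is_biset G H X"
    unfolding is_biset_def pts
    using assms(1) by (auto simp: act m c o H.inv_mult_group)
  moreover have "mark G H X = cnt P (stabilizer (G \<times>\<times> H) \<phi>)"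
    unfolding mark_def
  proof (rule cnt_stabilizer_equivariant[OF assms(2) gset_of_biset[OF bX], symmetric])
    show "bij_betw e P (points X)" using e by (simp add: X_def)
    fix t p assume "t \<in> carrier (G \<times>\<times> H)" "p \<in> P"
    then show "e (\<phi> t p) = prod_act G H X t (e p)"
      by (auto simp: prod_act_def act m c)
  qed
  ultimately show thesis by (rule that)
qed

lemma biset_union:
  assumes X: "is_biset G H X" and Y: "is_biset G H Y"
  shows "is_biset G H (biset_union X Y)" "mark G H (biset_union X Y) L = mark G H X L + mark G H Y L"
proof -
  note X' = is_bisetD[OF X] and Y' = is_bisetD[OF Y]
  show "is_biset G H (biset_union X Y)"
    unfolding is_biset_def biset_union_def by (auto simp: X' Y')
  have act: "prod_act G H (biset_union X Y) t (Inl x) = Inl (prod_act G H X t x)"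
    "prod_act G H (biset_union X Y) t (Inr y) = Inr (prod_act G H Y t y)" for t x y
    by (auto simp: prod_act_def biset_union_def split: prod.split)
  have "cnt (Inl ` points X) (stabilizer (G \<times>\<times> H) (prod_act G H (biset_union X Y))) = mark G H X"
    unfolding mark_def by (rule sym, rule cnt_bij_betw[of Inl]) (auto simp: bij_betw_def stabilizer_def act)
  moreover have "cnt (Inr ` points Y) (stabilizer (G \<times>\<times> H) (prod_act G H (biset_union X Y))) = mark G H Y"
    unfolding mark_def by (rule sym, rule cnt_bij_betw[of Inr]) (auto simp: bij_betw_def stabilizer_def act)
  moreover have "points (biset_union X Y) = Inl ` points X \<union> Inr ` points Y"
    by (auto simp: biset_union_def)
  ultimately show "mark G H (biset_union X Y) L = mark G H X L + mark G H Y L"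
    unfolding mark_def[of G H "biset_union X Y"] using X'(1) Y'(1)
      cnt_Un[of "Inl ` points X" "Inr ` points Y" "stabilizer (G \<times>\<times> H) (prod_act G H (biset_union X Y))" L]
    by auto
qed

definition transporters where
  "transporters L N = card {t \<in> carrier (G \<times>\<times> H). conjugate (G \<times>\<times> H) t L = N}"

text \<open>
The biset \<open>T/L\<close> of left cosets: it is the orbit of \<open>L\<close> under translation, with stabilizer \<open>L\<close> at
\<open>L\<close>. All stabilizers are conjugates of \<open>L\<close> and so have \<open>|L|\<close> elements.
\<close>
lemma transitive_biset:
  assumes L: "L \<in> subgroups_of (G \<times>\<times> H)"
  obtains X :: "('g, 'h, nat) biset" where "is_biset G H X" "\<And>N. card L * mark G H X N = transporters L N"
proof -
  let ?T = "G \<times>\<times> H" and ?\<phi> = "\<lambda>t C. t <#\<^bsub>G \<times>\<times> H\<^esub> C"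
  have sL: "subgroup L ?T" using L by (simp add: subgroups_of_def)
  have subL: "L \<subseteq> carrier ?T" using sL by (rule subgroup.subset)
  define P where "P = (\<lambda>t. t <#\<^bsub>?T\<^esub> L) ` carrier ?T"
  have PE: "\<exists>s\<in>carrier ?T. x = s <#\<^bsub>?T\<^esub> L" if "x \<in> P" for x using that by (auto simp: P_def)
  have Psub: "x \<subseteq> carrier ?T" if "x \<in> P" for x using PE[OF that] T.l_coset_subset_G[OF subL] by blast
  interpret P: gset ?T ?\<phi> P
  proof
    show "?\<phi> t x \<in> P" if "t \<in> carrier ?T" "x \<in> P" for t x
    proof -
      obtain s where s: "s \<in> carrier ?T" "x = s <#\<^bsub>?T\<^esub> L" using PE[OF \<open>x \<in> P\<close>] by blast
      have "?\<phi> t x = (t \<otimes>\<^bsub>?T\<^esub> s) <#\<^bsub>?T\<^esub> L" unfolding s(2) by (rule T.lcos_m_assoc[OF subL that(1) s(1)])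
      then show ?thesis unfolding P_def using T.m_closed[OF that(1) s(1)] by (rule image_eqI)
    qed
    show "?\<phi> \<one>\<^bsub>?T\<^esub> x = x" if "x \<in> P" for x
      by (rule T.lcos_mult_one[OF Psub[OF that]])
    show "?\<phi> (s \<otimes>\<^bsub>?T\<^esub> t) x = ?\<phi> s (?\<phi> t x)" if "s \<in> carrier ?T" "t \<in> carrier ?T" "x \<in> P" for s t x
      by (rule T.lcos_m_assoc[OF Psub[OF that(3)] that(1,2), symmetric])
  qed
  have finT: "finite (carrier ?T)" using fin by simp
  have LP: "L \<in> P" unfolding P_def using T.lcos_mult_one[OF subL] T.one_closed by (metis image_eqI)
  have orb: "P = orbit ?T ?\<phi> L" by (auto simp: P_def orbit_def)
  have stabL: "P.stab L = L"
  proof -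
    have "t <#\<^bsub>?T\<^esub> L = L \<longleftrightarrow> t \<in> L" if "t \<in> carrier ?T" for t
    proof
      have "t \<in> t <#\<^bsub>?T\<^esub> L"
        unfolding l_coset_def
        by (rule UN_I[OF subgroup.one_closed[OF sL]]) (simp only: T.r_one[OF that] singleton_iff)
      then show "t \<in> L" if "t <#\<^bsub>?T\<^esub> L = L" using that by blast
      show "t <#\<^bsub>?T\<^esub> L = L" if "t \<in> L" by (rule T.coset_join3[OF \<open>t \<in> carrier ?T\<close> sL that])
    qed
    then show ?thesis using subL by (auto simp: stabilizer_def)
  qed
  have finP: "finite P" unfolding P_def by (rule finite_imageI[OF finT])
  obtain X :: "('g, 'h, nat) biset" where X: "is_biset G H X" "mark G H X = cnt P (stabilizer ?T ?\<phi>)"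
    using biset_of_gset[OF finP P.gset_axioms] by blast
  have "card L * mark G H X N = transporters L N" for N
  proof -
    have "card L * mark G H X N = (\<Sum>p\<in>P. card L * of_bool (P.stab p = N))"
      by (simp add: X(2) cnt_eq_sum[OF finP] sum_distrib_left)
    also have "\<dots> = (\<Sum>p\<in>P. card (P.stab p) * of_bool (P.stab p = N))"
    proof (rule sum.cong)
      fix p assume "p \<in> P"
      then obtain t where "t \<in> carrier ?T" "p = ?\<phi> t L" by (auto simp: P_def)
      then have "card (P.stab p) = card L"
        using P.stab_act[OF _ LP, of t] T.card_conjugate[of t L] stabL subL by simp
      then show "card L * of_bool (P.stab p = N) = card (P.stab p) * of_bool (P.stab p = N)" by simp
    qed simp
    also have "\<dots> = (\<Sum>t\<in>carrier ?T. of_bool (P.stab (?\<phi> t L) = N))"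
      using P.sum_over_orbit[OF LP finT, of "\<lambda>p. of_bool (P.stab p = N)"] orb by simp
    also have "\<dots> = (\<Sum>t\<in>carrier ?T. of_bool (conjugate ?T t L = N))"
      by (rule sum.cong) (use P.stab_act[OF _ LP] stabL in auto)
    also have "\<dots> = transporters L N"
      using cnt_eq_sum[OF finT, of "\<lambda>t. conjugate ?T t L" N] by (simp add: transporters_def cnt_def)
    finally show ?thesis .
  qed
  with X(1) show thesis by (rule that)
qed

end

text \<open>
By the orbit-stabilizer theorem each orbit contributes the same total weight \<open>|T|\<close>, whatever its size.
\<close>
lemma (in gset) sum_over_orbits:
  assumes "finite (carrier T)" "finite X"
  shows "(\<Sum>p\<in>X. card (stab p) * F (orbit T \<phi> p)) = card (carrier T) * (\<Sum>B\<in>orbits T X \<phi>. F B)"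
proof -
  have "(\<Sum>p\<in>X. card (stab p) * F (orbit T \<phi> p))
      = (\<Sum>B\<in>orbits T X \<phi>. \<Sum>p\<in>{p \<in> X. orbit T \<phi> p = B}. card (stab p) * F (orbit T \<phi> p))"
    by (rule sum.group[symmetric]) (use assms(2) in \<open>auto simp: orbits_def\<close>)
  also have "\<dots> = (\<Sum>B\<in>orbits T X \<phi>. card (carrier T) * F B)"
  proof (rule sum.cong)
    fix B assume "B \<in> orbits T X \<phi>"
    then obtain x where x: "x \<in> X" "B = orbit T \<phi> x" by (auto simp: orbits_def)
    have B: "{p \<in> X. orbit T \<phi> p = B} = orbit T \<phi> x"
      using x orbit_eq orbit_self orbit_subset by blast
    have "(\<Sum>p\<in>{p \<in> X. orbit T \<phi> p = B}. card (stab p) * F (orbit T \<phi> p)) = (\<Sum>p\<in>orbit T \<phi> x. card (stab p) * F B)"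
      using B by (intro sum.cong) auto
    also have "\<dots> = (\<Sum>t\<in>carrier T. F B)"
      using sum_over_orbit[OF x(1) assms(1), of "\<lambda>_. F B"] .
    finally show "(\<Sum>p\<in>{p \<in> X. orbit T \<phi> p = B}. card (stab p) * F (orbit T \<phi> p)) = card (carrier T) * F B"
      by simp
  qed simp
  finally show ?thesis by (simp add: sum_distrib_left)
qed

section \<open>The stabilizers in a tensor product of bisets\<close>

text \<open>
The product of subgroup combinations with the denominator \<open>|H|\<close> cleared, on natural coefficients.
\<close>
definition conv ::
  "('g, 'm) monoid_scheme \<Rightarrow> ('h, 'n) monoid_scheme \<Rightarrow> ('k, 'p) monoid_scheme \<Rightarrow>
   (('g \<times> 'h) set \<Rightarrow> nat) \<Rightarrow> (('h \<times> 'k) set \<Rightarrow> nat) \<Rightarrow> ('g \<times> 'k) set \<Rightarrow> nat" where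
  "conv G H K m m' N = (\<Sum>L\<in>subgroups_of (G \<times>\<times> H). m L *
     (\<Sum>M\<in>subgroups_of (H \<times>\<times> K). m' M * (if L O M = N then card (k2 G H L \<inter> k1 H K M) else 0)))"

locale group_triple = GH: group_pair G H + HK: group_pair H K
  for G :: "('g, 'm) monoid_scheme" and H :: "('h, 'n) monoid_scheme" and K :: "('k, 'p) monoid_scheme"
begin

sublocale GK: group_pair G K
  by standard (rule GH.groups HK.groups GH.fin HK.fin)+

lemma conv_cnt:
  assumes "finite I" "finite J" "\<And>i. i \<in> I \<Longrightarrow> d i \<in> subgroups_of (G \<times>\<times> H)"
    "\<And>j. j \<in> J \<Longrightarrow> e j \<in> subgroups_of (H \<times>\<times> K)"
  shows "conv G H K (cnt I d) (cnt J e) N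
    = (\<Sum>i\<in>I. \<Sum>j\<in>J. if d i O e j = N then card (k2 G H (d i) \<inter> k1 H K (e j)) else 0)"
proof -
  let ?c = "\<lambda>L M. if L O M = N then card (k2 G H L \<inter> k1 H K M) else 0"
  have "(\<Sum>M\<in>subgroups_of (H \<times>\<times> K). cnt J e M * ?c L M) = (\<Sum>j\<in>J. ?c L (e j))" for L
    using sum_cnt[OF assms(2) HK.finite_subgroups_of assms(4)] .
  then have "conv G H K (cnt I d) (cnt J e) N = (\<Sum>L\<in>subgroups_of (G \<times>\<times> H). cnt I d L * (\<Sum>j\<in>J. ?c L (e j)))"
    by (simp only: conv_def)
  also have "\<dots> = (\<Sum>i\<in>I. \<Sum>j\<in>J. ?c (d i) (e j))"
    using sum_cnt[OF assms(1) GH.finite_subgroups_of assms(3)] .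
  finally show ?thesis .
qed

lemma conv_add_left: "conv G H K (\<lambda>L. m L + m' L) n N = conv G H K m n N + conv G H K m' n N"
  by (simp add: conv_def add_mult_distrib sum.distrib)

lemma conv_add_right: "conv G H K m (\<lambda>L. n L + n' L) N = conv G H K m n N + conv G H K m n' N"
  by (simp add: conv_def add_mult_distrib add_mult_distrib2 sum.distrib)

lemma relcomp_subgroup:
  assumes "subgroup L (G \<times>\<times> H)" "subgroup M (H \<times>\<times> K)"
  shows "subgroup (L O M) (G \<times>\<times> K)"
proof (rule GK.T.subgroupI)
  note L = subgroup.mem_carrier[OF assms(1)] and M = subgroup.mem_carrier[OF assms(2)]
  show "L O M \<subseteq> carrier (G \<times>\<times> K)" using L M by fastforce
  show "L O M \<noteq> {}"
    using subgroup.one_closed[OF assms(1)] subgroup.one_closed[OF assms(2)] by auto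
  show "inv\<^bsub>G \<times>\<times> K\<^esub> a \<in> L O M" if a: "a \<in> L O M" for a
  proof -
    obtain g h k where *: "a = (g, k)" "(g, h) \<in> L" "(h, k) \<in> M" using a by auto
    have c: "g \<in> carrier G" "h \<in> carrier H" "k \<in> carrier K" using L[OF *(2)] M[OF *(3)] by auto
    have "(inv\<^bsub>G\<^esub> g, inv\<^bsub>H\<^esub> h) \<in> L" "(inv\<^bsub>H\<^esub> h, inv\<^bsub>K\<^esub> k) \<in> M"
      using subgroup.m_inv_closed[OF assms(1) *(2)] subgroup.m_inv_closed[OF assms(2) *(3)] c
      by (simp_all add: GH.inv_T HK.inv_T)
    then show ?thesis using c by (auto simp: *(1) GK.inv_T)
  qed
  show "a \<otimes>\<^bsub>G \<times>\<times> K\<^esub> b \<in> L O M" if ab: "a \<in> L O M" "b \<in> L O M" for a b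
  proof -
    obtain g h k g' h' k' where *: "a = (g, k)" "(g, h) \<in> L" "(h, k) \<in> M"
      "b = (g', k')" "(g', h') \<in> L" "(h', k') \<in> M" using ab by auto
    show ?thesis
      using subgroup.m_closed[OF assms(1) *(2,5)] subgroup.m_closed[OF assms(2) *(3,6)] *(1,4) by auto
  qed
qed

context
  fixes X :: "('g, 'h, 'x) biset" and Y :: "('h, 'k, 'y) biset"
  assumes bX: "is_biset G H X" and bY: "is_biset H K Y"
begin

abbreviation XY where "XY \<equiv> biset_tensor H X Y"
abbreviation E where "E \<equiv> points X \<times> points Y"
abbreviation middle where "middle \<equiv> \<lambda>h (x, y). (ract X x (inv\<^bsub>H\<^esub> h), lact Y h y)"
abbreviation outer where "outer g k \<equiv> \<lambda>(x, y). (lact X g x, ract Y y k)"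
abbreviation orb where "orb p \<equiv> orbit H middle p"
abbreviation stX where "stX \<equiv> stabilizer (G \<times>\<times> H) (prod_act G H X)"
abbreviation stY where "stY \<equiv> stabilizer (H \<times>\<times> K) (prod_act H K Y)"

lemmas X = is_bisetD[OF bX] and Y = is_bisetD[OF bY]

lemma gset_middle: "gset H middle E"
  by unfold_locales (auto simp: X Y GH.H.inv_mult_group)

lemma outer_orb:
  assumes "g \<in> carrier G" "k \<in> carrier K" "p \<in> E"
  shows "outer g k ` orb p = orb (outer g k p)"
proof -
  have "outer g k (middle h p) = middle h (outer g k p)" if "h \<in> carrier H" for h
    using assms that by (auto simp: X Y)
  moreover have "outer g k ` orb p = (\<lambda>h. outer g k (middle h p)) ` carrier H"
    unfolding orbit_def by blast
  moreover have "orb (outer g k p) = (\<lambda>h. middle h (outer g k p)) ` carrier H"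
    unfolding orbit_def by blast
  ultimately show ?thesis by (simp cong: image_cong)
qed

lemma lact_orb:
  assumes "g \<in> carrier G" "p \<in> E"
  shows "lact XY g (orb p) = orb (outer g \<one>\<^bsub>K\<^esub> p)"
proof -
  have "lact XY g (orb p) = outer g \<one>\<^bsub>K\<^esub> ` orb p"
    unfolding biset_tensor_def
    by (simp, rule image_cong) (use gset.orbit_subset[OF gset_middle assms(2)] in \<open>auto simp: Y\<close>)
  then show ?thesis using outer_orb[OF assms(1) _ assms(2)] by simp
qed

lemma ract_orb:
  assumes "k \<in> carrier K" "p \<in> E"
  shows "ract XY (orb p) k = orb (outer \<one>\<^bsub>G\<^esub> k p)"
proof -
  have "ract XY (orb p) k = outer \<one>\<^bsub>G\<^esub> k ` orb p"
    unfolding biset_tensor_def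
    by (simp, rule image_cong) (use gset.orbit_subset[OF gset_middle assms(2)] in \<open>auto simp: X\<close>)
  then show ?thesis using outer_orb[OF _ assms] by simp
qed

lemma points_tensor: "points XY = orb ` E"
  by (auto simp: biset_tensor_def orbits_def)

lemma outer_E: "g \<in> carrier G \<Longrightarrow> k \<in> carrier K \<Longrightarrow> p \<in> E \<Longrightarrow> outer g k p \<in> E"
  by (auto simp: X Y)

lemma is_biset_tensor: "is_biset G K XY"
proof -
  have o: "outer g k (outer g' k' p) = outer (g \<otimes>\<^bsub>G\<^esub> g') (k' \<otimes>\<^bsub>K\<^esub> k) p" "outer \<one>\<^bsub>G\<^esub> \<one>\<^bsub>K\<^esub> p = p"
    if "g \<in> carrier G" "k \<in> carrier K" "g' \<in> carrier G" "k' \<in> carrier K" "p \<in> E" for g k g' k' p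
    using that by (auto simp: X Y)
  show ?thesis
    unfolding is_biset_def points_tensor
  proof (intro conjI ballI)
    show "finite (orb ` E)" using X(1) Y(1) by simp
  next
    fix g B assume "g \<in> carrier G" "B \<in> orb ` E"
    then show "lact XY g B \<in> orb ` E"
      using lact_orb outer_E[of g "\<one>\<^bsub>K\<^esub>"] by fastforce
  next
    fix B assume "B \<in> orb ` E"
    then obtain p where p: "p \<in> E" "B = orb p" by blast
    then show "lact XY \<one>\<^bsub>G\<^esub> B = B" "ract XY B \<one>\<^bsub>K\<^esub> = B"
      using o(2)[of "\<one>\<^bsub>G\<^esub>" "\<one>\<^bsub>K\<^esub>" "\<one>\<^bsub>G\<^esub>" "\<one>\<^bsub>K\<^esub>" p] lact_orb[of "\<one>\<^bsub>G\<^esub>" p] ract_orb[of "\<one>\<^bsub>K\<^esub>" p] by simp_all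
  next
    fix g g' B assume g: "g \<in> carrier G" "g' \<in> carrier G" and "B \<in> orb ` E"
    then obtain p where p: "p \<in> E" "B = orb p" by blast
    show "lact XY (g \<otimes>\<^bsub>G\<^esub> g') B = lact XY g (lact XY g' B)"
      unfolding p(2) lact_orb[OF GH.G.m_closed[OF g] p(1)] lact_orb[OF g(2) p(1)]
        lact_orb[OF g(1) outer_E[OF g(2) HK.H.one_closed p(1)]]
        o(1)[OF g(1) HK.H.one_closed g(2) HK.H.one_closed p(1)] by simp
  next
    fix B k assume k: "k \<in> carrier K" and "B \<in> orb ` E"
    then show "ract XY B k \<in> orb ` E"
      using ract_orb outer_E[of "\<one>\<^bsub>G\<^esub>" k] by fastforce
  next
    fix B k k' assume k: "k \<in> carrier K" "k' \<in> carrier K" and "B \<in> orb ` E"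
    then obtain p where p: "p \<in> E" "B = orb p" by blast
    show "ract XY B (k \<otimes>\<^bsub>K\<^esub> k') = ract XY (ract XY B k) k'"
      unfolding p(2) ract_orb[OF HK.H.m_closed[OF k] p(1)] ract_orb[OF k(1) p(1)]
        ract_orb[OF k(2) outer_E[OF GH.G.one_closed k(1) p(1)]]
        o(1)[OF GH.G.one_closed k(2) GH.G.one_closed k(1) p(1)] by simp
  next
    fix g B k assume g: "g \<in> carrier G" and k: "k \<in> carrier K" and "B \<in> orb ` E"
    then obtain p where p: "p \<in> E" "B = orb p" by blast
    show "ract XY (lact XY g B) k = lact XY g (ract XY B k)"
      unfolding p(2) ract_orb[OF k p(1)] lact_orb[OF g p(1)]
        ract_orb[OF k outer_E[OF g HK.H.one_closed p(1)]] lact_orb[OF g outer_E[OF GH.G.one_closed k p(1)]]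
        o(1)[OF GH.G.one_closed k g HK.H.one_closed p(1)] o(1)[OF g HK.H.one_closed GH.G.one_closed k p(1)]
      using g k by simp
  qed
qed

lemma prod_act_orb:
  assumes "g \<in> carrier G" "k \<in> carrier K" "p \<in> E"
  shows "prod_act G K XY (g, k) (orb p) = orb (outer g (inv\<^bsub>K\<^esub> k) p)"
proof -
  have "outer \<one>\<^bsub>G\<^esub> (inv\<^bsub>K\<^esub> k) (outer g \<one>\<^bsub>K\<^esub> p) = outer g (inv\<^bsub>K\<^esub> k) p"
    using assms by (auto simp: X Y)
  then show ?thesis
    unfolding prod_act_def
    using lact_orb[OF assms(1,3)] ract_orb[of "inv\<^bsub>K\<^esub> k" "outer g \<one>\<^bsub>K\<^esub> p"] outer_E[OF assms(1) HK.H.one_closed assms(3)] assms(2)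
    by simp
qed

text \<open>
The pair \<open>(g, k)\<close> fixes the orbit of \<open>(x, y)\<close> if and only if some \<open>h \<in> H\<close> satisfies \<open>gx = xh\<close> and
\<open>hy = yk\<close>, that is, \<open>(g, h)\<close> stabilizes \<open>x\<close> and \<open>(h, k)\<close> stabilizes \<open>y\<close>.
\<close>
lemma stabilizer_orb:
  assumes x: "x \<in> points X" and y: "y \<in> points Y"
  shows "stabilizer (G \<times>\<times> K) (prod_act G K XY) (orb (x, y)) = stX x O stY y"
proof -
  interpret E: gset H middle E by (rule gset_middle)
  have p: "(x, y) \<in> E" using x y by simp
  have "orb (outer g (inv\<^bsub>K\<^esub> k) (x, y)) = orb (x, y) \<longleftrightarrow> (g, k) \<in> stX x O stY y"
    if g: "g \<in> carrier G" and k: "k \<in> carrier K" for g k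
  proof -
    have q: "outer g (inv\<^bsub>K\<^esub> k) (x, y) \<in> E" using outer_E[of g "inv\<^bsub>K\<^esub> k" "(x, y)"] g k p by simp
    have "orb (outer g (inv\<^bsub>K\<^esub> k) (x, y)) = orb (x, y) \<longleftrightarrow> outer g (inv\<^bsub>K\<^esub> k) (x, y) \<in> orb (x, y)"
      using E.orbit_eq[OF p] E.orbit_self[OF q] by blast
    also have "\<dots> \<longleftrightarrow> (\<exists>h\<in>carrier H. lact X g x = ract X x (inv\<^bsub>H\<^esub> h) \<and> ract Y y (inv\<^bsub>K\<^esub> k) = lact Y h y)"
      unfolding E.mem_orbit by auto
    also have "\<dots> \<longleftrightarrow> (\<exists>h\<in>carrier H. lact X g x = ract X x h \<and> ract Y y (inv\<^bsub>K\<^esub> k) = lact Y (inv\<^bsub>H\<^esub> h) y)"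
      by (metis GH.H.inv_closed GH.H.inv_inv)
    also have "\<dots> \<longleftrightarrow> (\<exists>h\<in>carrier H. (g, h) \<in> stX x \<and> (h, k) \<in> stY y)"
    proof (rule bex_cong[OF refl], rule conj_cong)
      fix h assume h: "h \<in> carrier H"
      have 1: "ract X (ract X x h) (inv\<^bsub>H\<^esub> h) = x" and 2: "lact Y h (lact Y (inv\<^bsub>H\<^esub> h) y) = y"
        using x y h by (simp_all flip: X(7) Y(4) add: X(6) Y(3))
      have 3: "ract X (ract X (lact X g x) (inv\<^bsub>H\<^esub> h)) h = lact X g x"
        using x g h by (simp flip: X(7) add: X(2,6))
      have 4: "lact Y (inv\<^bsub>H\<^esub> h) (lact Y h (ract Y y (inv\<^bsub>K\<^esub> k))) = ract Y y (inv\<^bsub>K\<^esub> k)"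
        using y k h by (simp flip: Y(4) add: Y(3,5))
      show "lact X g x = ract X x h \<longleftrightarrow> (g, h) \<in> stX x"
        using 1 3 g h by (auto simp: stabilizer_def prod_act_def)
      show "ract Y y (inv\<^bsub>K\<^esub> k) = lact Y (inv\<^bsub>H\<^esub> h) y \<longleftrightarrow> (h, k) \<in> stY y"
        using 2 4 k h Y(8)[OF h HK.H.inv_closed[OF k] y] by (auto simp: stabilizer_def prod_act_def)
    qed
    also have "\<dots> \<longleftrightarrow> (g, k) \<in> stX x O stY y"
      by (auto simp: stabilizer_def)
    finally show ?thesis .
  qed
  moreover have "stX x O stY y \<subseteq> carrier G \<times> carrier K"
    by (auto simp: stabilizer_def)
  moreover have "stabilizer (G \<times>\<times> K) (prod_act G K XY) (orb (x, y)) =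
    {(g, k). g \<in> carrier G \<and> k \<in> carrier K \<and> orb (outer g (inv\<^bsub>K\<^esub> k) (x, y)) = orb (x, y)}"
    unfolding stabilizer_def using prod_act_orb[OF _ _ p] by auto
  ultimately show ?thesis by auto
qed

lemma stabilizer_middle:
  assumes x: "x \<in> points X" and y: "y \<in> points Y"
  shows "stabilizer H middle (x, y) = k2 G H (stX x) \<inter> k1 H K (stY y)"
  using assms by (auto simp: stabilizer_def k1_def k2_def prod_act_def X Y)

text \<open>
Both sides sum \<open>|stab\<^sub>H(x, y)|\<close> over the pairs whose orbit has stabilizer \<open>N\<close>. Grouped by orbits, each orbit
contributes \<open>|H|\<close>; grouped by the stabilizers of \<open>x\<close> and \<open>y\<close>, one finds the structure constants.
\<close>
theorem mark_tensor:
  "card (carrier H) * mark G K XY N = conv G H K (mark G H X) (mark H K Y) N"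
proof -
  interpret E: gset H middle E by (rule gset_middle)
  have finE: "finite E" using X(1) Y(1) by simp
  let ?st = "stabilizer (G \<times>\<times> K) (prod_act G K XY)"
  have "card (carrier H) * mark G K XY N = card (carrier H) * (\<Sum>B\<in>orbits H E middle. of_bool (?st B = N))"
    using is_bisetD(1)[OF is_biset_tensor] by (simp add: mark_def cnt_eq_sum) (simp add: biset_tensor_def)
  also have "\<dots> = (\<Sum>p\<in>E. card (E.stab p) * of_bool (?st (orb p) = N))"
    by (rule E.sum_over_orbits[OF GH.fin(2) finE, symmetric])
  also have "\<dots> = (\<Sum>(x, y)\<in>E. if stX x O stY y = N then card (k2 G H (stX x) \<inter> k1 H K (stY y)) else 0)"
  proof (rule sum.cong)
    fix p assume "p \<in> E"
    then obtain x y where "p = (x, y)" "x \<in> points X" "y \<in> points Y" by auto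
    then show "card (E.stab p) * of_bool (?st (orb p) = N) =
        (case p of (x, y) \<Rightarrow> if stX x O stY y = N then card (k2 G H (stX x) \<inter> k1 H K (stY y)) else 0)"
      using stabilizer_orb stabilizer_middle by simp
  qed simp
  also have "\<dots> = conv G H K (mark G H X) (mark H K Y) N"
    unfolding mark_def
    by (subst conv_cnt) (use X(1) Y(1) GH.stab_subgroups_of[OF bX] HK.stab_subgroups_of[OF bY] in \<open>auto simp: sum.cartesian_product\<close>)
  finally show ?thesis .
qed

end

end

section \<open>The Burnside group in terms of marks\<close>

text \<open>
Isomorphic bisets have the same counts, so the chosen representative does not matter.
\<close>
definition class_mark ::
    "('g, 'm) monoid_scheme \<Rightarrow> ('h, 'n) monoid_scheme \<Rightarrow> ('g, 'h) biset_class \<Rightarrow> ('g \<times> 'h) set \<Rightarrow> nat" where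
  "class_mark G H x = mark G H (SOME X. X \<in> x)"

context group_pair begin

abbreviation BM where "BM \<equiv> biset_monoid G H"
abbreviation cm where "cm \<equiv> class_mark G H"

lemma iso_class_eq_marks:
  "is_biset G H X \<Longrightarrow> iso_class G H X = {Y. is_biset G H Y \<and> mark G H Y = mark G H X}"
  using biset_isomorphic_iff_mark[of _ X] by (auto simp: iso_class_def)

lemma nat_biset:
  fixes X :: "('g, 'h, 'x) biset"
  assumes "is_biset G H X"
  obtains Y :: "('g, 'h, nat) biset" where "is_biset G H Y" "mark G H Y = mark G H X"
  using biset_of_gset[OF is_bisetD(1)[OF assms] gset_of_biset[OF assms]] unfolding mark_def[of G H X] by blast

lemma iso_class_in_carrier:
  fixes X :: "('g, 'h, 'x) biset"
  assumes "is_biset G H X"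
  shows "iso_class G H X \<in> carrier BM"
proof -
  obtain Y :: "('g, 'h, nat) biset" where "is_biset G H Y" "mark G H Y = mark G H X"
    using nat_biset[OF assms] by blast
  then have "iso_class G H X = iso_class G H Y" "is_biset G H Y" using assms by (simp_all add: iso_class_eq_marks)
  then show ?thesis unfolding biset_monoid_def by auto
qed

lemma class_mark_iso_class:
  fixes X :: "('g, 'h, 'x) biset"
  assumes "is_biset G H X"
  shows "cm (iso_class G H X) = mark G H X"
proof -
  obtain Y :: "('g, 'h, nat) biset" where "is_biset G H Y" "mark G H Y = mark G H X"
    using nat_biset[OF assms] by blast
  then have "Y \<in> iso_class G H X" using assms by (simp add: iso_class_eq_marks)
  then have "(SOME Y. Y \<in> iso_class G H X) \<in> iso_class G H X" by (rule someI[of "\<lambda>Y. Y \<in> iso_class G H X"])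
  then show ?thesis unfolding class_mark_def using iso_class_eq_marks[OF assms] by blast
qed

lemma BM_cases:
  assumes "x \<in> carrier BM"
  obtains X :: "('g, 'h, nat) biset" where "is_biset G H X" "x = iso_class G H X" "cm x = mark G H X"
proof -
  obtain X :: "('g, 'h, nat) biset" where X: "is_biset G H X" "x = iso_class G H X"
    using assms by (auto simp: biset_monoid_def)
  with class_mark_iso_class[OF X(1)] show thesis by (intro that) auto
qed

lemma BM_eq: "x \<in> carrier BM \<Longrightarrow> x = {Y. is_biset G H Y \<and> mark G H Y = cm x}"
  by (erule BM_cases) (simp add: iso_class_eq_marks)

lemma BM_mem: "x \<in> carrier BM \<Longrightarrow> X \<in> x \<longleftrightarrow> is_biset G H X \<and> mark G H X = cm x"
  by (subst BM_eq) simp_all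

lemma class_mark_inj: "x \<in> carrier BM \<Longrightarrow> y \<in> carrier BM \<Longrightarrow> cm x = cm y \<Longrightarrow> x = y"
  using BM_eq[of x] BM_eq[of y] by simp

lemma
  assumes x: "x \<in> carrier BM" and y: "y \<in> carrier BM"
  shows BM_mult_closed: "x \<otimes>\<^bsub>BM\<^esub> y \<in> carrier BM"
    and class_mark_mult: "cm (x \<otimes>\<^bsub>BM\<^esub> y) = (\<lambda>L. cm x L + cm y L)"
proof -
  obtain X :: "('g, 'h, nat) biset" where X: "is_biset G H X" "x = iso_class G H X" "cm x = mark G H X" using BM_cases[OF x] .
  obtain Y :: "('g, 'h, nat) biset" where Y: "is_biset G H Y" "y = iso_class G H Y" "cm y = mark G H Y" using BM_cases[OF y] .
  let ?Z = "biset_union X Y"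
  have Z: "is_biset G H ?Z" "mark G H ?Z = (\<lambda>L. cm x L + cm y L)"
    using biset_union[OF X(1) Y(1)] by (auto simp: X(3) Y(3))
  have XY: "iso_class G H (biset_union X' Y') = iso_class G H ?Z" if "X' \<in> x" "Y' \<in> y" for X' Y'
  proof -
    have 1: "is_biset G H X'" "mark G H X' = cm x" "is_biset G H Y'" "mark G H Y' = cm y"
      using that BM_mem[OF x] BM_mem[OF y] by simp_all
    then have "mark G H (biset_union X' Y') = mark G H ?Z"
      unfolding Z(2) by (auto simp: biset_union(2))
    then show ?thesis by (simp add: iso_class_eq_marks biset_union(1) 1 Z(1))
  qed
  have "X \<in> x" "Y \<in> y" using BM_mem[OF x, of X] BM_mem[OF y, of Y] X(1,3) Y(1,3) by simp_all
  then have ne: "x \<noteq> {}" "y \<noteq> {}" by blast+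
  have "x \<otimes>\<^bsub>BM\<^esub> y = (\<Union>X\<in>x. \<Union>Y\<in>y. iso_class G H (biset_union X Y))"
    by (simp add: biset_monoid_def)
  also have "\<dots> = iso_class G H ?Z" using XY ne by blast
  finally have e: "x \<otimes>\<^bsub>BM\<^esub> y = iso_class G H ?Z" .
  show "x \<otimes>\<^bsub>BM\<^esub> y \<in> carrier BM" unfolding e by (rule iso_class_in_carrier[OF Z(1)])
  show "cm (x \<otimes>\<^bsub>BM\<^esub> y) = (\<lambda>L. cm x L + cm y L)" unfolding e class_mark_iso_class[OF Z(1)] by (rule Z(2))
qed

definition union_relators where
  "union_relators = {frag_of (x \<otimes>\<^bsub>BM\<^esub> y) - frag_of x - frag_of y | x y. x \<in> carrier BM \<and> y \<in> carrier BM}"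

sublocale B: presentation "carrier BM" union_relators
proof
  fix a assume "a \<in> union_relators"
  then obtain x y where *: "a = frag_relator (x \<otimes>\<^bsub>BM\<^esub> y) x y" "x \<in> carrier BM" "y \<in> carrier BM"
    unfolding union_relators_def by blast
  then show "Poly_Mapping.keys a \<subseteq> carrier BM"
    by (simp only: keys_relator BM_mult_closed)
qed

abbreviation cl where "cl x \<equiv> B.cls (frag_of x)"

lemma grothendieck_rel_eq: "grothendieck_rel BM = B.K"
  by (simp add: grothendieck_rel_def union_relators_def)

lemma burnside_group_eq: "burnside_group G H = B.Q"
  by (simp add: burnside_group_def grothendieck_group_def grothendieck_rel_eq)

lemma burnside_class_eq: "burnside_class G H X = cl (iso_class G H X)"
  by (simp add: burnside_class_def grothendieck_class_def grothendieck_rel_eq)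

lemma comm_group_burnside: "comm_group B.Q"
  by (rule B.comm_group_quotient)

sublocale BG: comm_group B.Q by (rule comm_group_burnside)

lemma cl_mult:
  assumes "x \<in> carrier BM" "y \<in> carrier BM"
  shows "cl (x \<otimes>\<^bsub>BM\<^esub> y) = cl x \<otimes>\<^bsub>B.Q\<^esub> cl y"
proof -
  have "frag_relator (x \<otimes>\<^bsub>BM\<^esub> y) x y \<in> B.K"
    by (rule generate.incl) (use assms in \<open>unfold union_relators_def, blast\<close>)
  then have "frag_of (x \<otimes>\<^bsub>BM\<^esub> y) - (frag_of x + frag_of y) \<in> B.K"
    by (simp add: diff_diff_eq)
  then show ?thesis using assms by (simp add: B.mult_cls B.cls_eq_iff)
qed

lemma cl_closed [simp]: "x \<in> carrier BM \<Longrightarrow> cl x \<in> carrier B.Q"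
  by (rule B.gen_in_carrier)

text \<open>
The class of the empty biset is idempotent in the Burnside group and hence its neutral element.
\<close>
lemma empty_class:
  obtains z where "z \<in> carrier BM" "cm z = (\<lambda>L. 0)" "cl z = \<one>\<^bsub>B.Q\<^esub>"
proof -
  let ?E = "\<lparr>points = {}, lact = (\<lambda>g n. n), ract = (\<lambda>n h. n)\<rparr> :: ('g, 'h, nat) biset"
  have E: "is_biset G H ?E" by (simp add: is_biset_def)
  let ?z = "iso_class G H ?E"
  have z: "?z \<in> carrier BM" by (rule iso_class_in_carrier[OF E])
  have m: "cm ?z = (\<lambda>L. 0)" by (simp add: class_mark_iso_class[OF E] mark_def cnt_def[abs_def])
  have "?z \<otimes>\<^bsub>BM\<^esub> ?z = ?z"
    by (rule class_mark_inj[OF BM_mult_closed[OF z z] z]) (simp add: class_mark_mult[OF z z] m)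
  then have "cl ?z \<otimes>\<^bsub>B.Q\<^esub> cl ?z = cl ?z" using cl_mult[OF z z] by simp
  then have "cl ?z = \<one>\<^bsub>B.Q\<^esub>" using BG.l_cancel_one'[of "cl ?z" "cl ?z"] cl_closed[OF z] by simp
  with z m show thesis by (rule that)
qed

lemma cl_pow:
  assumes "x \<in> carrier BM"
  obtains z where "z \<in> carrier BM" "cm z = (\<lambda>L. n * cm x L)" "cl z = cl x [^]\<^bsub>B.Q\<^esub> (n::nat)"
proof -
  have "\<exists>z\<in>carrier BM. cm z = (\<lambda>L. n * cm x L) \<and> cl z = cl x [^]\<^bsub>B.Q\<^esub> n"
  proof (induction n)
    case 0
    obtain z where "z \<in> carrier BM" "cm z = (\<lambda>L. 0)" "cl z = \<one>\<^bsub>B.Q\<^esub>" using empty_class .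
    then show ?case by (intro bexI[of _ z]) (simp_all del: one_FactGroup)
  next
    case (Suc n)
    then obtain z where z: "z \<in> carrier BM" "cm z = (\<lambda>L. n * cm x L)" "cl z = cl x [^]\<^bsub>B.Q\<^esub> n" by blast
    show ?case
      by (rule bexI[of _ "z \<otimes>\<^bsub>BM\<^esub> x"])
         (use z assms in \<open>simp_all add: BM_mult_closed class_mark_mult cl_mult algebra_simps\<close>)
  qed
  then show thesis using that by blast
qed

text \<open>
A product of nonnegative powers of classes is again the class of a biset. Together with
\<open>class_mark_inj\<close> this reduces identities between such products to identities between counts.
\<close>
lemma cl_finprod:
  assumes "finite I" "\<And>i. i \<in> I \<Longrightarrow> x i \<in> carrier BM"
  obtains z where "z \<in> carrier BM" "cm z = (\<lambda>L. \<Sum>i\<in>I. n i * cm (x i) L)"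
    "cl z = (\<Otimes>\<^bsub>B.Q\<^esub>i\<in>I. cl (x i) [^]\<^bsub>B.Q\<^esub> (n i :: nat))"
proof -
  have "\<exists>z\<in>carrier BM. cm z = (\<lambda>L. \<Sum>i\<in>I. n i * cm (x i) L) \<and> cl z = (\<Otimes>\<^bsub>B.Q\<^esub>i\<in>I. cl (x i) [^]\<^bsub>B.Q\<^esub> n i)"
    using assms
  proof (induction I)
    case empty
    obtain z where "z \<in> carrier BM" "cm z = (\<lambda>L. 0)" "cl z = \<one>\<^bsub>B.Q\<^esub>" using empty_class .
    then show ?case by (intro bexI[of _ z]) (simp_all del: one_FactGroup)
  next
    case (insert i I)
    then obtain z where z: "z \<in> carrier BM" "cm z = (\<lambda>L. \<Sum>i\<in>I. n i * cm (x i) L)"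
      "cl z = (\<Otimes>\<^bsub>B.Q\<^esub>i\<in>I. cl (x i) [^]\<^bsub>B.Q\<^esub> n i)" by auto
    have xi: "x i \<in> carrier BM" using insert.prems by blast
    obtain w where w: "w \<in> carrier BM" "cm w = (\<lambda>L. n i * cm (x i) L)" "cl w = cl (x i) [^]\<^bsub>B.Q\<^esub> n i"
      using cl_pow[OF xi] by blast
    have f: "(\<lambda>i. cl (x i) [^]\<^bsub>B.Q\<^esub> n i) \<in> I \<rightarrow> carrier B.Q" "cl (x i) [^]\<^bsub>B.Q\<^esub> n i \<in> carrier B.Q"
      using insert.prems by (auto intro!: BG.nat_pow_closed cl_closed)
    show ?case
      by (rule bexI[of _ "w \<otimes>\<^bsub>BM\<^esub> z"])
         (use z w insert.hyps f in \<open>simp_all add: BM_mult_closed class_mark_mult cl_mult\<close>)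
  qed
  then show thesis using that by blast
qed

end

section \<open>The product on Burnside groups\<close>

context group_triple begin

definition class_tensor where "class_tensor x y = (\<Union>X\<in>x. \<Union>Y\<in>y. iso_class G K (biset_tensor H X Y))"

lemma card_H_pos: "card (carrier H) > 0"
  using GH.fin(2) GH.H.one_closed by (auto simp: card_gt_0_iff)

lemma
  assumes x: "x \<in> carrier GH.BM" and y: "y \<in> carrier HK.BM"
  shows class_tensor_closed: "class_tensor x y \<in> carrier GK.BM"
    and class_mark_tensor: "card (carrier H) * GK.cm (class_tensor x y) N = conv G H K (GH.cm x) (HK.cm y) N"
proof -
  obtain X :: "('g, 'h, nat) biset" where X: "is_biset G H X" "x = iso_class G H X" "GH.cm x = mark G H X" using GH.BM_cases[OF x] .
  obtain Y :: "('h, 'k, nat) biset" where Y: "is_biset H K Y" "y = iso_class H K Y" "HK.cm y = mark H K Y" using HK.BM_cases[OF y] .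
  let ?Z = "biset_tensor H X Y"
  have Z: "is_biset G K ?Z" by (rule is_biset_tensor[OF X(1) Y(1)])
  have XY: "iso_class G K (biset_tensor H X' Y') = iso_class G K ?Z" if "X' \<in> x" "Y' \<in> y" for X' Y'
  proof -
    have 1: "is_biset G H X'" "mark G H X' = GH.cm x" "is_biset H K Y'" "mark H K Y' = HK.cm y"
      using that GH.BM_mem[OF x] HK.BM_mem[OF y] by simp_all
    have "card (carrier H) * mark G K (biset_tensor H X' Y') N = card (carrier H) * mark G K ?Z N" for N
      unfolding mark_tensor[OF X(1) Y(1)] mark_tensor[OF 1(1,3)] 1(2,4) X(3) Y(3) ..
    then have "mark G K (biset_tensor H X' Y') = mark G K ?Z"
      using card_H_pos by auto
    then show ?thesis by (simp add: GK.iso_class_eq_marks is_biset_tensor[OF 1(1,3)] Z)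
  qed
  have "X \<in> x" "Y \<in> y" using GH.BM_mem[OF x, of X] HK.BM_mem[OF y, of Y] X(1,3) Y(1,3) by simp_all
  then have ne: "x \<noteq> {}" "y \<noteq> {}" by blast+
  have e: "class_tensor x y = iso_class G K ?Z" unfolding class_tensor_def using XY ne by blast
  show "class_tensor x y \<in> carrier GK.BM" unfolding e by (rule GK.iso_class_in_carrier[OF Z])
  show "card (carrier H) * GK.cm (class_tensor x y) N = conv G H K (GH.cm x) (HK.cm y) N"
    unfolding e GK.class_mark_iso_class[OF Z] X(3) Y(3) by (rule mark_tensor[OF X(1) Y(1)])
qed

text \<open>
The counts of both sides agree after multiplication by \<open>|H|\<close>, and counts determine classes.
\<close>
lemma class_tensor_distrib_left:
  assumes "x \<in> carrier GH.BM" "x' \<in> carrier GH.BM" "y \<in> carrier HK.BM"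
  shows "class_tensor (x \<otimes>\<^bsub>GH.BM\<^esub> x') y = class_tensor x y \<otimes>\<^bsub>GK.BM\<^esub> class_tensor x' y"
proof (rule GK.class_mark_inj)
  have "card (carrier H) * GK.cm (class_tensor (x \<otimes>\<^bsub>GH.BM\<^esub> x') y) N = card (carrier H) * GK.cm (class_tensor x y \<otimes>\<^bsub>GK.BM\<^esub> class_tensor x' y) N" for N
    using assms by (simp add: class_mark_tensor GH.BM_mult_closed GH.class_mark_mult GK.class_mark_mult class_tensor_closed
        add_mult_distrib2 conv_add_left)
  then show "GK.cm (class_tensor (x \<otimes>\<^bsub>GH.BM\<^esub> x') y) = GK.cm (class_tensor x y \<otimes>\<^bsub>GK.BM\<^esub> class_tensor x' y)" using card_H_pos by auto
qed (use assms in \<open>simp_all add: class_tensor_closed GH.BM_mult_closed GK.BM_mult_closed\<close>)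

lemma class_tensor_distrib_right:
  assumes "x \<in> carrier GH.BM" "y \<in> carrier HK.BM" "y' \<in> carrier HK.BM"
  shows "class_tensor x (y \<otimes>\<^bsub>HK.BM\<^esub> y') = class_tensor x y \<otimes>\<^bsub>GK.BM\<^esub> class_tensor x y'"
proof (rule GK.class_mark_inj)
  have "card (carrier H) * GK.cm (class_tensor x (y \<otimes>\<^bsub>HK.BM\<^esub> y')) N = card (carrier H) * GK.cm (class_tensor x y \<otimes>\<^bsub>GK.BM\<^esub> class_tensor x y') N" for N
    using assms by (simp add: class_mark_tensor HK.BM_mult_closed HK.class_mark_mult GK.class_mark_mult class_tensor_closed
        add_mult_distrib2 conv_add_right)
  then show "GK.cm (class_tensor x (y \<otimes>\<^bsub>HK.BM\<^esub> y')) = GK.cm (class_tensor x y \<otimes>\<^bsub>GK.BM\<^esub> class_tensor x y')" using card_H_pos by auto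
qed (use assms in \<open>simp_all add: class_tensor_closed HK.BM_mult_closed GK.BM_mult_closed\<close>)

sublocale M: biadditive_extension "carrier GH.BM" GH.union_relators "carrier HK.BM" HK.union_relators "carrier GK.BM" GK.union_relators class_tensor
proof
  have rel: "frag_relator (u \<otimes>\<^bsub>GK.BM\<^esub> v) u v \<in> GK.B.K" if "u \<in> carrier GK.BM" "v \<in> carrier GK.BM" for u v
    by (rule generate.incl) (use that in \<open>unfold GK.union_relators_def, blast\<close>)
  show "frag_extend (\<lambda>x. frag_of (class_tensor x y)) a \<in> GK.B.K" if a: "a \<in> GH.union_relators" and y: "y \<in> carrier HK.BM" for a y
  proof -
    obtain x x' where x: "a = frag_relator (x \<otimes>\<^bsub>GH.BM\<^esub> x') x x'" "x \<in> carrier GH.BM" "x' \<in> carrier GH.BM"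
      using a unfolding GH.union_relators_def by blast
    have "frag_extend (\<lambda>x. frag_of (class_tensor x y)) a = frag_relator (class_tensor x y \<otimes>\<^bsub>GK.BM\<^esub> class_tensor x' y) (class_tensor x y) (class_tensor x' y)"
      by (simp add: x frag_extend_diff class_tensor_distrib_left y)
    then show ?thesis using rel class_tensor_closed x y by simp
  qed
  show "frag_extend (\<lambda>y. frag_of (class_tensor x y)) b \<in> GK.B.K" if x: "x \<in> carrier GH.BM" and b: "b \<in> HK.union_relators" for x b
  proof -
    obtain y y' where y: "b = frag_relator (y \<otimes>\<^bsub>HK.BM\<^esub> y') y y'" "y \<in> carrier HK.BM" "y' \<in> carrier HK.BM"
      using b unfolding HK.union_relators_def by blast
    have "frag_extend (\<lambda>y. frag_of (class_tensor x y)) b = frag_relator (class_tensor x y \<otimes>\<^bsub>GK.BM\<^esub> class_tensor x y') (class_tensor x y) (class_tensor x y')"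
      by (simp add: y frag_extend_diff class_tensor_distrib_right x)
    then show ?thesis using rel class_tensor_closed x y by simp
  qed
qed (rule class_tensor_closed)

lemma burnside_mult_eq: "burnside_mult G H K = M.ext"
  by (simp add: burnside_mult_def GK.grothendieck_rel_eq class_tensor_def[abs_def])

end

section \<open>Finitely generated free modules\<close>

context cring begin

abbreviation nr :: "nat \<Rightarrow> 'a" where "nr n \<equiv> [n] \<cdot>\<^bsub>R\<^esub> \<one>"

lemma nr_closed [simp]: "nr n \<in> carrier R"
  by (rule add.nat_pow_closed) simp

lemma nr_add: "nr (m + n) = nr m \<oplus> nr n"
  by (simp add: add.nat_pow_mult)

lemma nr_mult: "nr (m * n) = nr m \<otimes> nr n"
  by (simp add: add_pow_ldistr add.nat_pow_pow mult.commute)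

lemma add_pow_eq_nr: "a \<in> carrier R \<Longrightarrow> [n] \<cdot>\<^bsub>R\<^esub> a = nr n \<otimes> a"
  by (simp add: add_pow_ldistr)

lemma nr_sum: "nr (\<Sum>i\<in>I. f i) = (\<Oplus>i\<in>I. nr (f i))"
  by (induction I rule: infinite_finite_induct) (simp_all add: nr_add finsum_insert[OF _ _ Pi_I])

lemma finsum_of_bool:
  assumes "finite I"
  shows "(\<Oplus>i\<in>I. if P i then \<one> else \<zero>) = nr (card {i \<in> I. P i})"
proof -
  have "(\<Oplus>i\<in>I. if P i then \<one> else \<zero>) = (\<Oplus>i\<in>I. nr (of_bool (P i)))"
    by (rule finsum_cong') auto
  also have "\<dots> = nr (\<Sum>i\<in>I. of_bool (P i))" by (rule nr_sum[symmetric])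
  finally show ?thesis using assms by (simp add: of_bool_def sum.If_cases Int_def)
qed

end

lemma additive_finsum:
  assumes "abelian_group M" "abelian_group N" and f: "f \<in> carrier M \<rightarrow> carrier N"
    and add: "\<And>x y. x \<in> carrier M \<Longrightarrow> y \<in> carrier M \<Longrightarrow> f (x \<oplus>\<^bsub>M\<^esub> y) = f x \<oplus>\<^bsub>N\<^esub> f y"
    and "finite I" and "\<And>i. i \<in> I \<Longrightarrow> a i \<in> carrier M"
  shows "f (\<Oplus>\<^bsub>M\<^esub>i\<in>I. a i) = (\<Oplus>\<^bsub>N\<^esub>i\<in>I. f (a i))"
proof -
  interpret M: abelian_group M by fact
  interpret N: abelian_group N by fact
  have fc: "f x \<in> carrier N" if "x \<in> carrier M" for x using f that by blast
  have z: "f \<zero>\<^bsub>M\<^esub> = \<zero>\<^bsub>N\<^esub>"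
    using add[of "\<zero>\<^bsub>M\<^esub>" "\<zero>\<^bsub>M\<^esub>"] fc[of "\<zero>\<^bsub>M\<^esub>"] by (simp add: N.add.l_cancel_one')
  show ?thesis
    using assms(5,6)
  proof (induction I)
    case (insert i I)
    then have "a \<in> I \<rightarrow> carrier M" "(\<lambda>i. f (a i)) \<in> I \<rightarrow> carrier N" by (auto intro: fc)
    with insert show ?case by (simp add: add fc)
  qed (simp add: z)
qed

text \<open>
Over a finite basis all functions have finite support, and identities can be checked coordinatewise.
\<close>
locale finite_free_module = cring R for R (structure) +
  fixes S :: "'s set"
  assumes finite_S: "finite S"
begin

abbreviation N where "N \<equiv> free_module R S"
abbreviation basis where "basis \<equiv> basis_elem R S"

lemma carrier_N: "carrier N = S \<rightarrow>\<^sub>E carrier R"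
  using finite_S by (auto simp: free_module_def)

lemma coord_closed [simp]: "u \<in> carrier N \<Longrightarrow> s \<in> S \<Longrightarrow> u s \<in> carrier R"
  by (auto simp: carrier_N)

lemma N_I: "(\<And>s. s \<in> S \<Longrightarrow> f s \<in> carrier R) \<Longrightarrow> (\<lambda>s\<in>S. f s) \<in> carrier N"
  by (simp add: carrier_N)

lemma N_eqI: "u \<in> carrier N \<Longrightarrow> v \<in> carrier N \<Longrightarrow> (\<And>s. s \<in> S \<Longrightarrow> u s = v s) \<Longrightarrow> u = v"
  by (auto simp: carrier_N intro: PiE_ext)

lemma coord_add [simp]: "s \<in> S \<Longrightarrow> (u \<oplus>\<^bsub>N\<^esub> v) s = u s \<oplus> v s"
  and coord_smult [simp]: "s \<in> S \<Longrightarrow> (r \<odot>\<^bsub>N\<^esub> u) s = r \<otimes> u s"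
  and coord_zero [simp]: "s \<in> S \<Longrightarrow> \<zero>\<^bsub>N\<^esub> s = \<zero>"
  by (simp_all add: free_module_def)

lemma add_N_closed: "u \<in> carrier N \<Longrightarrow> v \<in> carrier N \<Longrightarrow> u \<oplus>\<^bsub>N\<^esub> v \<in> carrier N"
  and zero_N_closed: "\<zero>\<^bsub>N\<^esub> \<in> carrier N"
  and smult_N_closed: "r \<in> carrier R \<Longrightarrow> u \<in> carrier N \<Longrightarrow> r \<odot>\<^bsub>N\<^esub> u \<in> carrier N"
  unfolding carrier_N by (auto simp: free_module_def)

lemma abelian_group_N: "abelian_group N"
proof (rule abelian_groupI)
  fix u assume u: "u \<in> carrier N"
  show "\<exists>v\<in>carrier N. v \<oplus>\<^bsub>N\<^esub> u = \<zero>\<^bsub>N\<^esub>"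
  proof
    show m: "(\<lambda>s\<in>S. \<ominus> u s) \<in> carrier N" using u by (intro N_I) simp
    show "(\<lambda>s\<in>S. \<ominus> u s) \<oplus>\<^bsub>N\<^esub> u = \<zero>\<^bsub>N\<^esub>"
      by (rule N_eqI) (use u m in \<open>simp_all add: add_N_closed zero_N_closed l_neg\<close>)
  qed
qed (auto intro!: N_eqI add_N_closed zero_N_closed simp: a_ac)

sublocale N: module R N
  by (rule moduleI[OF is_cring abelian_group_N])
     (auto intro!: N_eqI add_N_closed smult_N_closed simp: l_distr r_distr m_assoc)

lemma coord_finsum:
  assumes "finite I" "\<And>i. i \<in> I \<Longrightarrow> f i \<in> carrier N" "s \<in> S"
  shows "(\<Oplus>\<^bsub>N\<^esub>i\<in>I. f i) s = (\<Oplus>i\<in>I. f i s)"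
  by (rule additive_finsum[OF abelian_group_N is_abelian_group _ _ assms(1,2)])
     (use assms in \<open>auto\<close>)

lemma basis_closed: "basis t \<in> carrier N"
  unfolding basis_elem_def by (rule N_I) simp

lemma coord_basis: "s \<in> S \<Longrightarrow> basis t s = (if s = t then \<one> else \<zero>)"
  by (simp add: basis_elem_def)

lemma basis_expansion:
  assumes "u \<in> carrier N"
  shows "u = (\<Oplus>\<^bsub>N\<^esub>t\<in>S. u t \<odot>\<^bsub>N\<^esub> basis t)"
proof (rule N_eqI[OF assms])
  have c: "u t \<odot>\<^bsub>N\<^esub> basis t \<in> carrier N" if "t \<in> S" for t
    using assms that by (simp add: smult_N_closed basis_closed)
  then show "(\<Oplus>\<^bsub>N\<^esub>t\<in>S. u t \<odot>\<^bsub>N\<^esub> basis t) \<in> carrier N" by (intro N.M.finsum_closed) auto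
  fix s assume s: "s \<in> S"
  have "(\<Oplus>\<^bsub>N\<^esub>t\<in>S. u t \<odot>\<^bsub>N\<^esub> basis t) s = (\<Oplus>t\<in>S. (u t \<odot>\<^bsub>N\<^esub> basis t) s)"
    by (rule coord_finsum[OF finite_S c s])
  also have "\<dots> = (\<Oplus>t\<in>S. if s = t then u t else \<zero>)"
    by (rule finsum_cong') (use assms s in \<open>auto simp: coord_basis\<close>)
  also have "\<dots> = u s"
    by (rule finsum_singleton) (use assms s finite_S in auto)
  finally show "u s = (\<Oplus>\<^bsub>N\<^esub>t\<in>S. u t \<odot>\<^bsub>N\<^esub> basis t) s" ..
qed

definition vec :: "('s \<Rightarrow> nat) \<Rightarrow> 's \<Rightarrow> 'a" where "vec m = (\<lambda>s\<in>S. nr (m s))"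

lemma vec_closed [simp]: "vec m \<in> carrier N"
  unfolding vec_def by (rule N_I) simp

lemma coord_vec [simp]: "s \<in> S \<Longrightarrow> vec m s = nr (m s)"
  by (simp add: vec_def)

lemma vec_add: "vec (\<lambda>s. m s + n s) = vec m \<oplus>\<^bsub>N\<^esub> vec n"
  by (rule N_eqI) (auto simp: add_N_closed nr_add)

lemma finsum_basis:
  assumes "finite I"
  shows "(\<Oplus>\<^bsub>N\<^esub>i\<in>I. basis (d i)) = vec (cnt I d)"
proof (rule N_eqI)
  show "(\<Oplus>\<^bsub>N\<^esub>i\<in>I. basis (d i)) \<in> carrier N" by (intro N.M.finsum_closed) (auto intro: basis_closed)
  fix s assume s: "s \<in> S"
  have "(\<Oplus>\<^bsub>N\<^esub>i\<in>I. basis (d i)) s = (\<Oplus>i\<in>I. basis (d i) s)"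
    by (rule coord_finsum[OF assms basis_closed s])
  also have "\<dots> = (\<Oplus>i\<in>I. if d i = s then \<one> else \<zero>)"
    by (rule finsum_cong') (auto simp: coord_basis s)
  finally show "(\<Oplus>\<^bsub>N\<^esub>i\<in>I. basis (d i)) s = vec (cnt I d) s"
    by (simp add: finsum_of_bool assms cnt_def s)
qed simp

end

section \<open>The mark homomorphism\<close>

locale ring_pair = R: cring R + group_pair G H
  for R :: "('r, 's) ring_scheme" (structure) and G :: "('g, 'm) monoid_scheme" and H :: "('h, 'n) monoid_scheme"
begin

sublocale L: finite_free_module R "subgroups_of (G \<times>\<times> H)"
  by unfold_locales (rule finite_subgroups_of)

sublocale RB: tensor R B.Q
  by (intro tensor.intro R.is_cring comm_group_burnside)

abbreviation S where "S \<equiv> subgroups_of (G \<times>\<times> H)"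
abbreviation A where "A \<equiv> burnside_module R G H"

lemma burnside_module_eq: "A = RB.T"
  by (simp add: burnside_module_def burnside_group_eq)

lemma burnside_module_class_eq: "burnside_module_class R G H X = RB.pure \<one> (cl (iso_class G H X))"
  by (simp add: burnside_module_class_def burnside_group_eq burnside_class_eq)

lemma subgroup_module_eq: "subgroup_module R (G \<times>\<times> H) = L.N"
  by (simp add: subgroup_module_def)

text \<open>
The elements \<open>r \<otimes> [X]\<close> generate \<open>RB(G,H)\<close>: first \<open>r\<close> is fixed and the second tensor factor runs through
the group generated by the classes, then arbitrary sums of pure tensors are reached.
\<close>
lemma additive_maps_eq:
  assumes "abelian_group M" and fg: "f \<in> carrier RB.T \<rightarrow> carrier M" "g \<in> carrier RB.T \<rightarrow> carrier M"
    and f: "\<And>u v. u \<in> carrier RB.T \<Longrightarrow> v \<in> carrier RB.T \<Longrightarrow> f (u \<oplus>\<^bsub>RB.T\<^esub> v) = f u \<oplus>\<^bsub>M\<^esub> f v"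
    and g: "\<And>u v. u \<in> carrier RB.T \<Longrightarrow> v \<in> carrier RB.T \<Longrightarrow> g (u \<oplus>\<^bsub>RB.T\<^esub> v) = g u \<oplus>\<^bsub>M\<^esub> g v"
    and eq: "\<And>r x. r \<in> carrier R \<Longrightarrow> x \<in> carrier BM \<Longrightarrow> f (RB.pure r (cl x)) = g (RB.pure r (cl x))"
    and u: "u \<in> carrier RB.T"
  shows "f u = g u"
proof -
  interpret M: abelian_group M by fact
  have z: "f \<zero>\<^bsub>RB.T\<^esub> = g \<zero>\<^bsub>RB.T\<^esub>"
    using f[of "\<zero>\<^bsub>RB.T\<^esub>" "\<zero>\<^bsub>RB.T\<^esub>"] g[of "\<zero>\<^bsub>RB.T\<^esub>" "\<zero>\<^bsub>RB.T\<^esub>"] fg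
      funcset_mem[OF fg(1), of "\<zero>\<^bsub>RB.T\<^esub>"] funcset_mem[OF fg(2), of "\<zero>\<^bsub>RB.T\<^esub>"]
    by (simp add: M.add.l_cancel_one')
  have cancel: "f u = g u" if "u \<in> carrier RB.T" "w \<in> carrier RB.T" "f w = g w"
    "f (u \<oplus>\<^bsub>RB.T\<^esub> w) = g (u \<oplus>\<^bsub>RB.T\<^esub> w)" for u w
    using that f[of u w] g[of u w] funcset_mem[OF fg(1), of u] funcset_mem[OF fg(2), of u]
      funcset_mem[OF fg(2), of w] by simp
  have on_pure: "f (RB.pure r b) = g (RB.pure r b)" if r: "r \<in> carrier R" and b: "b \<in> carrier B.Q" for r b
    using b
  proof (induction rule: B.quotient_induct)
    case zero
    show ?case using z unfolding RB.pure_one_right[OF r] .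
  next
    case (gen x)
    then show ?case by (rule eq[OF r])
  next
    case (diff u v w)
    show ?case
      by (rule cancel[of _ "RB.pure r w"])
         (use diff r in \<open>simp_all add: RB.pure_closed RB.pure_add_right[symmetric]\<close>)
  qed
  show ?thesis
    using u
  proof (induction rule: RB.tensor_induct)
    case zero show ?case by (rule z)
  next
    case (pure r a) then show ?case by (rule on_pure)
  next
    case (diff u v w)
    then show ?case using cancel[of u w] by simp
  qed
qed

text \<open>
Stabilizer counts are additive on disjoint unions, hence define a homomorphism on \<open>B(G,H)\<close>; the
universal property of the tensor product extends the scalars.
\<close>
lemma mark_hom_exists:
  obtains f where "f \<in> linear_maps R RB.T L.N"
    "\<And>r x. r \<in> carrier R \<Longrightarrow> x \<in> carrier BM \<Longrightarrow> f (RB.pure r (cl x)) = r \<odot>\<^bsub>L.N\<^esub> L.vec (cm x)"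
proof -
  obtain h where h: "h \<in> hom B.Q (add_monoid L.N)" "\<And>x. x \<in> carrier BM \<Longrightarrow> h (cl x) = L.vec (cm x)"
  proof (rule B.hom_from_presentation[where f = "\<lambda>x. L.vec (cm x)" and N = "add_monoid L.N"])
    show "comm_group (add_monoid L.N)" by (rule L.N.M.a_comm_group)
    show "L.vec (cm x) \<in> carrier (add_monoid L.N)" if "x \<in> carrier BM" for x by simp
  next
    fix h a assume h: "h \<in> hom B.F (add_monoid L.N)"
      and hf: "\<And>x. x \<in> carrier BM \<Longrightarrow> h (frag_of x) = L.vec (cm x)" and "a \<in> union_relators"
    then obtain x y where *: "a = frag_relator (x \<otimes>\<^bsub>BM\<^esub> y) x y" "x \<in> carrier BM" "y \<in> carrier BM"
      unfolding union_relators_def by blast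
    show "h a = \<one>\<^bsub>add_monoid L.N\<^esub>"
      unfolding *(1)
      using hom_frag_relator[OF L.abelian_group_N h BM_mult_closed[OF *(2,3)] *(2,3)] *(2,3)
      by (simp add: hf BM_mult_closed class_mark_mult L.vec_add)
  qed blast
  have hc: "h b \<in> carrier L.N" if "b \<in> carrier B.Q" for b
    using h(1) that by (auto simp: hom_def)
  have hm: "h (b \<otimes>\<^bsub>B.Q\<^esub> c) = h b \<oplus>\<^bsub>L.N\<^esub> h c" if "b \<in> carrier B.Q" "c \<in> carrier B.Q" for b c
    using h(1) that by (auto simp: hom_def)
  obtain g where g: "g \<in> carrier RB.T \<rightarrow> carrier L.N"
    "\<And>u v. u \<in> carrier RB.T \<Longrightarrow> v \<in> carrier RB.T \<Longrightarrow> g (u \<oplus>\<^bsub>RB.T\<^esub> v) = g u \<oplus>\<^bsub>L.N\<^esub> g v"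
    "\<And>r b. r \<in> carrier R \<Longrightarrow> b \<in> carrier B.Q \<Longrightarrow> g (RB.pure r b) = r \<odot>\<^bsub>L.N\<^esub> h b"
    by (rule RB.hom_from_tensor[OF L.abelian_group_N, of "\<lambda>r b. r \<odot>\<^bsub>L.N\<^esub> h b"])
       (auto simp: hc hm L.N.smult_l_distr L.N.smult_r_distr)
  note gc = funcset_mem[OF g(1)]
  have "g (r \<odot>\<^bsub>RB.T\<^esub> u) = r \<odot>\<^bsub>L.N\<^esub> g u" if r: "r \<in> carrier R" and u: "u \<in> carrier RB.T" for r u
  proof (rule additive_maps_eq[OF L.abelian_group_N _ _ _ _ _ u])
    show "(\<lambda>u. g (r \<odot>\<^bsub>RB.T\<^esub> u)) \<in> carrier RB.T \<rightarrow> carrier L.N"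
      using r by (auto intro!: gc RB.smult_closed)
    show "(\<lambda>u. r \<odot>\<^bsub>L.N\<^esub> g u) \<in> carrier RB.T \<rightarrow> carrier L.N"
      using r gc by (auto intro!: L.N.smult_closed)
    show "g (r \<odot>\<^bsub>RB.T\<^esub> (u \<oplus>\<^bsub>RB.T\<^esub> v)) = g (r \<odot>\<^bsub>RB.T\<^esub> u) \<oplus>\<^bsub>L.N\<^esub> g (r \<odot>\<^bsub>RB.T\<^esub> v)"
      if "u \<in> carrier RB.T" "v \<in> carrier RB.T" for u v
      using that r by (simp add: RB.smult_add RB.smult_closed g(2))
    show "r \<odot>\<^bsub>L.N\<^esub> g (u \<oplus>\<^bsub>RB.T\<^esub> v) = r \<odot>\<^bsub>L.N\<^esub> g u \<oplus>\<^bsub>L.N\<^esub> r \<odot>\<^bsub>L.N\<^esub> g v"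
      if "u \<in> carrier RB.T" "v \<in> carrier RB.T" for u v
      using that r gc by (simp add: L.N.smult_r_distr g(2))
    show "g (r \<odot>\<^bsub>RB.T\<^esub> RB.pure s (cl x)) = r \<odot>\<^bsub>L.N\<^esub> g (RB.pure s (cl x))"
      if "s \<in> carrier R" "x \<in> carrier BM" for s x
      using that r by (simp add: RB.smult_pure g(3) hc L.N.smult_assoc1)
  qed
  then have "g \<in> linear_maps R RB.T L.N"
    using g by (simp add: linear_maps_def)
  then show thesis by (rule that) (simp add: g(3) h(2))
qed

lemma finsum_stabilizers:
  assumes "is_biset G H X"
  shows "(\<Oplus>\<^bsub>L.N\<^esub>x\<in>points X. L.basis (stabilizer (G \<times>\<times> H) (prod_act G H X) x)) = L.vec (mark G H X)"
  unfolding mark_def by (rule L.finsum_basis[OF is_bisetD(1)[OF assms]])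

text \<open>
The description that defines \<open>\<alpha>\<close> has exactly one solution: the homomorphism just constructed is one,
and linear maps are determined by their values on the classes of bisets.
\<close>
lemma
  shows alpha_linear: "alpha R G H \<in> linear_maps R A L.N"
    and alpha_pure: "\<And>r x. r \<in> carrier R \<Longrightarrow> x \<in> carrier BM \<Longrightarrow>
          alpha R G H (RB.pure r (cl x)) = r \<odot>\<^bsub>L.N\<^esub> L.vec (cm x)"
proof -
  let ?P = "\<lambda>f. f \<in> linear_maps R A L.N \<and> f \<in> extensional (carrier A) \<and>
     (\<forall>X :: ('g, 'h, nat) biset. is_biset G H X \<longrightarrow> f (burnside_module_class R G H X) = L.vec (mark G H X))"
  obtain f where f: "f \<in> linear_maps R RB.T L.N"
    "\<And>r x. r \<in> carrier R \<Longrightarrow> x \<in> carrier BM \<Longrightarrow> f (RB.pure r (cl x)) = r \<odot>\<^bsub>L.N\<^esub> L.vec (cm x)"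
    using mark_hom_exists by blast
  have alpha: "alpha R G H = (THE f. ?P f)"
    unfolding alpha_def subgroup_module_eq subgroup_basis_def
    by (intro arg_cong[where f = The] ext conj_cong refl iff_allI imp_cong) (simp_all add: finsum_stabilizers)
  have PI: "?P (restrict f (carrier A))"
  proof (intro conjI allI impI)
    show "restrict f (carrier A) \<in> linear_maps R A L.N"
      using f(1) by (auto simp: linear_maps_def burnside_module_eq RB.smult_closed)
    fix X :: "('g, 'h, nat) biset" assume X: "is_biset G H X"
    have "restrict f (carrier A) (burnside_module_class R G H X) = f (RB.pure \<one> (cl (iso_class G H X)))"
      unfolding burnside_module_eq burnside_module_class_eq
      by (simp add: RB.pure_closed iso_class_in_carrier[OF X])
    then show "restrict f (carrier A) (burnside_module_class R G H X) = L.vec (mark G H X)"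
      using X by (simp add: f(2) iso_class_in_carrier class_mark_iso_class)
  qed simp
  have uniq: "f' = restrict f (carrier A)" if f': "?P f'" for f'
  proof (rule extensionalityI)
    show "f' \<in> extensional (carrier A)" "restrict f (carrier A) \<in> extensional (carrier A)" using f' by auto
    fix u assume "u \<in> carrier A"
    then have u: "u \<in> carrier RB.T" by (simp add: burnside_module_eq)
    have lin: "f' \<in> linear_maps R RB.T L.N" using f' by (simp add: burnside_module_eq)
    have "f' u = f u"
    proof (rule additive_maps_eq[OF L.abelian_group_N _ _ _ _ _ u])
      fix r x assume r: "r \<in> carrier R" and x: "x \<in> carrier BM"
      obtain X :: "('g, 'h, nat) biset" where X: "is_biset G H X" "x = iso_class G H X" "cm x = mark G H X"
        using BM_cases[OF x] .
      have "f' (RB.pure r (cl x)) = f' (r \<odot>\<^bsub>RB.T\<^esub> RB.pure \<one> (cl x))"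
        using r x by (simp add: RB.smult_pure)
      also have "\<dots> = r \<odot>\<^bsub>L.N\<^esub> f' (RB.pure \<one> (cl x))"
        using lin r x by (simp add: linear_maps_def RB.pure_closed)
      also have "f' (RB.pure \<one> (cl x)) = L.vec (cm x)"
        using f' X by (simp add: burnside_module_class_eq)
      finally show "f' (RB.pure r (cl x)) = f (RB.pure r (cl x))" using r x by (simp add: f(2))
    qed (use lin f(1) in \<open>auto simp: linear_maps_def\<close>)
    then show "f' u = restrict f (carrier A) u" using \<open>u \<in> carrier A\<close> by simp
  qed
  have a: "alpha R G H = restrict f (carrier A)"
    unfolding alpha using PI uniq by (rule the_equality)
  show "alpha R G H \<in> linear_maps R A L.N" unfolding a using PI by blast
  show "alpha R G H (RB.pure r (cl x)) = r \<odot>\<^bsub>L.N\<^esub> L.vec (cm x)" if "r \<in> carrier R" "x \<in> carrier BM" for r x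
    unfolding a using that by (simp add: burnside_module_eq RB.pure_closed f(2))
qed

end

section \<open>Bilinear forms with finite support\<close>

context cring begin

definition bil :: "'i set \<Rightarrow> 'j set \<Rightarrow> ('i \<Rightarrow> 'j \<Rightarrow> 'a) \<Rightarrow> ('i \<Rightarrow> 'a) \<Rightarrow> ('j \<Rightarrow> 'a) \<Rightarrow> 'a" where
  "bil I J c u v = (\<Oplus>i\<in>I. \<Oplus>j\<in>J. u i \<otimes> v j \<otimes> c i j)"

context
  fixes I :: "'i set" and J :: "'j set" and c :: "'i \<Rightarrow> 'j \<Rightarrow> 'a"
  assumes fin: "finite I" "finite J" and c: "\<And>i j. i \<in> I \<Longrightarrow> j \<in> J \<Longrightarrow> c i j \<in> carrier R"
begin

lemma bil_closed: "u \<in> I \<rightarrow> carrier R \<Longrightarrow> v \<in> J \<rightarrow> carrier R \<Longrightarrow> bil I J c u v \<in> carrier R"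
  unfolding bil_def by (intro finsum_closed Pi_I m_closed c) auto

lemma bil_cong:
  assumes "\<And>i. i \<in> I \<Longrightarrow> u i = u' i" "\<And>j. j \<in> J \<Longrightarrow> v j = v' j"
    "u' \<in> I \<rightarrow> carrier R" "v' \<in> J \<rightarrow> carrier R"
  shows "bil I J c u v = bil I J c u' v'"
  unfolding bil_def using assms c
  by (intro finsum_cong' refl Pi_I finsum_closed m_closed) auto

lemma bil_add_left:
  assumes "u \<in> I \<rightarrow> carrier R" "u' \<in> I \<rightarrow> carrier R" "v \<in> J \<rightarrow> carrier R"
  shows "bil I J c (\<lambda>i. u i \<oplus> u' i) v = bil I J c u v \<oplus> bil I J c u' v"
proof -
  note cl = funcset_mem[OF assms(1)] funcset_mem[OF assms(2)] funcset_mem[OF assms(3)] c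
  have "bil I J c (\<lambda>i. u i \<oplus> u' i) v = (\<Oplus>i\<in>I. (\<Oplus>j\<in>J. u i \<otimes> v j \<otimes> c i j) \<oplus> (\<Oplus>j\<in>J. u' i \<otimes> v j \<otimes> c i j))"
    unfolding bil_def
  proof (rule finsum_cong')
    fix i assume i: "i \<in> I"
    have "(\<Oplus>j\<in>J. (u i \<oplus> u' i) \<otimes> v j \<otimes> c i j) = (\<Oplus>j\<in>J. u i \<otimes> v j \<otimes> c i j \<oplus> u' i \<otimes> v j \<otimes> c i j)"
      by (rule finsum_cong') (use i in \<open>auto simp: l_distr cl\<close>)
    also have "\<dots> = (\<Oplus>j\<in>J. u i \<otimes> v j \<otimes> c i j) \<oplus> (\<Oplus>j\<in>J. u' i \<otimes> v j \<otimes> c i j)"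
      by (rule finsum_addf) (use i in \<open>auto simp: cl\<close>)
    finally show "(\<Oplus>j\<in>J. (u i \<oplus> u' i) \<otimes> v j \<otimes> c i j) = \<dots>" .
  qed (auto intro!: finsum_closed simp: cl)
  also have "\<dots> = bil I J c u v \<oplus> bil I J c u' v"
    unfolding bil_def by (rule finsum_addf) (auto intro!: finsum_closed simp: cl)
  finally show ?thesis .
qed

lemma bil_smult_left:
  assumes "u \<in> I \<rightarrow> carrier R" "v \<in> J \<rightarrow> carrier R" "r \<in> carrier R"
  shows "bil I J c (\<lambda>i. r \<otimes> u i) v = r \<otimes> bil I J c u v"
proof -
  note cl = funcset_mem[OF assms(1)] funcset_mem[OF assms(2)] c assms(3)
  have "bil I J c (\<lambda>i. r \<otimes> u i) v = (\<Oplus>i\<in>I. r \<otimes> (\<Oplus>j\<in>J. u i \<otimes> v j \<otimes> c i j))"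
    unfolding bil_def
  proof (rule finsum_cong')
    fix i assume i: "i \<in> I"
    have "(\<Oplus>j\<in>J. r \<otimes> u i \<otimes> v j \<otimes> c i j) = (\<Oplus>j\<in>J. r \<otimes> (u i \<otimes> v j \<otimes> c i j))"
      by (rule finsum_cong') (use i in \<open>auto simp: m_assoc cl\<close>)
    also have "\<dots> = r \<otimes> (\<Oplus>j\<in>J. u i \<otimes> v j \<otimes> c i j)"
      by (rule finsum_rdistr[symmetric]) (use i fin in \<open>auto simp: cl\<close>)
    finally show "(\<Oplus>j\<in>J. r \<otimes> u i \<otimes> v j \<otimes> c i j) = \<dots>" .
  qed (auto intro!: finsum_closed simp: cl)
  also have "\<dots> = r \<otimes> bil I J c u v"
    unfolding bil_def by (rule finsum_rdistr[symmetric]) (use fin in \<open>auto intro!: finsum_closed simp: cl\<close>)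
  finally show ?thesis .
qed

lemma bil_add_right:
  assumes "u \<in> I \<rightarrow> carrier R" "v \<in> J \<rightarrow> carrier R" "v' \<in> J \<rightarrow> carrier R"
  shows "bil I J c u (\<lambda>j. v j \<oplus> v' j) = bil I J c u v \<oplus> bil I J c u v'"
proof -
  note cl = funcset_mem[OF assms(1)] funcset_mem[OF assms(2)] funcset_mem[OF assms(3)] c
  have "bil I J c u (\<lambda>j. v j \<oplus> v' j) = (\<Oplus>i\<in>I. (\<Oplus>j\<in>J. u i \<otimes> v j \<otimes> c i j) \<oplus> (\<Oplus>j\<in>J. u i \<otimes> v' j \<otimes> c i j))"
    unfolding bil_def
  proof (rule finsum_cong')
    fix i assume i: "i \<in> I"
    have "(\<Oplus>j\<in>J. u i \<otimes> (v j \<oplus> v' j) \<otimes> c i j) = (\<Oplus>j\<in>J. u i \<otimes> v j \<otimes> c i j \<oplus> u i \<otimes> v' j \<otimes> c i j)"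
      by (rule finsum_cong') (use i in \<open>auto simp: l_distr r_distr cl\<close>)
    also have "\<dots> = (\<Oplus>j\<in>J. u i \<otimes> v j \<otimes> c i j) \<oplus> (\<Oplus>j\<in>J. u i \<otimes> v' j \<otimes> c i j)"
      by (rule finsum_addf) (use i in \<open>auto simp: cl\<close>)
    finally show "(\<Oplus>j\<in>J. u i \<otimes> (v j \<oplus> v' j) \<otimes> c i j) = \<dots>" .
  qed (auto intro!: finsum_closed simp: cl)
  also have "\<dots> = bil I J c u v \<oplus> bil I J c u v'"
    unfolding bil_def by (rule finsum_addf) (auto intro!: finsum_closed simp: cl)
  finally show ?thesis .
qed

lemma bil_smult_right:
  assumes "u \<in> I \<rightarrow> carrier R" "v \<in> J \<rightarrow> carrier R" "r \<in> carrier R"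
  shows "bil I J c u (\<lambda>j. r \<otimes> v j) = r \<otimes> bil I J c u v"
proof -
  note cl = funcset_mem[OF assms(1)] funcset_mem[OF assms(2)] c assms(3)
  have "bil I J c u (\<lambda>j. r \<otimes> v j) = bil I J c (\<lambda>i. r \<otimes> u i) v"
    unfolding bil_def by (intro finsum_cong' refl Pi_I finsum_closed) (auto simp: m_ac cl)
  then show ?thesis using bil_smult_left[OF assms] by simp
qed

end

text \<open>
For natural coefficients the form is a natural number times a scalar, so that counting arguments
apply before anything is read in \<open>R\<close>.
\<close>
lemma bil_nr:
  assumes fin: "finite I" "finite J" and k: "k \<in> carrier R"
  shows "bil I J (\<lambda>i j. nr (c i j) \<otimes> k) (\<lambda>i. nr (m i)) (\<lambda>j. nr (n j))
    = k \<otimes> nr (\<Sum>i\<in>I. m i * (\<Sum>j\<in>J. n j * c i j))"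
proof -
  have "bil I J (\<lambda>i j. nr (c i j) \<otimes> k) (\<lambda>i. nr (m i)) (\<lambda>j. nr (n j))
      = (\<Oplus>i\<in>I. k \<otimes> nr (m i * (\<Sum>j\<in>J. n j * c i j)))"
    unfolding bil_def
  proof (rule finsum_cong')
    fix i assume "i \<in> I"
    have "(\<Oplus>j\<in>J. nr (m i) \<otimes> nr (n j) \<otimes> (nr (c i j) \<otimes> k)) = (\<Oplus>j\<in>J. k \<otimes> nr (m i * (n j * c i j)))"
      by (rule finsum_cong') (use k in \<open>auto simp: nr_mult m_ac\<close>)
    also have "\<dots> = k \<otimes> (\<Oplus>j\<in>J. nr (m i * (n j * c i j)))"
      by (rule finsum_rdistr[symmetric]) (use fin k in auto)
    finally show "(\<Oplus>j\<in>J. nr (m i) \<otimes> nr (n j) \<otimes> (nr (c i j) \<otimes> k)) = k \<otimes> nr (m i * (\<Sum>j\<in>J. n j * c i j))"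
      by (simp only: nr_sum[symmetric] sum_distrib_left)
  qed (use k in auto)
  also have "\<dots> = k \<otimes> (\<Oplus>i\<in>I. nr (m i * (\<Sum>j\<in>J. n j * c i j)))"
    by (rule finsum_rdistr[symmetric]) (use fin k in auto)
  finally show ?thesis by (simp only: nr_sum)
qed

end

section \<open>The product of subgroups and multiplicativity of the mark homomorphism\<close>

locale ring_triple = R: cring R + group_triple G H K
  for R :: "('r, 's) ring_scheme" (structure) and G :: "('g, 'm) monoid_scheme"
    and H :: "('h, 'n) monoid_scheme" and K :: "('k, 'p) monoid_scheme" +
  assumes unit_H: "[order H] \<cdot> \<one> \<in> Units R"
begin

sublocale RGH: ring_pair R G H by unfold_locales
sublocale RHK: ring_pair R H K by unfold_locales
sublocale RGK: ring_pair R G K by unfold_locales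

abbreviation iH where "iH \<equiv> inv (R.nr (order H))"
abbreviation star (infixl "\<star>" 70) where "u \<star> v \<equiv> star_kappa R G H K u v"
abbreviation kap :: "('g \<times> 'k) set \<Rightarrow> ('g \<times> 'h) set \<Rightarrow> ('h \<times> 'k) set \<Rightarrow> 'r" where
  "kap N \<equiv> \<lambda>L M. R.nr (if L O M = N then card (k2 G H L \<inter> k1 H K M) else 0) \<otimes> iH"
abbreviation form where "form N \<equiv> R.bil RGH.S RHK.S (kap N)"

lemma iH_closed [simp]: "iH \<in> carrier R"
  using unit_H by (rule R.Units_inv_closed)

lemma relcomp_S: "L \<in> RGH.S \<Longrightarrow> M \<in> RHK.S \<Longrightarrow> L O M \<in> RGK.S"
  by (simp add: subgroups_of_def relcomp_subgroup)

lemma funcset_N: "u \<in> carrier RGH.L.N \<Longrightarrow> u \<in> RGH.S \<rightarrow> carrier R" "v \<in> carrier RHK.L.N \<Longrightarrow> v \<in> RHK.S \<rightarrow> carrier R"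
  by (auto simp: RGH.L.carrier_N RHK.L.carrier_N)

lemma
  assumes u: "u \<in> carrier RGH.L.N" and v: "v \<in> carrier RHK.L.N"
  shows star_closed: "u \<star> v \<in> carrier RGK.L.N"
    and coord_star: "N \<in> RGK.S \<Longrightarrow> (u \<star> v) N = form N u v"
proof -
  let ?t = "\<lambda>L M. (u L \<otimes> v M \<otimes> kappa R G H K L M) \<odot>\<^bsub>RGK.L.N\<^esub> RGK.L.basis (L O M)"
  have star: "u \<star> v = (\<Oplus>\<^bsub>RGK.L.N\<^esub>L\<in>RGH.S. \<Oplus>\<^bsub>RGK.L.N\<^esub>M\<in>RHK.S. ?t L M)"
    by (simp add: star_kappa_def RGK.subgroup_module_eq subgroup_basis_def)
  have kc: "kappa R G H K L M \<in> carrier R" for L M by (simp add: kappa_def)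
  have t: "?t L M \<in> carrier RGK.L.N" if "L \<in> RGH.S" "M \<in> RHK.S" for L M
    using that u v kc by (intro RGK.L.smult_N_closed RGK.L.basis_closed R.m_closed) simp_all
  then have t': "(\<Oplus>\<^bsub>RGK.L.N\<^esub>M\<in>RHK.S. ?t L M) \<in> carrier RGK.L.N" if "L \<in> RGH.S" for L
    using that by (intro RGK.L.N.M.finsum_closed) auto
  then show "u \<star> v \<in> carrier RGK.L.N" unfolding star by (intro RGK.L.N.M.finsum_closed) auto
  assume N: "N \<in> RGK.S"
  have "(u \<star> v) N = (\<Oplus>L\<in>RGH.S. (\<Oplus>\<^bsub>RGK.L.N\<^esub>M\<in>RHK.S. ?t L M) N)"
    unfolding star by (rule RGK.L.coord_finsum[OF RGH.L.finite_S t' N])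
  also have "\<dots> = form N u v"
    unfolding R.bil_def
  proof (rule R.finsum_cong')
    fix L assume L: "L \<in> RGH.S"
    have "(\<Oplus>\<^bsub>RGK.L.N\<^esub>M\<in>RHK.S. ?t L M) N = (\<Oplus>M\<in>RHK.S. ?t L M N)"
      by (rule RGK.L.coord_finsum[OF RHK.L.finite_S t[OF L] N])
    also have "\<dots> = (\<Oplus>M\<in>RHK.S. u L \<otimes> v M \<otimes> kap N L M)"
    proof (rule R.finsum_cong')
      fix M assume M: "M \<in> RHK.S"
      have uv: "u L \<in> carrier R" "v M \<in> carrier R" using u v L M by simp_all
      show "?t L M N = u L \<otimes> v M \<otimes> kap N L M"
        using N uv kc by (auto simp: RGK.L.coord_basis kappa_def)
    qed (use u v L in auto)
    finally show "(\<Oplus>\<^bsub>RGK.L.N\<^esub>M\<in>RHK.S. ?t L M) N = (\<Oplus>M\<in>RHK.S. u L \<otimes> v M \<otimes> kap N L M)" .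
  qed (use u v in \<open>auto intro!: R.finsum_closed\<close>)
  finally show "(u \<star> v) N = form N u v" .
qed

lemma kap_closed: "kap N L M \<in> carrier R"
  by simp

lemmas form_rules = RGH.L.finite_S RHK.L.finite_S kap_closed

lemma star_add_left:
  assumes "u \<in> carrier RGH.L.N" "u' \<in> carrier RGH.L.N" "v \<in> carrier RHK.L.N"
  shows "(u \<oplus>\<^bsub>RGH.L.N\<^esub> u') \<star> v = u \<star> v \<oplus>\<^bsub>RGK.L.N\<^esub> u' \<star> v"
proof (rule RGK.L.N_eqI)
  fix N assume N: "N \<in> RGK.S"
  have "form N (u \<oplus>\<^bsub>RGH.L.N\<^esub> u') v = form N (\<lambda>L. u L \<oplus> u' L) v"
    by (rule R.bil_cong[OF form_rules]) (use assms in \<open>auto simp: funcset_N\<close>)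
  also have "\<dots> = form N u v \<oplus> form N u' v"
    by (rule R.bil_add_left[OF form_rules]) (use assms in \<open>simp_all add: funcset_N\<close>)
  finally show "((u \<oplus>\<^bsub>RGH.L.N\<^esub> u') \<star> v) N = (u \<star> v \<oplus>\<^bsub>RGK.L.N\<^esub> u' \<star> v) N"
    using assms N by (simp add: coord_star RGH.L.add_N_closed)
qed (use assms in \<open>simp_all add: star_closed RGH.L.add_N_closed RGK.L.add_N_closed\<close>)

lemma star_add_right:
  assumes "u \<in> carrier RGH.L.N" "v \<in> carrier RHK.L.N" "v' \<in> carrier RHK.L.N"
  shows "u \<star> (v \<oplus>\<^bsub>RHK.L.N\<^esub> v') = u \<star> v \<oplus>\<^bsub>RGK.L.N\<^esub> u \<star> v'"
proof (rule RGK.L.N_eqI)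
  fix N assume N: "N \<in> RGK.S"
  have "form N u (v \<oplus>\<^bsub>RHK.L.N\<^esub> v') = form N u (\<lambda>L. v L \<oplus> v' L)"
    by (rule R.bil_cong[OF form_rules]) (use assms in \<open>auto simp: funcset_N\<close>)
  also have "\<dots> = form N u v \<oplus> form N u v'"
    by (rule R.bil_add_right[OF form_rules]) (use assms in \<open>simp_all add: funcset_N\<close>)
  finally show "(u \<star> (v \<oplus>\<^bsub>RHK.L.N\<^esub> v')) N = (u \<star> v \<oplus>\<^bsub>RGK.L.N\<^esub> u \<star> v') N"
    using assms N by (simp add: coord_star RHK.L.add_N_closed)
qed (use assms in \<open>simp_all add: star_closed RHK.L.add_N_closed RGK.L.add_N_closed\<close>)

lemma star_smult_left:
  assumes "u \<in> carrier RGH.L.N" "v \<in> carrier RHK.L.N" "r \<in> carrier R"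
  shows "(r \<odot>\<^bsub>RGH.L.N\<^esub> u) \<star> v = r \<odot>\<^bsub>RGK.L.N\<^esub> (u \<star> v)"
proof (rule RGK.L.N_eqI)
  fix N assume N: "N \<in> RGK.S"
  have "form N (r \<odot>\<^bsub>RGH.L.N\<^esub> u) v = form N (\<lambda>L. r \<otimes> u L) v"
    by (rule R.bil_cong[OF form_rules]) (use assms in \<open>auto simp: funcset_N\<close>)
  also have "\<dots> = r \<otimes> form N u v"
    by (rule R.bil_smult_left[OF form_rules]) (use assms in \<open>simp_all add: funcset_N\<close>)
  finally show "((r \<odot>\<^bsub>RGH.L.N\<^esub> u) \<star> v) N = (r \<odot>\<^bsub>RGK.L.N\<^esub> (u \<star> v)) N"
    using assms N by (simp add: coord_star RGH.L.smult_N_closed)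
qed (use assms in \<open>simp_all add: star_closed RGH.L.smult_N_closed RGK.L.smult_N_closed\<close>)

lemma star_smult_right:
  assumes "u \<in> carrier RGH.L.N" "v \<in> carrier RHK.L.N" "r \<in> carrier R"
  shows "u \<star> (r \<odot>\<^bsub>RHK.L.N\<^esub> v) = r \<odot>\<^bsub>RGK.L.N\<^esub> (u \<star> v)"
proof (rule RGK.L.N_eqI)
  fix N assume N: "N \<in> RGK.S"
  have "form N u (r \<odot>\<^bsub>RHK.L.N\<^esub> v) = form N u (\<lambda>L. r \<otimes> v L)"
    by (rule R.bil_cong[OF form_rules]) (use assms in \<open>auto simp: funcset_N\<close>)
  also have "\<dots> = r \<otimes> form N u v"
    by (rule R.bil_smult_right[OF form_rules]) (use assms in \<open>simp_all add: funcset_N\<close>)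
  finally show "(u \<star> (r \<odot>\<^bsub>RHK.L.N\<^esub> v)) N = (r \<odot>\<^bsub>RGK.L.N\<^esub> (u \<star> v)) N"
    using assms N by (simp add: coord_star RHK.L.smult_N_closed)
qed (use assms in \<open>simp_all add: star_closed RHK.L.smult_N_closed RGK.L.smult_N_closed\<close>)

lemma star_vec: "RGH.L.vec m \<star> RHK.L.vec n = iH \<odot>\<^bsub>RGK.L.N\<^esub> RGK.L.vec (conv G H K m n)"
proof (rule RGK.L.N_eqI)
  fix N assume N: "N \<in> RGK.S"
  have "form N (RGH.L.vec m) (RHK.L.vec n) = form N (\<lambda>L. R.nr (m L)) (\<lambda>M. R.nr (n M))"
    by (rule R.bil_cong[OF form_rules]) auto
  also have "\<dots> = iH \<otimes> R.nr (conv G H K m n N)"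
    unfolding conv_def by (rule R.bil_nr[OF RGH.L.finite_S RHK.L.finite_S iH_closed])
  finally show "(RGH.L.vec m \<star> RHK.L.vec n) N = (iH \<odot>\<^bsub>RGK.L.N\<^esub> RGK.L.vec (conv G H K m n)) N"
    using N by (simp add: coord_star)
qed (simp_all add: star_closed RGK.L.smult_N_closed)

abbreviation pmult where "pmult \<equiv> \<lambda>(r, b) (s, c). (r \<otimes> s, burnside_mult G H K b c)"

lemma burnside_mult_closed: "b \<in> carrier GH.B.Q \<Longrightarrow> c \<in> carrier HK.B.Q \<Longrightarrow> burnside_mult G H K b c \<in> carrier GK.B.Q"
  unfolding burnside_mult_eq by (rule M.ext_closed)

sublocale MM: biadditive_extension "carrier R \<times> carrier GH.B.Q" RGH.RB.tensor_relators "carrier R \<times> carrier HK.B.Q" RHK.RB.tensor_relators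
  "carrier R \<times> carrier GK.B.Q" RGK.RB.tensor_relators pmult
proof
  show "pmult x y \<in> carrier R \<times> carrier GK.B.Q"
    if "x \<in> carrier R \<times> carrier GH.B.Q" "y \<in> carrier R \<times> carrier HK.B.Q" for x y
    using that burnside_mult_closed by auto
  show "frag_extend (\<lambda>x. frag_of (pmult x y)) a \<in> RGK.RB.P.K"
    if a: "a \<in> RGH.RB.tensor_relators" and y: "y \<in> carrier R \<times> carrier HK.B.Q" for a y
  proof -
    obtain t d where y': "y = (t, d)" "t \<in> carrier R" "d \<in> carrier HK.B.Q" using y by auto
    show ?thesis
      using a
    proof (cases rule: RGH.RB.tensor_relators_cases)
      case (left r s b)
      then show ?thesis
        using RGK.RB.left_relator_K[of "r \<otimes> t" "s \<otimes> t" "burnside_mult G H K b d"] y'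
        by (simp add: frag_extend_diff R.l_distr burnside_mult_closed)
    next
      case (right r b c)
      then show ?thesis
        using RGK.RB.right_relator_K[of "r \<otimes> t" "burnside_mult G H K b d" "burnside_mult G H K c d"] y'
          M.ext_add_left[OF right(3,4) y'(3)]
        by (simp add: frag_extend_diff burnside_mult_closed burnside_mult_eq[symmetric])
    qed
  qed
  show "frag_extend (\<lambda>y. frag_of (pmult x y)) a \<in> RGK.RB.P.K"
    if x: "x \<in> carrier R \<times> carrier GH.B.Q" and a: "a \<in> RHK.RB.tensor_relators" for x a
  proof -
    obtain t d where x': "x = (t, d)" "t \<in> carrier R" "d \<in> carrier GH.B.Q" using x by auto
    show ?thesis
      using a
    proof (cases rule: RHK.RB.tensor_relators_cases)
      case (left r s b)
      then show ?thesis
        using RGK.RB.left_relator_K[of "t \<otimes> r" "t \<otimes> s" "burnside_mult G H K d b"] x'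
        by (simp add: frag_extend_diff R.r_distr burnside_mult_closed)
    next
      case (right r b c)
      then show ?thesis
        using RGK.RB.right_relator_K[of "t \<otimes> r" "burnside_mult G H K d b" "burnside_mult G H K d c"] x'
          M.ext_add_right[OF x'(3) right(3,4)]
        by (simp add: frag_extend_diff burnside_mult_closed burnside_mult_eq[symmetric])
    qed
  qed
qed

abbreviation rb_mult where "rb_mult \<equiv> burnside_module_mult R G H K"

lemma burnside_module_mult_eq: "rb_mult = MM.ext"
  by (simp add: burnside_module_mult_def GK.burnside_group_eq RGK.RB.tensor_rel_eq)

lemma burnside_module_mult_closed: "u \<in> carrier RGH.RB.T \<Longrightarrow> v \<in> carrier RHK.RB.T \<Longrightarrow> rb_mult u v \<in> carrier RGK.RB.T"
  unfolding burnside_module_mult_eq RGH.RB.carrier_T RHK.RB.carrier_T RGK.RB.carrier_T by (rule MM.ext_closed)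

lemma burnside_module_mult_add_left: "u \<in> carrier RGH.RB.T \<Longrightarrow> u' \<in> carrier RGH.RB.T \<Longrightarrow> v \<in> carrier RHK.RB.T \<Longrightarrow>
  rb_mult (u \<oplus>\<^bsub>RGH.RB.T\<^esub> u') v =
  rb_mult u v \<oplus>\<^bsub>RGK.RB.T\<^esub> rb_mult u' v"
  unfolding burnside_module_mult_eq RGH.RB.carrier_T RHK.RB.carrier_T RGH.RB.add_T RGK.RB.add_T by (rule MM.ext_add_left)

lemma burnside_module_mult_add_right: "u \<in> carrier RGH.RB.T \<Longrightarrow> v \<in> carrier RHK.RB.T \<Longrightarrow> v' \<in> carrier RHK.RB.T \<Longrightarrow>
  rb_mult u (v \<oplus>\<^bsub>RHK.RB.T\<^esub> v') =
  rb_mult u v \<oplus>\<^bsub>RGK.RB.T\<^esub> rb_mult u v'"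
  unfolding burnside_module_mult_eq RGH.RB.carrier_T RHK.RB.carrier_T RHK.RB.add_T RGK.RB.add_T by (rule MM.ext_add_right)

lemma burnside_module_mult_pure:
  assumes "r \<in> carrier R" "s \<in> carrier R" "x \<in> carrier GH.BM" "y \<in> carrier HK.BM"
  shows "rb_mult (RGH.RB.pure r (GH.cl x)) (RHK.RB.pure s (HK.cl y))
    = RGK.RB.pure (r \<otimes> s) (GK.cl (class_tensor x y))"
  unfolding burnside_module_mult_eq RGH.RB.pure_eq RHK.RB.pure_eq RGK.RB.pure_eq
  using MM.ext_gen[of "(r, GH.cl x)" "(s, HK.cl y)"] M.ext_gen[OF assms(3,4)] assms
  by (simp add: burnside_mult_eq)

text \<open>
Both sides are biadditive, so only classes of bisets matter. There the factor \<open>|H|\<close> of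
\<open>class_mark_tensor\<close> cancels against the denominator of \<open>\<kappa>\<close>.
\<close>
theorem alpha_mult:
  assumes u: "u \<in> carrier RGH.RB.T" and v: "v \<in> carrier RHK.RB.T"
  shows "alpha R G K (rb_mult u v) = alpha R G H u \<star> alpha R H K v"
proof -
  note lin = RGH.alpha_linear[unfolded RGH.burnside_module_eq linear_maps_def]
    RHK.alpha_linear[unfolded RHK.burnside_module_eq linear_maps_def]
    RGK.alpha_linear[unfolded RGK.burnside_module_eq linear_maps_def]
  have c: "\<And>u. u \<in> carrier RGH.RB.T \<Longrightarrow> alpha R G H u \<in> carrier RGH.L.N"
    "\<And>v. v \<in> carrier RHK.RB.T \<Longrightarrow> alpha R H K v \<in> carrier RHK.L.N"
    "\<And>w. w \<in> carrier RGK.RB.T \<Longrightarrow> alpha R G K w \<in> carrier RGK.L.N"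
    using lin by auto
  have a: "\<And>u u'. u \<in> carrier RGH.RB.T \<Longrightarrow> u' \<in> carrier RGH.RB.T \<Longrightarrow> alpha R G H (u \<oplus>\<^bsub>RGH.RB.T\<^esub> u') = alpha R G H u \<oplus>\<^bsub>RGH.L.N\<^esub> alpha R G H u'"
    "\<And>v v'. v \<in> carrier RHK.RB.T \<Longrightarrow> v' \<in> carrier RHK.RB.T \<Longrightarrow> alpha R H K (v \<oplus>\<^bsub>RHK.RB.T\<^esub> v') = alpha R H K v \<oplus>\<^bsub>RHK.L.N\<^esub> alpha R H K v'"
    "\<And>w w'. w \<in> carrier RGK.RB.T \<Longrightarrow> w' \<in> carrier RGK.RB.T \<Longrightarrow> alpha R G K (w \<oplus>\<^bsub>RGK.RB.T\<^esub> w') = alpha R G K w \<oplus>\<^bsub>RGK.L.N\<^esub> alpha R G K w'"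
    using lin by auto
  have pure: "alpha R G K (rb_mult (RGH.RB.pure r (GH.cl x)) (RHK.RB.pure s (HK.cl y)))
      = alpha R G H (RGH.RB.pure r (GH.cl x)) \<star> alpha R H K (RHK.RB.pure s (HK.cl y))"
    if *: "r \<in> carrier R" "s \<in> carrier R" "x \<in> carrier GH.BM" "y \<in> carrier HK.BM" for r s x y
  proof -
    have v: "conv G H K (GH.cm x) (HK.cm y) = (\<lambda>N. order H * GK.cm (class_tensor x y) N)"
      using class_mark_tensor[OF *(3,4)] by (auto simp: order_def)
    have "RGH.L.vec (GH.cm x) \<star> RHK.L.vec (HK.cm y) = RGK.L.vec (GK.cm (class_tensor x y))"
      unfolding star_vec v
    proof (rule RGK.L.N_eqI)
      fix N assume N: "N \<in> RGK.S"
      have "iH \<otimes> (R.nr (order H) \<otimes> R.nr (GK.cm (class_tensor x y) N)) = R.nr (GK.cm (class_tensor x y) N)"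
        using R.Units_l_inv[OF unit_H] by (simp flip: R.m_assoc)
      then show "(iH \<odot>\<^bsub>RGK.L.N\<^esub> RGK.L.vec (\<lambda>N. order H * GK.cm (class_tensor x y) N)) N = RGK.L.vec (GK.cm (class_tensor x y)) N"
        using N by (simp add: R.nr_mult)
    qed (simp_all add: RGK.L.smult_N_closed)
    then show ?thesis
      using * by (simp add: burnside_module_mult_pure RGH.alpha_pure RHK.alpha_pure RGK.alpha_pure class_tensor_closed star_smult_left star_smult_right
          RHK.L.smult_N_closed R.m_comm flip: RGK.L.N.smult_assoc1)
  qed
  show ?thesis
  proof (rule RGH.additive_maps_eq[OF RGK.L.abelian_group_N _ _ _ _ _ u, where f = "\<lambda>u. alpha R G K (rb_mult u v)"
        and g = "\<lambda>u. alpha R G H u \<star> alpha R H K v"])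
    fix r x assume rx: "r \<in> carrier R" "x \<in> carrier GH.BM"
    let ?u = "RGH.RB.pure r (GH.cl x)"
    have u: "?u \<in> carrier RGH.RB.T" using rx by (simp add: RGH.RB.pure_closed)
    show "alpha R G K (rb_mult ?u v) = alpha R G H ?u \<star> alpha R H K v"
    proof (rule RHK.additive_maps_eq[OF RGK.L.abelian_group_N _ _ _ _ _ v, where f = "\<lambda>v. alpha R G K (rb_mult ?u v)"
          and g = "\<lambda>v. alpha R G H ?u \<star> alpha R H K v"])
      show "alpha R G K (rb_mult ?u (RHK.RB.pure s (HK.cl y))) = alpha R G H ?u \<star> alpha R H K (RHK.RB.pure s (HK.cl y))"
        if "s \<in> carrier R" "y \<in> carrier HK.BM" for s y
        using pure rx that by blast
    qed (use u in \<open>auto simp: burnside_module_mult_closed burnside_module_mult_add_right c a star_closed star_add_right\<close>)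
  qed (use v in \<open>auto simp: burnside_module_mult_closed burnside_module_mult_add_left c a star_closed star_add_left\<close>)
qed

end

section \<open>Averaging over conjugation\<close>

lemma (in finite_free_module) linear_map_on_basis:
  assumes M: "module R M" and f: "f \<in> linear_maps R N M" and u: "u \<in> carrier N"
  shows "f u = (\<Oplus>\<^bsub>M\<^esub>t\<in>S. u t \<odot>\<^bsub>M\<^esub> f (basis t))"
proof -
  interpret M: module R M by fact
  have c: "u t \<odot>\<^bsub>N\<^esub> basis t \<in> carrier N" if "t \<in> S" for t
    using u that by (simp add: smult_N_closed basis_closed)
  have "f (\<Oplus>\<^bsub>N\<^esub>t\<in>S. u t \<odot>\<^bsub>N\<^esub> basis t) = (\<Oplus>\<^bsub>M\<^esub>t\<in>S. f (u t \<odot>\<^bsub>N\<^esub> basis t))"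
    by (rule additive_finsum[OF abelian_group_N M.abelian_group_axioms _ _ finite_S c])
       (use f in \<open>auto simp: linear_maps_def\<close>)
  also have "\<dots> = (\<Oplus>\<^bsub>M\<^esub>t\<in>S. u t \<odot>\<^bsub>M\<^esub> f (basis t))"
    by (rule M.M.finsum_cong') (use f u basis_closed in \<open>auto simp: linear_maps_def intro!: M.smult_closed\<close>)
  finally show ?thesis using basis_expansion[OF u] by simp
qed

context group_pair begin

abbreviation cj where "cj \<equiv> conjugate (G \<times>\<times> H)"

lemma S_subset: "L \<in> subgroups_of (G \<times>\<times> H) \<Longrightarrow> L \<subseteq> carrier (G \<times>\<times> H)"
  unfolding subgroups_of_def using subgroup.subset by blast

lemma conj_S: "t \<in> carrier (G \<times>\<times> H) \<Longrightarrow> L \<in> subgroups_of (G \<times>\<times> H) \<Longrightarrow> cj t L \<in> subgroups_of (G \<times>\<times> H)"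
  unfolding subgroups_of_def using T.conjugate_subgroup by blast

lemma finite_T: "finite (carrier (G \<times>\<times> H))"
  by (simp add: fin)

lemma card_T: "card (carrier (G \<times>\<times> H)) = order G * order H"
  by (simp add: order_def card_cartesian_product)

text \<open>
Translation \<open>t \<mapsto> xt\<close> matches the two sets of transporters. Hence averages are invariant.
\<close>
lemma transporters_conj:
  assumes x: "x \<in> carrier (G \<times>\<times> H)" and L: "L \<in> subgroups_of (G \<times>\<times> H)" and N: "N \<in> subgroups_of (G \<times>\<times> H)"
  shows "transporters L (cj (inv\<^bsub>G \<times>\<times> H\<^esub> x) N) = transporters L N"
  unfolding transporters_def
proof (rule bij_betw_same_card)
  let ?T = "G \<times>\<times> H"
  have *: "cj (x \<otimes>\<^bsub>?T\<^esub> t) L = N \<longleftrightarrow> cj t L = cj (inv\<^bsub>?T\<^esub> x) N" if t: "t \<in> carrier ?T" for t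
    unfolding T.conjugate_mult[OF x t S_subset[OF L]]
    by (rule T.conjugate_inv_iff[OF x S_subset[OF conj_S[OF t L]] S_subset[OF N]])
  show "bij_betw (\<lambda>t. x \<otimes>\<^bsub>?T\<^esub> t) {t \<in> carrier ?T. cj t L = cj (inv\<^bsub>?T\<^esub> x) N} {t \<in> carrier ?T. cj t L = N}"
  proof (rule bij_betw_byWitness[where f' = "\<lambda>t. inv\<^bsub>?T\<^esub> x \<otimes>\<^bsub>?T\<^esub> t"])
    have ix: "inv\<^bsub>?T\<^esub> x \<in> carrier ?T" using x by (rule T.inv_closed)
    show "\<forall>t\<in>{t \<in> carrier ?T. cj t L = cj (inv\<^bsub>?T\<^esub> x) N}. inv\<^bsub>?T\<^esub> x \<otimes>\<^bsub>?T\<^esub> (x \<otimes>\<^bsub>?T\<^esub> t) = t"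
      "\<forall>t\<in>{t \<in> carrier ?T. cj t L = N}. x \<otimes>\<^bsub>?T\<^esub> (inv\<^bsub>?T\<^esub> x \<otimes>\<^bsub>?T\<^esub> t) = t"
      using T.inv_cancel[OF x] by blast+
    show "(\<lambda>t. x \<otimes>\<^bsub>?T\<^esub> t) ` {t \<in> carrier ?T. cj t L = cj (inv\<^bsub>?T\<^esub> x) N} \<subseteq> {t \<in> carrier ?T. cj t L = N}"
      using * T.m_closed[OF x] by blast
    show "(\<lambda>t. inv\<^bsub>?T\<^esub> x \<otimes>\<^bsub>?T\<^esub> t) ` {t \<in> carrier ?T. cj t L = N} \<subseteq> {t \<in> carrier ?T. cj t L = cj (inv\<^bsub>?T\<^esub> x) N}"
    proof (rule image_subsetI)
      fix t assume "t \<in> {t \<in> carrier ?T. cj t L = N}"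
      then have t: "t \<in> carrier ?T" "cj t L = N" by blast+
      have c: "inv\<^bsub>?T\<^esub> x \<otimes>\<^bsub>?T\<^esub> t \<in> carrier ?T" using T.m_closed[OF ix t(1)] .
      moreover have "cj (inv\<^bsub>?T\<^esub> x \<otimes>\<^bsub>?T\<^esub> t) L = cj (inv\<^bsub>?T\<^esub> x) N"
        using T.conjugate_mult[OF ix t(1) S_subset[OF L]] unfolding t(2) .
      ultimately show "inv\<^bsub>?T\<^esub> x \<otimes>\<^bsub>?T\<^esub> t \<in> {t \<in> carrier ?T. cj t L = cj (inv\<^bsub>?T\<^esub> x) N}" by blast
    qed
  qed
qed

text \<open>
Each \<open>t\<close> transports exactly one subgroup to \<open>N\<close>.
\<close>
lemma sum_transporters:
  assumes N: "N \<in> subgroups_of (G \<times>\<times> H)"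
  shows "(\<Sum>L\<in>subgroups_of (G \<times>\<times> H). transporters L N) = card (carrier (G \<times>\<times> H))"
proof -
  let ?T = "G \<times>\<times> H"
  have "transporters L N = cnt (carrier ?T) (\<lambda>t. cj (inv\<^bsub>?T\<^esub> t) N) L * 1" if "L \<in> subgroups_of ?T" for L
    unfolding transporters_def cnt_def mult_1_right
    by (rule arg_cong[where f = card])
       (use T.conjugate_inv_iff[OF _ S_subset[OF that] S_subset[OF N]] in blast)
  then have "(\<Sum>L\<in>subgroups_of ?T. transporters L N) = (\<Sum>L\<in>subgroups_of ?T. cnt (carrier ?T) (\<lambda>t. cj (inv\<^bsub>?T\<^esub> t) N) L * 1)"
    by (intro sum.cong) auto
  also have "\<dots> = (\<Sum>t\<in>carrier ?T. 1)"
    by (rule sum_cnt[OF finite_T finite_subgroups_of conj_S[OF T.inv_closed N]])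
  finally show ?thesis by simp
qed

text \<open>
The left side counts the pairs \<open>(t, p)\<close> such that \<open>tp\<close> has stabilizer \<open>N\<close>. For each \<open>t\<close> the map
\<open>p \<mapsto> tp\<close> is a bijection of \<open>X\<close>, so there are equally many such \<open>p\<close> for every \<open>t\<close>.
\<close>
lemma sum_mark_transporters:
  fixes X :: "('g, 'h, 'x) biset"
  assumes X: "is_biset G H X"
  shows "(\<Sum>L\<in>subgroups_of (G \<times>\<times> H). mark G H X L * transporters L N) = card (carrier (G \<times>\<times> H)) * mark G H X N"
proof -
  let ?T = "G \<times>\<times> H" and ?\<phi> = "prod_act G H X"
  interpret X: gset ?T ?\<phi> "points X" by (rule gset_of_biset[OF X])
  note finX = is_bisetD(1)[OF X]
  have "(\<Sum>L\<in>subgroups_of ?T. mark G H X L * transporters L N) = (\<Sum>p\<in>points X. transporters (X.stab p) N)"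
    unfolding mark_def by (rule sum_cnt[OF finX finite_subgroups_of stab_subgroups_of[OF X]])
  also have "\<dots> = (\<Sum>p\<in>points X. \<Sum>t\<in>carrier ?T. of_bool (X.stab (?\<phi> t p) = N))"
  proof (rule sum.cong[OF refl])
    fix p assume p: "p \<in> points X"
    have "transporters (X.stab p) N = (\<Sum>t\<in>carrier ?T. of_bool (cj t (X.stab p) = N))"
      using cnt_eq_sum[OF finite_T, of "\<lambda>t. cj t (X.stab p)" N] by (simp add: transporters_def cnt_def)
    also have "\<dots> = (\<Sum>t\<in>carrier ?T. of_bool (X.stab (?\<phi> t p) = N))"
      by (rule sum.cong[OF refl]) (simp only: X.stab_act[OF _ p])
    finally show "transporters (X.stab p) N = \<dots>" .
  qed
  also have "\<dots> = (\<Sum>t\<in>carrier ?T. \<Sum>p\<in>points X. of_bool (X.stab (?\<phi> t p) = N))"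
    by (rule sum.swap)
  also have "\<dots> = (\<Sum>t\<in>carrier ?T. mark G H X N)"
  proof (rule sum.cong[OF refl])
    fix t assume t: "t \<in> carrier ?T"
    have "bij_betw (?\<phi> t) (points X) (points X)"
      by (rule bij_betw_byWitness[where f' = "?\<phi> (inv\<^bsub>?T\<^esub> t)"])
         (use t T.inv_closed[OF t] X.act_inv[OF t] X.act_inv'[OF t] X.act_closed in blast)+
    from sum.reindex_bij_betw[OF this, of "\<lambda>p. of_bool (X.stab p = N)"]
    show "(\<Sum>p\<in>points X. of_bool (X.stab (?\<phi> t p) = N)) = mark G H X N"
      by (simp add: mark_def cnt_eq_sum[OF finX])
  qed
  finally show ?thesis by simp
qed

end

locale ring_pair_unit = ring_pair R G H
  for R :: "('r, 's) ring_scheme" (structure) and G :: "('g, 'm) monoid_scheme" and H :: "('h, 'n) monoid_scheme" +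
  assumes units: "[order G] \<cdot> \<one> \<in> Units R" "[order H] \<cdot> \<one> \<in> Units R"
begin

abbreviation inv_G where "inv_G \<equiv> inv (R.nr (order G))"
abbreviation inv_H where "inv_H \<equiv> inv (R.nr (order H))"
abbreviation inv_card where "inv_card \<equiv> inv_G \<otimes> inv_H"

lemma inverses_closed [simp]: "inv_G \<in> carrier R" "inv_H \<in> carrier R" "inv_card \<in> carrier R"
  using units by (simp_all add: R.Units_inv_closed)

lemma inv_card_card_T: "inv_card \<otimes> R.nr (card (carrier (G \<times>\<times> H))) = \<one>"
proof -
  have "inv_card \<otimes> (R.nr (order G) \<otimes> R.nr (order H)) = (inv_G \<otimes> R.nr (order G)) \<otimes> (inv_H \<otimes> R.nr (order H))"
    by (simp add: R.m_ac)
  then show ?thesis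
    unfolding card_T R.nr_mult using units by (simp add: R.Units_l_inv)
qed

text \<open>
The linear extension of \<open>L \<mapsto> 1/|T| \<Sum>\<^sub>t tLt\<^sup>-\<^sup>1\<close>, with equal conjugates collected.
\<close>
definition average where
  "average u = (\<Oplus>\<^bsub>L.N\<^esub>L\<in>S. u L \<odot>\<^bsub>L.N\<^esub> (inv_card \<odot>\<^bsub>L.N\<^esub> L.vec (transporters L)))"

lemma average_closed: "u \<in> carrier L.N \<Longrightarrow> average u \<in> carrier L.N"
  unfolding average_def by (intro L.N.M.finsum_closed Pi_I L.smult_N_closed) auto

lemma coord_average:
  assumes "u \<in> carrier L.N" "N \<in> S"
  shows "average u N = (\<Oplus>L\<in>S. u L \<otimes> (inv_card \<otimes> R.nr (transporters L N)))"
proof -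
  have "average u N = (\<Oplus>L\<in>S. (u L \<odot>\<^bsub>L.N\<^esub> (inv_card \<odot>\<^bsub>L.N\<^esub> L.vec (transporters L))) N)"
    unfolding average_def by (rule L.coord_finsum[OF L.finite_S _ assms(2)]) (use assms in \<open>auto intro!: L.smult_N_closed\<close>)
  also have "\<dots> = (\<Oplus>L\<in>S. u L \<otimes> (inv_card \<otimes> R.nr (transporters L N)))"
    by (rule R.finsum_cong') (use assms in auto)
  finally show ?thesis .
qed

subsection \<open>The average is the projection onto the fixed points\<close>

lemma coord_conj_act:
  assumes u: "u \<in> carrier L.N" and x: "x \<in> carrier (G \<times>\<times> H)" and N: "N \<in> S"
  shows "conj_act R (G \<times>\<times> H) x u N = u (cj (inv\<^bsub>G \<times>\<times> H\<^esub> x) N)"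
proof -
  let ?N = "cj (inv\<^bsub>G \<times>\<times> H\<^esub> x) N"
  have N': "?N \<in> S" using conj_S[OF T.inv_closed[OF x] N] .
  have "conj_act R (G \<times>\<times> H) x u N = (\<Oplus>\<^bsub>L.N\<^esub>L\<in>S. u L \<odot>\<^bsub>L.N\<^esub> L.basis (cj x L)) N"
    by (simp add: conj_act_def subgroup_module_eq subgroup_basis_def)
  also have "\<dots> = (\<Oplus>L\<in>S. (u L \<odot>\<^bsub>L.N\<^esub> L.basis (cj x L)) N)"
    by (rule L.coord_finsum[OF L.finite_S _ N]) (use u in \<open>auto intro!: L.smult_N_closed L.basis_closed\<close>)
  also have "\<dots> = (\<Oplus>L\<in>S. if ?N = L then u L else \<zero>)"
  proof (rule R.finsum_cong')
    fix L assume L: "L \<in> S"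
    have "N = cj x L \<longleftrightarrow> ?N = L"
      using T.conjugate_inv_iff[OF x S_subset[OF L] S_subset[OF N]] by blast
    then show "(u L \<odot>\<^bsub>L.N\<^esub> L.basis (cj x L)) N = (if ?N = L then u L else \<zero>)"
      using u L N by (simp add: L.coord_basis)
  qed (use u in auto)
  also have "\<dots> = u ?N"
    by (rule R.finsum_singleton) (use u N' L.finite_S in auto)
  finally show ?thesis .
qed

lemma conj_act_closed:
  assumes "u \<in> carrier L.N"
  shows "conj_act R (G \<times>\<times> H) x u \<in> carrier L.N"
  unfolding conj_act_def subgroup_module_eq subgroup_basis_def
  using assms by (intro L.N.M.finsum_closed Pi_I L.smult_N_closed L.basis_closed) auto

lemma conj_fixed_iff:
  "u \<in> conj_fixed R (G \<times>\<times> H) \<longleftrightarrow> u \<in> carrier L.N \<and>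
    (\<forall>x\<in>carrier (G \<times>\<times> H). \<forall>N\<in>S. u (cj (inv\<^bsub>G \<times>\<times> H\<^esub> x) N) = u N)"
proof -
  have "conj_act R (G \<times>\<times> H) x u = u \<longleftrightarrow> (\<forall>N\<in>S. u (cj (inv\<^bsub>G \<times>\<times> H\<^esub> x) N) = u N)"
    if u: "u \<in> carrier L.N" and x: "x \<in> carrier (G \<times>\<times> H)" for x
  proof
    assume *: "conj_act R (G \<times>\<times> H) x u = u"
    show "\<forall>N\<in>S. u (cj (inv\<^bsub>G \<times>\<times> H\<^esub> x) N) = u N"
      using coord_conj_act[OF u x] unfolding * by simp
  next
    assume "\<forall>N\<in>S. u (cj (inv\<^bsub>G \<times>\<times> H\<^esub> x) N) = u N"
    then show "conj_act R (G \<times>\<times> H) x u = u"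
      by (intro L.N_eqI[OF conj_act_closed[OF u] u]) (simp only: coord_conj_act[OF u x])
  qed
  then show ?thesis by (simp only: conj_fixed_def subgroup_module_eq mem_Collect_eq cong: conj_cong ball_cong)
qed

lemma average_fixed: "u \<in> carrier L.N \<Longrightarrow> average u \<in> conj_fixed R (G \<times>\<times> H)"
  unfolding conj_fixed_iff
proof (intro conjI ballI average_closed)
  fix x N assume u: "u \<in> carrier L.N" and x: "x \<in> carrier (G \<times>\<times> H)" and N: "N \<in> S"
  have N': "cj (inv\<^bsub>G \<times>\<times> H\<^esub> x) N \<in> S" using conj_S[OF T.inv_closed[OF x] N] .
  show "average u (cj (inv\<^bsub>G \<times>\<times> H\<^esub> x) N) = average u N"
    unfolding coord_average[OF u N] coord_average[OF u N']
    by (rule R.finsum_cong') (use u transporters_conj[OF x _ N] in auto)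
qed

text \<open>
An invariant \<open>u\<close> is constant on conjugacy classes. Only conjugates \<open>L\<close> of \<open>N\<close> contribute to the
coordinate at \<open>N\<close>, so \<open>u(N)\<close> factors out, and the remaining weights sum to one.
\<close>
lemma average_of_fixed:
  assumes "u \<in> conj_fixed R (G \<times>\<times> H)"
  shows "average u = u"
proof -
  have u: "u \<in> carrier L.N" and fx: "\<And>x N. x \<in> carrier (G \<times>\<times> H) \<Longrightarrow> N \<in> S \<Longrightarrow> u (cj (inv\<^bsub>G \<times>\<times> H\<^esub> x) N) = u N"
    using assms unfolding conj_fixed_iff by blast+
  show ?thesis
  proof (rule L.N_eqI[OF average_closed[OF u] u])
    fix N assume N: "N \<in> S"
    have "average u N = (\<Oplus>L\<in>S. (u N \<otimes> inv_card) \<otimes> R.nr (transporters L N))"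
      unfolding coord_average[OF u N]
    proof (rule R.finsum_cong')
      fix L assume L: "L \<in> S"
      show "u L \<otimes> (inv_card \<otimes> R.nr (transporters L N)) = (u N \<otimes> inv_card) \<otimes> R.nr (transporters L N)"
      proof (cases "transporters L N = 0")
        case True
        then show ?thesis using u L N by simp
      next
        case False
        then have "{t \<in> carrier (G \<times>\<times> H). cj t L = N} \<noteq> {}"
          unfolding transporters_def by (rule contrapos_nn) (simp only: card.empty)
        then obtain t where t: "t \<in> carrier (G \<times>\<times> H)" "cj t L = N" by blast
        then have "L = cj (inv\<^bsub>G \<times>\<times> H\<^esub> t) N"
          using T.conjugate_inv_iff[OF t(1) S_subset[OF L] S_subset[OF N]] by blast
        then have "u L = u N" using fx[OF t(1) N] by (simp only:)
        then show ?thesis using u N by (simp add: R.m_assoc)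
      qed
    qed (use u N in auto)
    also have "\<dots> = (u N \<otimes> inv_card) \<otimes> (\<Oplus>L\<in>S. R.nr (transporters L N))"
      by (rule R.finsum_rdistr[symmetric]) (use u N L.finite_S in auto)
    also have "\<dots> = u N \<otimes> (inv_card \<otimes> R.nr (card (carrier (G \<times>\<times> H))))"
      unfolding R.nr_sum[symmetric] sum_transporters[OF N] using u N by (simp add: R.m_assoc)
    finally show "average u N = u N" using u N by (simp only: inv_card_card_T) simp
  qed
qed

lemma average_image: "average ` carrier L.N = conj_fixed R (G \<times>\<times> H)"
proof (intro equalityI subsetI)
  fix u assume "u \<in> conj_fixed R (G \<times>\<times> H)"
  then show "u \<in> average ` carrier L.N"
    using average_of_fixed[of u, symmetric] conj_fixed_iff[of u] by (intro image_eqI[of _ _ u]) blast+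
qed (use average_fixed in auto)

subsection \<open>The mark homomorphism has the transitive bisets as inverse\<close>

text \<open>
Counts determine classes, so the element chosen here is the class of \<open>T/L\<close>.
\<close>
definition transitive_class where
  "transitive_class L = (SOME z. z \<in> carrier BM \<and> (\<forall>N. card L * cm z N = transporters L N))"

lemma transitive_class:
  assumes "L \<in> S"
  shows "transitive_class L \<in> carrier BM" "card L * cm (transitive_class L) N = transporters L N"
proof -
  obtain X :: "('g, 'h, nat) biset" where X: "is_biset G H X" "\<And>N. card L * mark G H X N = transporters L N"
    using transitive_biset[OF assms] by blast
  then have "\<exists>z. z \<in> carrier BM \<and> (\<forall>N. card L * cm z N = transporters L N)"
    by (intro exI[of _ "iso_class G H X"]) (simp add: iso_class_in_carrier class_mark_iso_class)
  from someI_ex[OF this] show "transitive_class L \<in> carrier BM" "card L * cm (transitive_class L) N = transporters L N"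
    unfolding transitive_class_def by blast+
qed

text \<open>
The linear extension of \<open>L \<mapsto> |L|/|T| [T/L]\<close>.
\<close>
definition beta where
  "beta u = (\<Oplus>\<^bsub>RB.T\<^esub>L\<in>S. RB.pure (u L \<otimes> (inv_card \<otimes> R.nr (card L))) (cl (transitive_class L)))"

lemma beta_term: "u \<in> carrier L.N \<Longrightarrow> L \<in> S \<Longrightarrow> RB.pure (u L \<otimes> (inv_card \<otimes> R.nr (card L))) (cl (transitive_class L)) \<in> carrier RB.T"
  by (intro RB.pure_closed cl_closed transitive_class) auto

lemma beta_closed: "u \<in> carrier L.N \<Longrightarrow> beta u \<in> carrier RB.T"
  unfolding beta_def by (intro RB.T.finsum_closed Pi_I beta_term)

lemma beta_add:
  assumes "u \<in> carrier L.N" "v \<in> carrier L.N"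
  shows "beta (u \<oplus>\<^bsub>L.N\<^esub> v) = beta u \<oplus>\<^bsub>RB.T\<^esub> beta v"
proof -
  let ?f = "\<lambda>u L. RB.pure (u L \<otimes> (inv_card \<otimes> R.nr (card L))) (cl (transitive_class L))"
  have "beta (u \<oplus>\<^bsub>L.N\<^esub> v) = (\<Oplus>\<^bsub>RB.T\<^esub>L\<in>S. ?f u L \<oplus>\<^bsub>RB.T\<^esub> ?f v L)"
    unfolding beta_def
  proof (rule RB.T.finsum_cong')
    fix L assume L: "L \<in> S"
    then show "?f (u \<oplus>\<^bsub>L.N\<^esub> v) L = ?f u L \<oplus>\<^bsub>RB.T\<^esub> ?f v L"
      using assms transitive_class(1) by (simp add: R.l_distr RB.pure_add_left)
  qed (use assms beta_term in auto)
  also have "\<dots> = beta u \<oplus>\<^bsub>RB.T\<^esub> beta v"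
    unfolding beta_def by (rule RB.T.finsum_addf) (use assms beta_term in auto)
  finally show ?thesis .
qed

lemma alpha_carrier: "u \<in> carrier RB.T \<Longrightarrow> alpha R G H u \<in> carrier L.N"
  and alpha_add: "u \<in> carrier RB.T \<Longrightarrow> v \<in> carrier RB.T \<Longrightarrow> alpha R G H (u \<oplus>\<^bsub>RB.T\<^esub> v) = alpha R G H u \<oplus>\<^bsub>L.N\<^esub> alpha R G H v"
  and alpha_smult: "r \<in> carrier R \<Longrightarrow> u \<in> carrier RB.T \<Longrightarrow> alpha R G H (r \<odot>\<^bsub>RB.T\<^esub> u) = r \<odot>\<^bsub>L.N\<^esub> alpha R G H u"
  using alpha_linear unfolding burnside_module_eq linear_maps_def by auto

lemma alpha_beta:
  assumes u: "u \<in> carrier L.N"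
  shows "alpha R G H (beta u) = average u"
proof -
  have "alpha R G H (beta u) = (\<Oplus>\<^bsub>L.N\<^esub>L\<in>S. alpha R G H (RB.pure (u L \<otimes> (inv_card \<otimes> R.nr (card L))) (cl (transitive_class L))))"
    unfolding beta_def
    by (rule additive_finsum[OF RB.T.abelian_group_axioms L.abelian_group_N _ alpha_add L.finite_S])
       (use u alpha_carrier beta_term in auto)
  also have "\<dots> = average u"
    unfolding average_def
  proof (rule L.N.M.finsum_cong')
    fix L assume L: "L \<in> S"
    have "R.nr (card L) \<odot>\<^bsub>L.N\<^esub> L.vec (cm (transitive_class L)) = L.vec (transporters L)"
      by (rule L.N_eqI) (simp_all add: L.smult_N_closed transitive_class(2)[OF L, symmetric] R.nr_mult)
    then show "alpha R G H (RB.pure (u L \<otimes> (inv_card \<otimes> R.nr (card L))) (cl (transitive_class L))) = u L \<odot>\<^bsub>L.N\<^esub> (inv_card \<odot>\<^bsub>L.N\<^esub> L.vec (transporters L))"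
      using u L by (simp add: alpha_pure transitive_class(1) L.N.smult_assoc1)
  qed (use u in \<open>auto intro!: L.smult_N_closed\<close>)
  finally show ?thesis .
qed

text \<open>
The Burnside group is written multiplicatively here. The identity clears the denominator in
\<open>[X] = \<Sum>\<^sub>x |stab x|/|T| [T/stab x]\<close>, which merely splits \<open>X\<close> into its orbits; both sides
are classes of bisets and are compared through their counts.
\<close>
lemma transitive_decomposition:
  assumes x: "x \<in> carrier BM"
  shows "(\<Otimes>\<^bsub>B.Q\<^esub>L\<in>S. cl (transitive_class L) [^]\<^bsub>B.Q\<^esub> (cm x L * card L)) = cl x [^]\<^bsub>B.Q\<^esub> card (carrier (G \<times>\<times> H))"
proof -
  obtain z where z: "z \<in> carrier BM" "cm z = (\<lambda>N. \<Sum>L\<in>S. cm x L * card L * cm (transitive_class L) N)"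
    "cl z = (\<Otimes>\<^bsub>B.Q\<^esub>L\<in>S. cl (transitive_class L) [^]\<^bsub>B.Q\<^esub> (cm x L * card L))"
    by (rule cl_finprod[where n = "\<lambda>L. cm x L * card L" and x = transitive_class, OF L.finite_S transitive_class(1)])
  obtain w where w: "w \<in> carrier BM" "cm w = (\<lambda>L. card (carrier (G \<times>\<times> H)) * cm x L)"
    "cl w = cl x [^]\<^bsub>B.Q\<^esub> card (carrier (G \<times>\<times> H))"
    using cl_pow[OF x] by blast
  obtain X :: "('g, 'h, nat) biset" where X: "is_biset G H X" "cm x = mark G H X"
    using BM_cases[OF x] by blast
  have "cm z N = cm w N" for N
  proof -
    have "cm z N = (\<Sum>L\<in>S. cm x L * transporters L N)"
      unfolding z(2) by (rule sum.cong) (simp_all add: transitive_class(2)[symmetric] mult.assoc)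
    then show ?thesis unfolding w(2) X(2) using sum_mark_transporters[OF X(1)] by simp
  qed
  then have "z = w" using class_mark_inj[OF z(1) w(1)] by blast
  then show ?thesis using z(3) w(3) by (simp only:)
qed

lemma beta_alpha:
  assumes u: "u \<in> carrier RB.T"
  shows "beta (alpha R G H u) = u"
proof (rule additive_maps_eq[OF RB.T.abelian_group_axioms _ _ _ _ _ u, where f = "\<lambda>u. beta (alpha R G H u)" and g = "\<lambda>u. u"])
  fix r x assume r: "r \<in> carrier R" and x: "x \<in> carrier BM"
  have p: "cl (transitive_class L) [^]\<^bsub>B.Q\<^esub> n \<in> carrier B.Q" if "L \<in> S" for L and n :: nat
    using transitive_class(1)[OF that] by (intro BG.nat_pow_closed cl_closed)
  have "beta (alpha R G H (RB.pure r (cl x))) = (\<Oplus>\<^bsub>RB.T\<^esub>L\<in>S. RB.pure (r \<otimes> inv_card) (cl (transitive_class L) [^]\<^bsub>B.Q\<^esub> (cm x L * card L)))"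
    unfolding beta_def alpha_pure[OF r x]
  proof (rule RB.T.finsum_cong')
    fix L assume L: "L \<in> S"
    have "r \<otimes> R.nr (cm x L) \<otimes> (inv_card \<otimes> R.nr (card L)) = [(cm x L * card L)] \<cdot> (r \<otimes> inv_card)"
      using r by (subst R.add_pow_eq_nr) (simp_all add: R.nr_mult R.m_ac)
    then show "RB.pure ((r \<odot>\<^bsub>L.N\<^esub> L.vec (cm x)) L \<otimes> (inv_card \<otimes> R.nr (card L))) (cl (transitive_class L))
        = RB.pure (r \<otimes> inv_card) (cl (transitive_class L) [^]\<^bsub>B.Q\<^esub> (cm x L * card L))"
      using r L transitive_class(1)[OF L] by (simp add: RB.pure_pow)
  qed (use r p in \<open>auto intro!: RB.pure_closed\<close>)
  also have "\<dots> = RB.pure (r \<otimes> inv_card) (\<Otimes>\<^bsub>B.Q\<^esub>L\<in>S. cl (transitive_class L) [^]\<^bsub>B.Q\<^esub> (cm x L * card L))"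
    by (rule RB.pure_finprod[symmetric]) (use r p L.finite_S in auto)
  also have "\<dots> = RB.pure (r \<otimes> inv_card) (cl x [^]\<^bsub>B.Q\<^esub> card (carrier (G \<times>\<times> H)))"
    by (simp only: transitive_decomposition[OF x])
  also have "\<dots> = RB.pure (r \<otimes> (inv_card \<otimes> R.nr (card (carrier (G \<times>\<times> H))))) (cl x)"
  proof -
    have "[card (carrier (G \<times>\<times> H))] \<cdot> (r \<otimes> inv_card) = r \<otimes> (inv_card \<otimes> R.nr (card (carrier (G \<times>\<times> H))))"
      using r by (subst R.add_pow_eq_nr) (simp_all add: R.m_ac)
    then show ?thesis using r x by (simp add: RB.pure_pow)
  qed
  also have "\<dots> = RB.pure r (cl x)" unfolding inv_card_card_T using r by simp
  finally show "beta (alpha R G H (RB.pure r (cl x))) = RB.pure r (cl x)" .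
qed (auto simp: alpha_carrier beta_closed alpha_add beta_add)

lemma alpha_inj: "inj_on (alpha R G H) (carrier RB.T)"
  by (rule inj_on_inverseI[of _ beta]) (rule beta_alpha)

lemma alpha_image: "alpha R G H ` carrier RB.T = average ` carrier L.N"
proof (intro equalityI subsetI)
  fix v assume "v \<in> alpha R G H ` carrier RB.T"
  then obtain u where u: "u \<in> carrier RB.T" "v = alpha R G H u" by blast
  have "average v = v" using alpha_beta[OF alpha_carrier[OF u(1)]] beta_alpha[OF u(1)] u(2) by simp
  then show "v \<in> average ` carrier L.N" using alpha_carrier[OF u(1)] u(2) by (metis image_eqI)
next
  fix v assume "v \<in> average ` carrier L.N"
  then obtain u where "u \<in> carrier L.N" "v = alpha R G H (beta u)" using alpha_beta by auto
  then show "v \<in> alpha R G H ` carrier RB.T" using beta_closed by blast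
qed

end

section \<open>The corner defined by the idempotents\<close>

text \<open>
The element \<open>(x, y) \<in> L\<close> is carried to \<open>(gxg\<^sup>-\<^sup>1, h\<^sup>-\<^sup>1yh)\<close>, because \<open>\<Delta>\<^sub>h\<close> stands on the right.
\<close>
lemma relcomp_twisted_diag:
  assumes "g \<in> carrier G" "h \<in> carrier H" "group G" "group H" "L \<subseteq> carrier (G \<times>\<times> H)"
  shows "twisted_diag G g O L O twisted_diag H h = conjugate (G \<times>\<times> H) (g, inv\<^bsub>H\<^esub> h) L"
proof -
  interpret G: group G by fact
  interpret H: group H by fact
  interpret T: group "G \<times>\<times> H" by (intro DirProd_group assms)
  have L: "x \<in> carrier G \<and> y \<in> carrier H" if "(x, y) \<in> L" for x y using that assms(5) by auto
  have inv: "inv\<^bsub>G \<times>\<times> H\<^esub> (g, inv\<^bsub>H\<^esub> h) = (inv\<^bsub>G\<^esub> g, h)"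
    using assms by (simp add: inv_DirProd)
  have "twisted_diag G g O L O twisted_diag H h
      = {(g \<otimes>\<^bsub>G\<^esub> x \<otimes>\<^bsub>G\<^esub> inv\<^bsub>G\<^esub> g, z) | x z. z \<in> carrier H \<and> (x, h \<otimes>\<^bsub>H\<^esub> z \<otimes>\<^bsub>H\<^esub> inv\<^bsub>H\<^esub> h) \<in> L}"
    unfolding twisted_diag_def using L by blast
  also have "\<dots> = {(g \<otimes>\<^bsub>G\<^esub> x \<otimes>\<^bsub>G\<^esub> inv\<^bsub>G\<^esub> g, inv\<^bsub>H\<^esub> h \<otimes>\<^bsub>H\<^esub> y \<otimes>\<^bsub>H\<^esub> h) | x y. (x, y) \<in> L}"
  proof (intro equalityI subsetI)
    fix p assume "p \<in> {(g \<otimes>\<^bsub>G\<^esub> x \<otimes>\<^bsub>G\<^esub> inv\<^bsub>G\<^esub> g, z) | x z. z \<in> carrier H \<and> (x, h \<otimes>\<^bsub>H\<^esub> z \<otimes>\<^bsub>H\<^esub> inv\<^bsub>H\<^esub> h) \<in> L}"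
    then obtain x z where p: "p = (g \<otimes>\<^bsub>G\<^esub> x \<otimes>\<^bsub>G\<^esub> inv\<^bsub>G\<^esub> g, z)" "z \<in> carrier H" "(x, h \<otimes>\<^bsub>H\<^esub> z \<otimes>\<^bsub>H\<^esub> inv\<^bsub>H\<^esub> h) \<in> L" by blast
    have "z = inv\<^bsub>H\<^esub> h \<otimes>\<^bsub>H\<^esub> (h \<otimes>\<^bsub>H\<^esub> z \<otimes>\<^bsub>H\<^esub> inv\<^bsub>H\<^esub> h) \<otimes>\<^bsub>H\<^esub> h"
      using p(2) assms(2) by (simp add: H.m_assoc)
    then show "p \<in> {(g \<otimes>\<^bsub>G\<^esub> x \<otimes>\<^bsub>G\<^esub> inv\<^bsub>G\<^esub> g, inv\<^bsub>H\<^esub> h \<otimes>\<^bsub>H\<^esub> y \<otimes>\<^bsub>H\<^esub> h) | x y. (x, y) \<in> L}"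
      using p(1,3) by blast
  next
    fix p assume "p \<in> {(g \<otimes>\<^bsub>G\<^esub> x \<otimes>\<^bsub>G\<^esub> inv\<^bsub>G\<^esub> g, inv\<^bsub>H\<^esub> h \<otimes>\<^bsub>H\<^esub> y \<otimes>\<^bsub>H\<^esub> h) | x y. (x, y) \<in> L}"
    then obtain x y where p: "p = (g \<otimes>\<^bsub>G\<^esub> x \<otimes>\<^bsub>G\<^esub> inv\<^bsub>G\<^esub> g, inv\<^bsub>H\<^esub> h \<otimes>\<^bsub>H\<^esub> y \<otimes>\<^bsub>H\<^esub> h)" "(x, y) \<in> L" by blast
    have y: "y \<in> carrier H" using L p(2) by blast
    have "h \<otimes>\<^bsub>H\<^esub> (inv\<^bsub>H\<^esub> h \<otimes>\<^bsub>H\<^esub> y \<otimes>\<^bsub>H\<^esub> h) \<otimes>\<^bsub>H\<^esub> inv\<^bsub>H\<^esub> h = y"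
      using y assms(2) by (simp add: H.m_assoc)
    moreover have "inv\<^bsub>H\<^esub> h \<otimes>\<^bsub>H\<^esub> y \<otimes>\<^bsub>H\<^esub> h \<in> carrier H" using y assms(2) by simp
    ultimately show "p \<in> {(g \<otimes>\<^bsub>G\<^esub> x \<otimes>\<^bsub>G\<^esub> inv\<^bsub>G\<^esub> g, z) | x z. z \<in> carrier H \<and> (x, h \<otimes>\<^bsub>H\<^esub> z \<otimes>\<^bsub>H\<^esub> inv\<^bsub>H\<^esub> h) \<in> L}"
      using p by auto
  qed
  also have "\<dots> = conjugate (G \<times>\<times> H) (g, inv\<^bsub>H\<^esub> h) L"
    unfolding T.conjugate_eq_image unfolding inv by force
  finally show ?thesis .
qed

lemma (in group) k1_twisted_diag: "g \<in> carrier G \<Longrightarrow> k1 G G (twisted_diag G g) = {\<one>}"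
  by (auto simp: k1_def twisted_diag_def)

lemma (in group) k2_twisted_diag: 
  assumes "g \<in> carrier G"
  shows "k2 G G (twisted_diag G g) = {\<one>}"
proof -
  have "x = \<one>" if x: "x \<in> carrier G" and e: "\<one> = g \<otimes> x \<otimes> inv g" for x
  proof -
    have "x = inv g \<otimes> (g \<otimes> x \<otimes> inv g) \<otimes> g" using assms x by (simp add: m_assoc)
    then show ?thesis unfolding e[symmetric] using assms by simp
  qed
  then show ?thesis using assms by (auto simp: k2_def twisted_diag_def)
qed

lemma (in group) stabilizer_regular_biset:
  assumes "x \<in> carrier G"
  shows "stabilizer (G \<times>\<times> G) (prod_act G G (regular_biset G)) x = twisted_diag G x"
proof -
  have "a \<otimes> x \<otimes> inv b = x \<longleftrightarrow> a = x \<otimes> b \<otimes> inv x" if "a \<in> carrier G" "b \<in> carrier G" for a b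
  proof
    assume e: "a \<otimes> x \<otimes> inv b = x"
    have "a = (a \<otimes> x \<otimes> inv b) \<otimes> b \<otimes> inv x" using that assms by (simp add: m_assoc)
    then show "a = x \<otimes> b \<otimes> inv x" unfolding e .
  next
    assume "a = x \<otimes> b \<otimes> inv x"
    then show "a \<otimes> x \<otimes> inv b = x" using that assms by (simp add: m_assoc)
  qed
  then show ?thesis
    using assms by (auto simp: stabilizer_def prod_act_def regular_biset_def twisted_diag_def)
qed

lemma (in group) twisted_diag_subgroup:
  assumes "g \<in> carrier G"
  shows "subgroup (twisted_diag G g) (G \<times>\<times> G)"
proof -
  interpret T: group "G \<times>\<times> G" by (intro DirProd_group is_group)
  have "twisted_diag G g = conjugate (G \<times>\<times> G) (g, \<one>) {(x, x) | x. x \<in> carrier G}"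
    unfolding T.conjugate_eq_image twisted_diag_def
    using assms by (force simp: inv_DirProd[OF is_group is_group])
  moreover have "subgroup {(x, x) | x. x \<in> carrier G} (G \<times>\<times> G)"
    by (rule T.subgroupI) (auto simp: inv_DirProd[OF is_group is_group])
  ultimately show ?thesis using T.conjugate_subgroup[of "(g, \<one>)"] assms by simp
qed

context ring_pair_unit begin

text \<open>
Read as the count of a family with one member, so that products with it are computed by \<open>star_vec\<close>.
\<close>
lemma basis_eq_vec: "L.basis L = L.vec (cnt {()} (\<lambda>_. L))"
proof -
  have "(\<Oplus>\<^bsub>L.N\<^esub>i\<in>{()}. L.basis L) = L.basis L"
    using L.N.M.finsum_insert[of "{}" "()" "\<lambda>_. L.basis L"] by (simp add: L.basis_closed)
  then show ?thesis
    using L.finsum_basis[of "{()}" "\<lambda>_. L"] by simp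
qed

text \<open>
The groups \<open>k\<^sub>2(\<Delta>\<^sub>g)\<close> and \<open>k\<^sub>1(\<Delta>\<^sub>h)\<close> are trivial, so every coefficient is \<open>1/|G|\<close> or \<open>1/|H|\<close>, and as
\<open>(g, h)\<close> varies the subgroups that occur are all conjugates of \<open>L\<close>. The passage from \<open>h\<close> to its inverse
is absorbed by reindexing the sum.
\<close>
lemma corner_basis:
  assumes L: "L \<in> S"
  shows "star_kappa R G H H (star_kappa R G G H (e_idem R G) (L.basis L)) (e_idem R H)
    = inv_card \<odot>\<^bsub>L.N\<^esub> L.vec (transporters L)"
proof -
  interpret GGH: ring_triple R G G H by unfold_locales (rule units fin)+
  interpret GHH: ring_triple R G H H by unfold_locales (rule units fin)+
  note sg = L[unfolded subgroups_of_def mem_Collect_eq]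
  have DG: "twisted_diag G g \<in> subgroups_of (G \<times>\<times> G)" if "g \<in> carrier G" for g
    using G.twisted_diag_subgroup[OF that] by (simp add: subgroups_of_def)
  have DH: "twisted_diag H h \<in> subgroups_of (H \<times>\<times> H)" if "h \<in> carrier H" for h
    using H.twisted_diag_subgroup[OF that] by (simp add: subgroups_of_def)
  have eG: "e_idem R G = GGH.RGH.L.vec (cnt (carrier G) (twisted_diag G))"
    unfolding e_idem_def GGH.RGH.subgroup_module_eq subgroup_basis_def by (rule GGH.RGH.L.finsum_basis[OF fin(1)])
  have eH: "e_idem R H = GHH.RHK.L.vec (cnt (carrier H) (twisted_diag H))"
    unfolding e_idem_def GHH.RHK.subgroup_module_eq subgroup_basis_def by (rule GHH.RHK.L.finsum_basis[OF fin(2)])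
  have DL: "twisted_diag G g O L \<in> S" if "g \<in> carrier G" for g
    using GGH.relcomp_S[OF DG[OF that] L] .
  have k1: "\<one>\<^bsub>G\<^esub> \<in> k1 G H L" and k2: "\<one>\<^bsub>H\<^esub> \<in> k2 G H M" if "M \<in> S" for M
    using subgroup.one_closed[OF sg] that[unfolded subgroups_of_def mem_Collect_eq, THEN subgroup.one_closed]
    by (simp_all add: k1_def k2_def)
  have c1: "conv G G H (cnt (carrier G) (twisted_diag G)) (cnt {()} (\<lambda>_. L)) = cnt (carrier G) (\<lambda>g. twisted_diag G g O L)"
  proof
    fix N
    show "conv G G H (cnt (carrier G) (twisted_diag G)) (cnt {()} (\<lambda>_. L)) N = cnt (carrier G) (\<lambda>g. twisted_diag G g O L) N"
      using GGH.conv_cnt[of "carrier G" "{()}" "twisted_diag G" "\<lambda>_. L" N] DG L k1[OF L]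
      by (simp add: fin cnt_eq_sum[of "carrier G" "\<lambda>g. twisted_diag G g O L"] of_bool_def)
         (rule sum.cong, simp_all add: G.k2_twisted_diag)
  qed
  have c2: "conv G H H (cnt (carrier G) (\<lambda>g. twisted_diag G g O L)) (cnt (carrier H) (twisted_diag H)) = transporters L"
  proof
    fix N
    let ?T = "G \<times>\<times> H"
    have "conv G H H (cnt (carrier G) (\<lambda>g. twisted_diag G g O L)) (cnt (carrier H) (twisted_diag H)) N
      = (\<Sum>g\<in>carrier G. \<Sum>h\<in>carrier H. of_bool (cj (g, inv\<^bsub>H\<^esub> h) L = N))"
    proof (subst GHH.conv_cnt)
      show "(\<Sum>g\<in>carrier G. \<Sum>h\<in>carrier H. if (twisted_diag G g O L) O twisted_diag H h = N then
            card (k2 G H (twisted_diag G g O L) \<inter> k1 H H (twisted_diag H h)) else 0)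
        = (\<Sum>g\<in>carrier G. \<Sum>h\<in>carrier H. of_bool (cj (g, inv\<^bsub>H\<^esub> h) L = N))"
    proof (intro sum.cong refl)
      fix g h assume gh: "g \<in> carrier G" "h \<in> carrier H"
      have "(twisted_diag G g O L) O twisted_diag H h = cj (g, inv\<^bsub>H\<^esub> h) L"
        unfolding O_assoc by (rule relcomp_twisted_diag[OF gh groups S_subset[OF L]])
      then show "(if (twisted_diag G g O L) O twisted_diag H h = N then
            card (k2 G H (twisted_diag G g O L) \<inter> k1 H H (twisted_diag H h)) else 0)
          = of_bool (cj (g, inv\<^bsub>H\<^esub> h) L = N)"
        using k2[OF DL[OF gh(1)]] by (simp add: H.k1_twisted_diag[OF gh(2)])
    qed
    qed (fact fin DL DH)+
    also have "\<dots> = (\<Sum>g\<in>carrier G. \<Sum>h\<in>carrier H. of_bool (cj (g, h) L = N))"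
    proof (rule sum.cong[OF refl])
      fix g
      have "bij_betw (\<lambda>h. inv\<^bsub>H\<^esub> h) (carrier H) (carrier H)"
        by (rule bij_betw_byWitness[where f' = "\<lambda>h. inv\<^bsub>H\<^esub> h"]) auto
      from sum.reindex_bij_betw[OF this, of "\<lambda>h. of_bool (cj (g, h) L = N) :: nat"]
      show "(\<Sum>h\<in>carrier H. of_bool (cj (g, inv\<^bsub>H\<^esub> h) L = N) :: nat) = (\<Sum>h\<in>carrier H. of_bool (cj (g, h) L = N))" .
    qed
    also have "\<dots> = (\<Sum>t\<in>carrier ?T. of_bool (cj t L = N))"
      unfolding sum.cartesian_product carrier_DirProd by (rule sum.cong) auto
    also have "\<dots> = transporters L N"
      using cnt_eq_sum[OF finite_T, of "\<lambda>t. cj t L" N] unfolding transporters_def cnt_def by (rule sym)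
    finally show "conv G H H (cnt (carrier G) (\<lambda>g. twisted_diag G g O L)) (cnt (carrier H) (twisted_diag H)) N = transporters L N" .
  qed
  show ?thesis
    unfolding eG eH basis_eq_vec GGH.star_vec c1
    using GHH.star_smult_left[OF L.vec_closed GHH.RHK.L.vec_closed inverses_closed(1)]
    by (simp add: GHH.star_vec c2 L.N.smult_assoc1)
qed

lemma corner_eq_average:
  assumes u: "u \<in> carrier L.N"
  shows "star_kappa R G H H (star_kappa R G G H (e_idem R G) u) (e_idem R H) = average u"
proof -
  interpret GGH: ring_triple R G G H by unfold_locales (rule units fin)+
  interpret GHH: ring_triple R G H H by unfold_locales (rule units fin)+
  have eG: "e_idem R G \<in> carrier GGH.RGH.L.N"
    unfolding e_idem_def GGH.RGH.subgroup_module_eq subgroup_basis_def GGH.RGH.L.finsum_basis[OF fin(1)] by simp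
  have eH: "e_idem R H \<in> carrier GHH.RHK.L.N"
    unfolding e_idem_def GHH.RHK.subgroup_module_eq subgroup_basis_def GHH.RHK.L.finsum_basis[OF fin(2)] by simp
  let ?f = "\<lambda>u. star_kappa R G H H (star_kappa R G G H (e_idem R G) u) (e_idem R H)"
  have c: "star_kappa R G G H (e_idem R G) u \<in> carrier L.N" if "u \<in> carrier L.N" for u
    using GGH.star_closed[OF eG that] .
  have "?f \<in> linear_maps R L.N L.N"
    unfolding linear_maps_def
  proof (intro CollectI conjI ballI Pi_I)
    show "?f u \<in> carrier L.N" if "u \<in> carrier L.N" for u
      using GHH.star_closed[OF c[OF that] eH] .
    show "?f (u \<oplus>\<^bsub>L.N\<^esub> v) = ?f u \<oplus>\<^bsub>L.N\<^esub> ?f v" if uv: "u \<in> carrier L.N" "v \<in> carrier L.N" for u v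
      unfolding GGH.star_add_right[OF eG uv] by (rule GHH.star_add_left[OF c[OF uv(1)] c[OF uv(2)] eH])
    show "?f (r \<odot>\<^bsub>L.N\<^esub> u) = r \<odot>\<^bsub>L.N\<^esub> ?f u" if ru: "r \<in> carrier R" "u \<in> carrier L.N" for r u
      unfolding GGH.star_smult_right[OF eG ru(2,1)] by (rule GHH.star_smult_left[OF c[OF ru(2)] eH ru(1)])
  qed
  from L.linear_map_on_basis[OF L.N.module_axioms this u]
  have "?f u = (\<Oplus>\<^bsub>L.N\<^esub>L\<in>S. u L \<odot>\<^bsub>L.N\<^esub> ?f (L.basis L))" .
  also have "\<dots> = average u"
    unfolding average_def
    by (rule L.N.M.finsum_cong') (use u corner_basis in \<open>auto intro!: L.smult_N_closed\<close>)
  finally show ?thesis .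
qed

lemma e_corner_eq: "e_corner R G H = average ` carrier L.N"
proof -
  have "e_corner R G H = (\<lambda>u. star_kappa R G H H (star_kappa R G G H (e_idem R G) u) (e_idem R H)) ` carrier L.N"
    by (auto simp: e_corner_def subgroup_module_eq)
  also have "\<dots> = average ` carrier L.N"
    by (rule image_cong) (simp_all add: corner_eq_average)
  finally show ?thesis .
qed

end

text \<open>
The isomorphism is \<open>\<alpha>\<close>. It is unital because the stabilizer of the point \<open>g\<close> of the regular biset is
\<open>\<Delta>\<^sub>g\<close>.
\<close>
lemma double_burnside_algebra_isomorphic_corner:
  assumes R: "cring R" and G: "group G" "finite (carrier G)" and unit: "[order G] \<cdot>\<^bsub>R\<^esub> \<one>\<^bsub>R\<^esub> \<in> Units R"
  shows "algebra_isomorphic R (double_burnside_algebra R G) (e_corner_algebra R G)"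
proof -
  interpret R: cring R by fact
  interpret GG: ring_pair_unit R G G
    by (intro ring_pair_unit.intro ring_pair.intro group_pair.intro ring_pair_unit_axioms.intro R G unit)
  interpret GGG: ring_triple R G G G
    by unfold_locales (rule G unit)+
  let ?A = "double_burnside_algebra R G" and ?E = "e_corner_algebra R G" and ?\<alpha> = "alpha R G G"
  have A: "carrier ?A = carrier GG.RB.T" "add ?A = add GG.RB.T" "smult ?A = smult GG.RB.T"
    "monoid.mult ?A = burnside_module_mult R G G G" "one ?A = burnside_module_class R G G (regular_biset G)"
    by (simp_all add: double_burnside_algebra_def GG.burnside_module_eq)
  have E: "carrier ?E = ?\<alpha> ` carrier GG.RB.T" "add ?E = add GG.L.N" "smult ?E = smult GG.L.N"
    "monoid.mult ?E = star_kappa R G G G" "one ?E = e_idem R G"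
    by (simp_all add: e_corner_algebra_def GG.subgroup_module_eq GG.e_corner_eq GG.alpha_image)
  have reg: "is_biset G G (regular_biset G)"
    using G(2) by (simp add: is_biset_def regular_biset_def GG.G.m_assoc)
  have "cnt (carrier G) (stabilizer (G \<times>\<times> G) (prod_act G G (regular_biset G))) = cnt (carrier G) (twisted_diag G)"
    by (rule cnt_cong) (rule GG.G.stabilizer_regular_biset)
  then have "mark G G (regular_biset G) = cnt (carrier G) (twisted_diag G)"
    by (simp add: mark_def) (simp add: regular_biset_def)
  moreover have "e_idem R G = GG.L.vec (cnt (carrier G) (twisted_diag G))"
    unfolding e_idem_def GG.subgroup_module_eq subgroup_basis_def by (rule GG.L.finsum_basis[OF G(2)])
  ultimately have one: "?\<alpha> (burnside_module_class R G G (regular_biset G)) = e_idem R G"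
    by (simp add: GG.burnside_module_class_eq GG.alpha_pure GG.iso_class_in_carrier[OF reg] GG.class_mark_iso_class[OF reg])
  have "?\<alpha> \<in> ring_iso ?A ?E"
    unfolding ring_iso_def ring_hom_def A E
    using GGG.alpha_mult GG.alpha_add one GG.alpha_inj by (auto simp: bij_betw_def)
  moreover have "?\<alpha> \<in> linear_maps R ?A ?E"
    unfolding linear_maps_def A E using GG.alpha_add GG.alpha_smult by auto
  ultimately show ?thesis unfolding algebra_isomorphic_def by blast
qed

theorem proposition3p7:
  fixes R :: "('r, 's) ring_scheme"
    and G :: "('g, 'm) monoid_scheme"
    and H :: "('h, 'n) monoid_scheme"
  assumes "cring R"
    and "group G" and "finite (carrier G)" and "[order G] \<cdot>\<^bsub>R\<^esub> \<one>\<^bsub>R\<^esub> \<in> Units R"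
    and "group H" and "finite (carrier H)" and "[order H] \<cdot>\<^bsub>R\<^esub> \<one>\<^bsub>R\<^esub> \<in> Units R"
  shows "(alpha R G H ` carrier (burnside_module R G H) = conj_fixed R (G \<times>\<times> H) \<and>
          conj_fixed R (G \<times>\<times> H) = e_corner R G H) \<and>
         algebra_isomorphic R (double_burnside_algebra R G) (e_corner_algebra R G)"
proof -
  interpret R: cring R by fact
  interpret GH: ring_pair_unit R G H
    by (intro ring_pair_unit.intro ring_pair.intro group_pair.intro ring_pair_unit_axioms.intro assms)
  have "alpha R G H ` carrier (burnside_module R G H) = conj_fixed R (G \<times>\<times> H)"
    by (simp add: GH.burnside_module_eq GH.alpha_image GH.average_image)
  moreover have "conj_fixed R (G \<times>\<times> H) = e_corner R G H"
    by (simp only: GH.e_corner_eq GH.average_image)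
  moreover have "algebra_isomorphic R (double_burnside_algebra R G) (e_corner_algebra R G)"
    by (rule double_burnside_algebra_isomorphic_corner) fact+
  ultimately show ?thesis by blast
qed

end
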